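(* Let $\mathcal A$ be a small category, $\mathbf A$ the category of presheaves of sets on $\mathcal A$, and $\mathcal C$ a cocomplete category. Let $a:A_1\to A_0$ be a morphism of $\mathbf A$ and consider the Cartesian square in $\mathbf A$ given by $A_2=A_1\times_{A_0}A_1$ with projections $a_1,a_2:A_2\to A_1$ (so $aa_1=aa_2$). Then the exchange condition holds for this square, i.e. the base change morphism $(a_2)_*a_1^*\Rightarrow a^*a_*$ of functors $\mathbf M(A_1)\to\mathbf M(A_1)$ is an isomorphism, if $\mathcal C$ is the category $\mathbf{Set}$ of sets, and more generally if $\mathcal C$ admits a (forgetful) functor $\Omega:\mathcal C\to\mathbf{Set}$ with a left adjoint $L$ such that $(L,\Omega)$ satisfies the conditions of Beck's monadicity theorem.
   Context: For $A\in\mathbf A$, $\int A$ is the Grothendieck construction: objects are pairs $(X,x)$ with $X\in\mathcal A$ and $x\in A(X)$; a morphism $(X,x)\to(Y,y)$ is a morphism $f\in\mathcal A(X,Y)$ with $A(f)(y)=x$. $\mathbf M$ is the fibred category over $\mathbf A$ whose fibre $\mathbf M(A)$ at $A$ is the category of functors $\int A\to\mathcal C$. For $a:A_1\to A_0$ in $\mathbf A$, $a^*:\mathbf M(A_0)\to\mathbf M(A_1)$ is the pull-back functor (precomposition with $\int A_1\to\int A_0$), and $a_*$ is its left adjoint (left Kan extension, given by the usual colimit), with unit $\eta^a$ and counit $\epsilon^a$. The base change morphism is $\epsilon^{a_2}a^*a_*\circ (a_2)_*a_1^*\eta^a:(a_2)_*a_1^*\Rightarrow a^*a_*$, using $a_1^*a^*=a_2^*a^*$.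 The conditions of Beck's theorem (Mac Lane, Categories for the Working Mathematician, VI.7, Theorem 1) are the equivalent conditions: the comparison functor from $\mathcal C$ to the category of algebras over the monad $\Omega L$ is an isomorphism; equivalently, $\Omega$ creates coequalizers for those parallel pairs whose image under $\Omega$ has a split (equivalently, absolute) coequalizer. *)

theory Defs
  imports Main "HOL-Library.FuncSet"
begin

unbundle cardinal_syntax

section \<open>Categories\<close>

text \<open>Composition is written in applicative order: \<open>Cmp C g f\<close> is \<open>g\<close> after \<open>f\<close>.\<close>

record ('o, 'm) cat =
  Obj :: "'o set"
  Arr :: "'m set"
  Dom :: "'m \<Rightarrow> 'o"
  Cod :: "'m \<Rightarrow> 'o"
  Ident :: "'o \<Rightarrow> 'm"
  Cmp :: "'m \<Rightarrow> 'm \<Rightarrow> 'm"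

definition hom :: "('o, 'm) cat \<Rightarrow> 'o \<Rightarrow> 'o \<Rightarrow> 'm set" where
  "hom C x y = {f \<in> Arr C. Dom C f = x \<and> Cod C f = y}"

locale category =
  fixes C :: "('o, 'm) cat"
  assumes Dom_Obj: "f \<in> Arr C \<Longrightarrow> Dom C f \<in> Obj C"
    and Cod_Obj: "f \<in> Arr C \<Longrightarrow> Cod C f \<in> Obj C"
    and Ident_hom: "x \<in> Obj C \<Longrightarrow> Ident C x \<in> hom C x x"
    and Cmp_hom: "f \<in> hom C x y \<Longrightarrow> g \<in> hom C y z \<Longrightarrow> Cmp C g f \<in> hom C x z"
    and Cmp_Ident: "f \<in> hom C x y \<Longrightarrow> Cmp C f (Ident C x) = f"
    and Ident_Cmp: "f \<in> hom C x y \<Longrightarrow> Cmp C (Ident C y) f = f"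
    and Cmp_assoc: "f \<in> hom C w x \<Longrightarrow> g \<in> hom C x y \<Longrightarrow> h \<in> hom C y z \<Longrightarrow>
      Cmp C h (Cmp C g f) = Cmp C (Cmp C h g) f"

definition op_cat :: "('o, 'm) cat \<Rightarrow> ('o, 'm) cat" where
  "op_cat C = C\<lparr>Dom := Cod C, Cod := Dom C, Cmp := (\<lambda>g f. Cmp C f g)\<rparr>"

definition is_iso :: "('o, 'm) cat \<Rightarrow> 'm \<Rightarrow> bool" where
  "is_iso C f \<longleftrightarrow> f \<in> Arr C \<and>
    (\<exists>g \<in> hom C (Cod C f) (Dom C f).
      Cmp C g f = Ident C (Dom C f) \<and> Cmp C f g = Ident C (Cod C f))"

definition cartesian_square :: "('o, 'm) cat \<Rightarrow> 'm \<Rightarrow> 'm \<Rightarrow> 'm \<Rightarrow> 'm \<Rightarrow> bool" where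
  "cartesian_square C p q f g \<longleftrightarrow>
    p \<in> Arr C \<and> q \<in> Arr C \<and> f \<in> Arr C \<and> g \<in> Arr C \<and>
    Dom C p = Dom C q \<and> Cod C p = Dom C f \<and> Cod C q = Dom C g \<and> Cod C f = Cod C g \<and>
    Cmp C f p = Cmp C g q \<and>
    (\<forall>w. \<forall>u \<in> hom C w (Cod C p). \<forall>v \<in> hom C w (Cod C q). Cmp C f u = Cmp C g v \<longrightarrow>
      (\<exists>!h. h \<in> hom C w (Dom C p) \<and> Cmp C p h = u \<and> Cmp C q h = v))"


section \<open>Functors and natural transformations\<close>

text \<open>The maps of a functor and the components of a natural transformation are required to be
  \<open>extensional\<close>, so that equality in HOL is equality of functors and of transformations.\<close>

record ('o, 'm, 'p, 'q) ftor =
  FObj :: "'o \<Rightarrow> 'p"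
  FArr :: "'m \<Rightarrow> 'q"

record ('o, 'm, 'p, 'q) ntrans =
  Src :: "('o, 'm, 'p, 'q) ftor"
  Tgt :: "('o, 'm, 'p, 'q) ftor"
  At :: "'o \<Rightarrow> 'q"

definition is_ftor :: "('o, 'm) cat \<Rightarrow> ('p, 'q) cat \<Rightarrow> ('o, 'm, 'p, 'q) ftor \<Rightarrow> bool" where
  "is_ftor C D F \<longleftrightarrow> category C \<and> category D \<and>
    FObj F \<in> Obj C \<rightarrow>\<^sub>E Obj D \<and> FArr F \<in> Arr C \<rightarrow>\<^sub>E Arr D \<and>
    (\<forall>f \<in> Arr C. Dom D (FArr F f) = FObj F (Dom C f) \<and> Cod D (FArr F f) = FObj F (Cod C f)) \<and>
    (\<forall>x \<in> Obj C. FArr F (Ident C x) = Ident D (FObj F x)) \<and>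
    (\<forall>f \<in> Arr C. \<forall>g \<in> Arr C. Cod C f = Dom C g \<longrightarrow>
      FArr F (Cmp C g f) = Cmp D (FArr F g) (FArr F f))"

definition id_ftor :: "('o, 'm) cat \<Rightarrow> ('o, 'm, 'o, 'm) ftor" where
  "id_ftor C = \<lparr>FObj = (\<lambda>x\<in>Obj C. x), FArr = (\<lambda>f\<in>Arr C. f)\<rparr>"

text \<open>The category argument of \<open>ftor_comp\<close> and of the two whiskerings below is the domain of the
  inner functor, respectively of the resulting transformation.\<close>

definition ftor_comp ::
  "('o, 'm) cat \<Rightarrow> ('p, 'q, 'r, 's) ftor \<Rightarrow> ('o, 'm, 'p, 'q) ftor \<Rightarrow> ('o, 'm, 'r, 's) ftor" where
  "ftor_comp C G F =
    \<lparr>FObj = (\<lambda>x\<in>Obj C. FObj G (FObj F x)), FArr = (\<lambda>f\<in>Arr C. FArr G (FArr F f))\<rparr>"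

definition is_ntrans :: "('o, 'm) cat \<Rightarrow> ('p, 'q) cat \<Rightarrow> ('o, 'm, 'p, 'q) ntrans \<Rightarrow> bool" where
  "is_ntrans C D t \<longleftrightarrow> is_ftor C D (Src t) \<and> is_ftor C D (Tgt t) \<and>
    At t \<in> extensional (Obj C) \<and>
    (\<forall>x \<in> Obj C. At t x \<in> hom D (FObj (Src t) x) (FObj (Tgt t) x)) \<and>
    (\<forall>f \<in> Arr C. Cmp D (At t (Cod C f)) (FArr (Src t) f) = Cmp D (FArr (Tgt t) f) (At t (Dom C f)))"

definition ftor_cat ::
  "('o, 'm) cat \<Rightarrow> ('p, 'q) cat \<Rightarrow> (('o, 'm, 'p, 'q) ftor, ('o, 'm, 'p, 'q) ntrans) cat" where
  "ftor_cat C D =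
    \<lparr>Obj = {F. is_ftor C D F}, Arr = {t. is_ntrans C D t}, Dom = Src, Cod = Tgt,
     Ident = (\<lambda>F. \<lparr>Src = F, Tgt = F, At = (\<lambda>x\<in>Obj C. Ident D (FObj F x))\<rparr>),
     Cmp = (\<lambda>s t. \<lparr>Src = Src t, Tgt = Tgt s, At = (\<lambda>x\<in>Obj C. Cmp D (At s x) (At t x))\<rparr>)\<rparr>"

definition whisker_left ::
  "('o, 'm) cat \<Rightarrow> ('p, 'q, 'r, 's) ftor \<Rightarrow> ('o, 'm, 'p, 'q) ntrans \<Rightarrow> ('o, 'm, 'r, 's) ntrans" where
  "whisker_left C H t =
    \<lparr>Src = ftor_comp C H (Src t), Tgt = ftor_comp C H (Tgt t), At = (\<lambda>x\<in>Obj C. FArr H (At t x))\<rparr>"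

definition whisker_right ::
  "('o, 'm) cat \<Rightarrow> ('p, 'q, 'r, 's) ntrans \<Rightarrow> ('o, 'm, 'p, 'q) ftor \<Rightarrow> ('o, 'm, 'r, 's) ntrans" where
  "whisker_right C t H =
    \<lparr>Src = ftor_comp C (Src t) H, Tgt = ftor_comp C (Tgt t) H, At = (\<lambda>x\<in>Obj C. At t (FObj H x))\<rparr>"

text \<open>\<open>adjunction C D F G \<eta> \<epsilon>\<close>: the functor \<open>F : C \<rightarrow> D\<close> is left adjoint to \<open>G : D \<rightarrow> C\<close>,
  with unit \<open>\<eta>\<close> and counit \<open>\<epsilon>\<close>.\<close>

definition adjunction ::
  "('o, 'm) cat \<Rightarrow> ('p, 'q) cat \<Rightarrow> ('o, 'm, 'p, 'q) ftor \<Rightarrow> ('p, 'q, 'o, 'm) ftor \<Rightarrow>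
   ('o, 'm, 'o, 'm) ntrans \<Rightarrow> ('p, 'q, 'p, 'q) ntrans \<Rightarrow> bool" where
  "adjunction C D F G \<eta> \<epsilon> \<longleftrightarrow> is_ftor C D F \<and> is_ftor D C G \<and>
    \<eta> \<in> hom (ftor_cat C C) (id_ftor C) (ftor_comp C G F) \<and>
    \<epsilon> \<in> hom (ftor_cat D D) (ftor_comp D F G) (id_ftor D) \<and>
    (\<forall>x \<in> Obj C. Cmp D (At \<epsilon> (FObj F x)) (FArr F (At \<eta> x)) = Ident D (FObj F x)) \<and>
    (\<forall>y \<in> Obj D. Cmp C (FArr G (At \<epsilon> y)) (At \<eta> (FObj G y)) = Ident C (FObj G y))"

definition is_cat_iso :: "('o, 'm) cat \<Rightarrow> ('p, 'q) cat \<Rightarrow> ('o, 'm, 'p, 'q) ftor \<Rightarrow> bool" where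
  "is_cat_iso C D F \<longleftrightarrow> is_ftor C D F \<and>
    (\<exists>G. is_ftor D C G \<and> ftor_comp C G F = id_ftor C \<and> ftor_comp D F G = id_ftor D)"


section \<open>Smallness, sets and cocompleteness\<close>

text \<open>The size of the universe is an infinite regular cardinal \<open>\<kappa>\<close> carried by the type \<open>'u\<close>, and
  ``small'' means of cardinality less than \<open>\<kappa>\<close>.  For an inaccessible \<open>\<kappa>\<close> this is smallness with
  respect to a Grothendieck universe; that stronger requirement is not imposed.\<close>

definition infinite_regular :: "'u rel \<Rightarrow> bool" where
  "infinite_regular \<kappa> \<longleftrightarrow> Card_order \<kappa> \<and> cinfinite \<kappa> \<and> regularCard \<kappa>"

definition small_category :: "'u rel \<Rightarrow> ('o, 'm) cat \<Rightarrow> bool" where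
  "small_category \<kappa> J \<longleftrightarrow> category J \<and> |Obj J| <o \<kappa> \<and> |Arr J| <o \<kappa>"

text \<open>An arrow of the category of sets is a triple consisting of source, (extensional) map and
  target.  Since the field of \<open>\<kappa>\<close> is contained in \<open>'u\<close>, every set of cardinality less than \<open>\<kappa>\<close>,
  of whatever type, is in bijection with an object of \<open>Set_cat \<kappa>\<close>.\<close>

type_synonym 'u set_arr = "'u set \<times> ('u \<Rightarrow> 'u) \<times> 'u set"

abbreviation set_map :: "'u set_arr \<Rightarrow> 'u \<Rightarrow> 'u" where
  "set_map \<phi> \<equiv> fst (snd \<phi>)"

definition Set_cat :: "'u rel \<Rightarrow> ('u set, 'u set_arr) cat" where
  "Set_cat \<kappa> =
    \<lparr>Obj = {X. |X| <o \<kappa>},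
     Arr = {(X, \<phi>, Y). |X| <o \<kappa> \<and> |Y| <o \<kappa> \<and> \<phi> \<in> X \<rightarrow>\<^sub>E Y},
     Dom = fst,
     Cod = (\<lambda>u. snd (snd u)),
     Ident = (\<lambda>X. (X, \<lambda>x\<in>X. x, X)),
     Cmp = (\<lambda>v u. (fst u, compose (fst u) (set_map v) (set_map u), snd (snd v)))\<rparr>"

definition is_cocone ::
  "('i, 'j) cat \<Rightarrow> ('o, 'm) cat \<Rightarrow> ('i, 'j, 'o, 'm) ftor \<Rightarrow> 'o \<Rightarrow> ('i \<Rightarrow> 'm) \<Rightarrow> bool" where
  "is_cocone J C D c \<mu> \<longleftrightarrow> c \<in> Obj C \<and> (\<forall>j \<in> Obj J. \<mu> j \<in> hom C (FObj D j) c) \<and>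
    (\<forall>f \<in> Arr J. Cmp C (\<mu> (Cod J f)) (FArr D f) = \<mu> (Dom J f))"

definition is_colimit ::
  "('i, 'j) cat \<Rightarrow> ('o, 'm) cat \<Rightarrow> ('i, 'j, 'o, 'm) ftor \<Rightarrow> 'o \<Rightarrow> ('i \<Rightarrow> 'm) \<Rightarrow> bool" where
  "is_colimit J C D c \<mu> \<longleftrightarrow> is_cocone J C D c \<mu> \<and>
    (\<forall>c' \<mu>'. is_cocone J C D c' \<mu>' \<longrightarrow>
      (\<exists>!h. h \<in> hom C c c' \<and> (\<forall>j \<in> Obj J. Cmp C h (\<mu> j) = \<mu>' j)))"

text \<open>Every small category is isomorphic to one whose objects and arrows are elements of \<open>'u\<close>,
  so it suffices to take index categories of that type.\<close>

definition cocomplete :: "'u rel \<Rightarrow> ('o, 'm) cat \<Rightarrow> bool" where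
  "cocomplete \<kappa> C \<longleftrightarrow> category C \<and>
    (\<forall>(J :: ('u, 'u) cat) D. small_category \<kappa> J \<and> is_ftor J C D \<longrightarrow>
      (\<exists>c \<mu>. is_colimit J C D c \<mu>))"


section \<open>Monads and the hypothesis of Beck's theorem\<close>

text \<open>The category of algebras over a monad \<open>(T, \<eta>, \<mu>)\<close> on \<open>X\<close>; an algebra is a pair \<open>(x, h)\<close>
  with structure map \<open>h : T x \<rightarrow> x\<close>.\<close>

definition is_algebra ::
  "('o, 'm) cat \<Rightarrow> ('o, 'm, 'o, 'm) ftor \<Rightarrow> ('o, 'm, 'o, 'm) ntrans \<Rightarrow> ('o, 'm, 'o, 'm) ntrans \<Rightarrow>
   'o \<times> 'm \<Rightarrow> bool" where
  "is_algebra X T \<eta> \<mu> = (\<lambda>(x, h). x \<in> Obj X \<and> h \<in> hom X (FObj T x) x \<and>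
    Cmp X h (At \<eta> x) = Ident X x \<and> Cmp X h (At \<mu> x) = Cmp X h (FArr T h))"

definition alg_cat ::
  "('o, 'm) cat \<Rightarrow> ('o, 'm, 'o, 'm) ftor \<Rightarrow> ('o, 'm, 'o, 'm) ntrans \<Rightarrow> ('o, 'm, 'o, 'm) ntrans \<Rightarrow>
   ('o \<times> 'm, ('o \<times> 'm) \<times> 'm \<times> ('o \<times> 'm)) cat" where
  "alg_cat X T \<eta> \<mu> =
    \<lparr>Obj = {A. is_algebra X T \<eta> \<mu> A},
     Arr = {(A, f, B). is_algebra X T \<eta> \<mu> A \<and> is_algebra X T \<eta> \<mu> B \<and>
       f \<in> hom X (fst A) (fst B) \<and> Cmp X f (snd A) = Cmp X (snd B) (FArr T f)},
     Dom = fst,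
     Cod = (\<lambda>u. snd (snd u)),
     Ident = (\<lambda>A. (A, Ident X (fst A), A)),
     Cmp = (\<lambda>v u. (fst u, Cmp X (fst (snd v)) (fst (snd u)), snd (snd v)))\<rparr>"

text \<open>For an adjunction \<open>L \<stileturn> \<Omega>\<close> with \<open>L : X \<rightarrow> C\<close>, unit \<open>\<eta>\<close> and counit \<open>\<epsilon>\<close>, the monad on \<open>X\<close> is
  \<open>(\<Omega> L, \<eta>, \<Omega> \<epsilon> L)\<close>, and the comparison functor sends \<open>c\<close> to \<open>(\<Omega> c, \<Omega> \<epsilon>\<^sub>c)\<close>.\<close>

definition adj_alg_cat where
  "adj_alg_cat X L \<Omega> \<eta> \<epsilon> =
    alg_cat X (ftor_comp X \<Omega> L) \<eta> (whisker_left X \<Omega> (whisker_right X \<epsilon> L))"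

definition comparison_ftor ::
  "('p, 'q) cat \<Rightarrow> ('p, 'q, 'o, 'm) ftor \<Rightarrow> ('p, 'q, 'p, 'q) ntrans \<Rightarrow>
   ('p, 'q, 'o \<times> 'm, ('o \<times> 'm) \<times> 'm \<times> ('o \<times> 'm)) ftor" where
  "comparison_ftor C \<Omega> \<epsilon> =
    (let K = (\<lambda>c. (FObj \<Omega> c, FArr \<Omega> (At \<epsilon> c)))
     in \<lparr>FObj = (\<lambda>c\<in>Obj C. K c), FArr = (\<lambda>f\<in>Arr C. (K (Dom C f), FArr \<Omega> f, K (Cod C f)))\<rparr>)"

definition beck_monadic where
  "beck_monadic X C L \<Omega> \<eta> \<epsilon> \<longleftrightarrow> adjunction X C L \<Omega> \<eta> \<epsilon> \<and>
    is_cat_iso C (adj_alg_cat X L \<Omega> \<eta> \<epsilon>) (comparison_ftor C \<Omega> \<epsilon>)"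


section \<open>Presheaves and the Grothendieck construction\<close>

type_synonym ('o, 'm, 'u) presheaf = "('o, 'm, 'u set, 'u set_arr) ftor"
type_synonym ('o, 'm, 'u) presheaf_arr = "('o, 'm, 'u set, 'u set_arr) ntrans"

definition presheaf_cat ::
  "'u rel \<Rightarrow> ('o, 'm) cat \<Rightarrow> (('o, 'm, 'u) presheaf, ('o, 'm, 'u) presheaf_arr) cat" where
  "presheaf_cat \<kappa> \<A> = ftor_cat (op_cat \<A>) (Set_cat \<kappa>)"

text \<open>The same \<open>f\<close> can underlie several arrows of the category of elements, so an arrow
  also records its source and target.\<close>

type_synonym ('o, 'm, 'u) elem_arr = "('o \<times> 'u) \<times> 'm \<times> ('o \<times> 'u)"

definition elements ::
  "('o, 'm) cat \<Rightarrow> ('o, 'm, 'u) presheaf \<Rightarrow> ('o \<times> 'u, ('o, 'm, 'u) elem_arr) cat" where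
  "elements \<A> A =
    \<lparr>Obj = {(X, x). X \<in> Obj \<A> \<and> x \<in> FObj A X},
     Arr = {((X, x), f, (Y, y)). f \<in> hom \<A> X Y \<and> x \<in> FObj A X \<and> y \<in> FObj A Y \<and>
       set_map (FArr A f) y = x},
     Dom = fst,
     Cod = (\<lambda>u. snd (snd u)),
     Ident = (\<lambda>p. (p, Ident \<A> (fst p), p)),
     Cmp = (\<lambda>v u. (fst u, Cmp \<A> (fst (snd v)) (fst (snd u)), snd (snd v)))\<rparr>"

definition elements_map ::
  "('o, 'm) cat \<Rightarrow> ('o, 'm, 'u) presheaf_arr \<Rightarrow>
   ('o \<times> 'u, ('o, 'm, 'u) elem_arr, 'o \<times> 'u, ('o, 'm, 'u) elem_arr) ftor" where
  "elements_map \<A> a =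
    (let E = (\<lambda>(X, x). (X, set_map (At a X) x))
     in \<lparr>FObj = (\<lambda>p \<in> Obj (elements \<A> (Src a)). E p),
         FArr = (\<lambda>(p, f, q) \<in> Arr (elements \<A> (Src a)). (E p, f, E q))\<rparr>)"


section \<open>The fibres of \<open>M\<close> and the exchange condition\<close>

definition fibre where
  "fibre \<A> C A = ftor_cat (elements \<A> A) C"

definition precomp_ftor ::
  "('i, 'j) cat \<Rightarrow> ('k, 'l) cat \<Rightarrow> ('o, 'm) cat \<Rightarrow> ('i, 'j, 'k, 'l) ftor \<Rightarrow>
   (('k, 'l, 'o, 'm) ftor, ('k, 'l, 'o, 'm) ntrans, ('i, 'j, 'o, 'm) ftor, ('i, 'j, 'o, 'm) ntrans) ftor"
  where
  "precomp_ftor I J C K =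
    \<lparr>FObj = (\<lambda>F \<in> Obj (ftor_cat J C). ftor_comp I F K),
     FArr = (\<lambda>t \<in> Arr (ftor_cat J C). whisker_right I t K)\<rparr>"

definition pullback where
  "pullback \<A> C a =
    precomp_ftor (elements \<A> (Src a)) (elements \<A> (Tgt a)) C (elements_map \<A> a)"

text \<open>Here \<open>l\<close> and \<open>l\<^sub>2\<close> are left adjoints of the pull-backs along \<open>a\<close> and \<open>a\<^sub>2\<close>, with unit \<open>\<eta>\<close> of
  the former and counit \<open>\<epsilon>\<^sub>2\<close> of the latter; the two whiskered transformations are composable because
  pulling back along \<open>a a\<^sub>1 = a a\<^sub>2\<close> gives the same functor either way.\<close>

definition base_change where
  "base_change \<A> C a a\<^sub>1 a\<^sub>2 l \<eta> l\<^sub>2 \<epsilon>\<^sub>2 =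
    (let M\<^sub>1 = fibre \<A> C (Src a)
     in Cmp (ftor_cat M\<^sub>1 M\<^sub>1)
          (whisker_right M\<^sub>1 \<epsilon>\<^sub>2 (ftor_comp M\<^sub>1 (pullback \<A> C a) l))
          (whisker_left M\<^sub>1 (ftor_comp M\<^sub>1 l\<^sub>2 (pullback \<A> C a\<^sub>1)) \<eta>))"

text \<open>The left adjoints are determined only up to isomorphism, so the condition is stated for every
  choice of them together with their units and counits.\<close>

definition exchange_condition where
  "exchange_condition \<A> C a a\<^sub>1 a\<^sub>2 \<longleftrightarrow>
    (let M\<^sub>0 = fibre \<A> C (Tgt a); M\<^sub>1 = fibre \<A> C (Src a); M\<^sub>2 = fibre \<A> C (Src a\<^sub>2)
     in \<forall>l \<eta> \<epsilon> l\<^sub>2 \<eta>\<^sub>2 \<epsilon>\<^sub>2.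
          adjunction M\<^sub>1 M\<^sub>0 l (pullback \<A> C a) \<eta> \<epsilon> \<and>
          adjunction M\<^sub>2 M\<^sub>1 l\<^sub>2 (pullback \<A> C a\<^sub>2) \<eta>\<^sub>2 \<epsilon>\<^sub>2 \<longrightarrow>
          is_iso (ftor_cat M\<^sub>1 M\<^sub>1) (base_change \<A> C a a\<^sub>1 a\<^sub>2 l \<eta> l\<^sub>2 \<epsilon>\<^sub>2))"

end

(*
  Write el A for the category of elements of a presheaf A.  The functor el A1 -> el A0 induced by
  a is a discrete fibration: an arrow of el A0 into the image of q lifts uniquely to an arrow into
  q.  As A2 is a pointwise pullback (by the Yoneda lemma), the comma category of el a2 over q is
  therefore isomorphic to that of el a over the image of q.  When C is cocomplete, left adjoints of
  pull-backs are pointwise Kan extensions, so at each object the base change morphism compares two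
  colimits of the same diagram.
*)

theory Submission
  imports Defs
begin

section \<open>Smallness\<close>

text \<open>The exchange condition ranges over all left adjoints with arbitrary units and counits,
  so no formula for \<open>l\<close> or \<open>l\<^sub>2\<close> is at hand. The universal property
  still fixes the base change morphism: its component at \<open>F\<close> is the transpose, under
  the adjunction of \<open>l\<^sub>2\<close>, of the unit \<eta> at \<open>F\<close> whiskered with
  the functor induced by \<open>a\<^sub>1\<close>. Composing it with the unit of
  \<open>l\<^sub>2\<close> gives this whiskered unit back, and that evaluates it on every
  coprojection of the colimit at its source.

  The square is Cartesian only through a universal property among presheaves, while arrows are
  lifted with elements. Let q = (Y, y). An object of the comma category over the image of q is an
  element x of \<open>A\<^sub>1\<close> at X with an arrow f from X to Y such that x and the
  restriction of y along f have the same image in \<open>A\<^sub>0\<close>. This pair is the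
  required element of \<open>A\<^sub>2\<close>.

  The index categories met on the way do not live on the type 'u to which \<open>cocomplete\<close>
  refers, so colimits have to be transported along injections into 'u.\<close>

lemma small_subset: "A \<subseteq> B \<Longrightarrow> |B| <o \<kappa> \<Longrightarrow> |A| <o \<kappa>"
  by (meson card_of_mono1 ordLeq_ordLess_trans)

lemma small_image: "|A| <o \<kappa> \<Longrightarrow> |f ` A| <o \<kappa>"
  by (meson card_of_image ordLeq_ordLess_trans)

text \<open>Regularity of \<kappa> enters here: an infinite regular cardinal is
  \<open>stable\<close>, that is, closed under sums of fewer than \<kappa> sets that are each
  smaller than \<kappa>.\<close>

lemma small_Sigma:
  assumes "infinite_regular \<kappa>" and "|I| <o \<kappa>" and "\<And>i. i \<in> I \<Longrightarrow> |A i| <o \<kappa>"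
  shows "|Sigma I A| <o \<kappa>"
proof -
  have "stable \<kappa>"
    using assms(1) regularCard_stable unfolding infinite_regular_def cinfinite_def by blast
  then show ?thesis using stable_elim assms(2,3) by blast
qed

lemma small_Times:
  assumes "infinite_regular \<kappa>" and "|A| <o \<kappa>" and "|B| <o \<kappa>"
  shows "|A \<times> B| <o \<kappa>"
  using assms by (intro small_Sigma)

text \<open>A cardinal order is equipotent to its field, which is a set of elements of 'u. The
  injection serves to encode index categories, hom-sets and quotients inside 'u.\<close>

lemma small_embedding:
  fixes \<kappa> :: "'u rel" and A :: "'a set"
  assumes "infinite_regular \<kappa>" and "|A| <o \<kappa>"
  obtains e :: "'a \<Rightarrow> 'u" where "inj_on e A"
proof -
  have "|Field \<kappa>| =o \<kappa>"
    using assms(1) card_of_Field_ordIso unfolding infinite_regular_def by blast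
  then have "|A| \<le>o |Field \<kappa>|"
    using assms(2) ordLess_imp_ordLeq ordIso_symmetric ordLeq_ordIso_trans by blast
  then show ?thesis using that card_of_ordLeq[of A "Field \<kappa>"] by blast
qed


section \<open>Categories, functors and transformations\<close>

lemma homD:
  assumes "f \<in> hom C x y"
  shows "f \<in> Arr C" "Dom C f = x" "Cod C f = y"
  using assms by (simp_all add: hom_def)

lemma Arr_hom: "f \<in> Arr C \<Longrightarrow> f \<in> hom C (Dom C f) (Cod C f)"
  by (simp add: hom_def)

lemma (in category) hom_Obj:
  assumes "f \<in> hom C x y"
  shows "x \<in> Obj C" "y \<in> Obj C"
  using assms Dom_Obj Cod_Obj by (auto simp: hom_def)

lemma (in category) paste_squares:
  assumes "f \<in> hom C x y" "f' \<in> hom C x' y'" "f'' \<in> hom C x'' y''"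
    and "s \<in> hom C x x'" "s' \<in> hom C y y'" "t \<in> hom C x' x''" "t' \<in> hom C y' y''"
    and "Cmp C s' f = Cmp C f' s" "Cmp C t' f' = Cmp C f'' t"
  shows "Cmp C (Cmp C t' s') f = Cmp C f'' (Cmp C t s)"
  using Cmp_assoc[OF assms(1,5,7)] Cmp_assoc[OF assms(4,2,7)] Cmp_assoc[OF assms(4,6,3)] assms(8,9)
  by simp

text \<open>This is naturality of a pointwise inverse. Insert \<open>Cmp C t v\<close> after
  \<open>g\<close>, move \<open>t\<close> across the square, and cancel \<open>t'\<close> against
  \<open>v'\<close>.\<close>

lemma (in category) inverse_square:
  assumes f: "f \<in> hom C x y" and g: "g \<in> hom C x' y'"
    and t: "t \<in> hom C x x'" "t' \<in> hom C y y'" and v: "v \<in> hom C x' x" "v' \<in> hom C y' y"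
    and eqs: "Cmp C t v = Ident C x'" "Cmp C v' t' = Ident C y" "Cmp C t' f = Cmp C g t"
  shows "Cmp C v' g = Cmp C f v"
proof -
  have "Cmp C v' g = Cmp C v' (Cmp C g (Cmp C t v))"
    by (simp add: eqs(1) Cmp_Ident[OF g])
  also have "\<dots> = Cmp C v' (Cmp C t' (Cmp C f v))"
    using Cmp_assoc[OF v(1) t(1) g] Cmp_assoc[OF v(1) f t(2)] eqs(3) by simp
  also have "\<dots> = Cmp C f v"
    using Cmp_assoc[OF Cmp_hom[OF v(1) f] t(2) v(2)] eqs(2) Ident_Cmp[OF Cmp_hom[OF v(1) f]] by simp
  finally show ?thesis .
qed

lemma is_isoI:
  assumes "f \<in> hom C x y" "g \<in> hom C y x" "Cmp C g f = Ident C x" "Cmp C f g = Ident C y"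
  shows "is_iso C f"
  using assms unfolding is_iso_def by (auto simp: hom_def)

text \<open>The definition speaks of \<open>Dom\<close>, \<open>Cod\<close> and composable pairs.
  This form and \<open>is_ftorD\<close> speak of hom-sets only, which suits the rules of the locale
  \<open>category\<close>.\<close>

lemma is_ftorI:
  assumes "category C" "category D"
    and "\<And>x. x \<in> Obj C \<Longrightarrow> FObj F x \<in> Obj D"
    and "\<And>f x y. f \<in> hom C x y \<Longrightarrow> FArr F f \<in> hom D (FObj F x) (FObj F y)"
    and "\<And>x. x \<in> Obj C \<Longrightarrow> FArr F (Ident C x) = Ident D (FObj F x)"
    and "\<And>f g x y z. f \<in> hom C x y \<Longrightarrow> g \<in> hom C y z \<Longrightarrow>
      FArr F (Cmp C g f) = Cmp D (FArr F g) (FArr F f)"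
    and "FObj F \<in> extensional (Obj C)" "FArr F \<in> extensional (Arr C)"
  shows "is_ftor C D F"
proof -
  have "FArr F f \<in> hom D (FObj F (Dom C f)) (FObj F (Cod C f))" if "f \<in> Arr C" for f
    using assms(4) Arr_hom[OF that] by blast
  moreover have "FArr F (Cmp C g f) = Cmp D (FArr F g) (FArr F f)"
    if "f \<in> Arr C" "g \<in> Arr C" "Cod C f = Dom C g" for f g
    using assms(6)[of f "Dom C f" "Cod C f" g "Cod C g"] that by (simp add: hom_def)
  ultimately show ?thesis
    using assms(1-3,5,7,8) unfolding is_ftor_def PiE_def by (auto simp: hom_def)
qed

lemma is_ftorD:
  assumes "is_ftor C D F"
  shows "category C" "category D"
    and "x \<in> Obj C \<Longrightarrow> FObj F x \<in> Obj D"
    and "f \<in> hom C x y \<Longrightarrow> FArr F f \<in> hom D (FObj F x) (FObj F y)"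
    and "x \<in> Obj C \<Longrightarrow> FArr F (Ident C x) = Ident D (FObj F x)"
    and "f \<in> hom C x y \<Longrightarrow> g \<in> hom C y z \<Longrightarrow>
      FArr F (Cmp C g f) = Cmp D (FArr F g) (FArr F f)"
    and "FObj F \<in> extensional (Obj C)" "FArr F \<in> extensional (Arr C)"
  using assms unfolding is_ftor_def by (auto simp: hom_def PiE_def)

lemma ftor_eqI:
  fixes F G :: "('o, 'm, 'p, 'q) ftor"
  assumes "is_ftor C D F" "is_ftor C D G"
    and "\<And>x. x \<in> Obj C \<Longrightarrow> FObj F x = FObj G x"
    and "\<And>f. f \<in> Arr C \<Longrightarrow> FArr F f = FArr G f"
  shows "F = G"
proof -
  have "FObj F = FObj G"
    using is_ftorD(7)[OF assms(1)] is_ftorD(7)[OF assms(2)] assms(3) by (rule extensionalityI)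
  moreover have "FArr F = FArr G"
    using is_ftorD(8)[OF assms(1)] is_ftorD(8)[OF assms(2)] assms(4) by (rule extensionalityI)
  ultimately show ?thesis by (cases F; cases G) simp
qed

lemma is_ntransI:
  assumes "is_ftor C D (Src t)" "is_ftor C D (Tgt t)"
    and "\<And>x. x \<in> Obj C \<Longrightarrow> At t x \<in> hom D (FObj (Src t) x) (FObj (Tgt t) x)"
    and "\<And>f x y. f \<in> hom C x y \<Longrightarrow>
      Cmp D (At t y) (FArr (Src t) f) = Cmp D (FArr (Tgt t) f) (At t x)"
    and "At t \<in> extensional (Obj C)"
  shows "is_ntrans C D t"
  unfolding is_ntrans_def
  by (intro conjI ballI) ((fact assms(1,2,5))+ | rule assms(3,4), (assumption | erule Arr_hom))+

lemma is_ntransD: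
  assumes "is_ntrans C D t"
  shows "is_ftor C D (Src t)" "is_ftor C D (Tgt t)"
    and "x \<in> Obj C \<Longrightarrow> At t x \<in> hom D (FObj (Src t) x) (FObj (Tgt t) x)"
    and "f \<in> hom C x y \<Longrightarrow> Cmp D (At t y) (FArr (Src t) f) = Cmp D (FArr (Tgt t) f) (At t x)"
    and "At t \<in> extensional (Obj C)"
  using assms unfolding is_ntrans_def by (auto simp: hom_def)

lemma ntrans_eqI:
  fixes s t :: "('o, 'm, 'p, 'q) ntrans"
  assumes "Src s = Src t" "Tgt s = Tgt t"
    and "At s \<in> extensional X" "At t \<in> extensional X"
    and "\<And>x. x \<in> X \<Longrightarrow> At s x = At t x"
  shows "s = t"
proof -
  have "At s = At t" using assms(3-5) by (rule extensionalityI)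
  then show ?thesis using assms(1,2) by (cases s; cases t) simp
qed

lemma ftor_cat_simps [simp]:
  "Obj (ftor_cat C D) = {F. is_ftor C D F}"
  "Arr (ftor_cat C D) = {t. is_ntrans C D t}"
  "Dom (ftor_cat C D) = Src" "Cod (ftor_cat C D) = Tgt"
  "Ident (ftor_cat C D) F = \<lparr>Src = F, Tgt = F, At = (\<lambda>x\<in>Obj C. Ident D (FObj F x))\<rparr>"
  "Cmp (ftor_cat C D) s t =
    \<lparr>Src = Src t, Tgt = Tgt s, At = (\<lambda>x\<in>Obj C. Cmp D (At s x) (At t x))\<rparr>"
  by (simp_all add: ftor_cat_def)

lemma hom_ftor_cat: "t \<in> hom (ftor_cat C D) F G \<longleftrightarrow> is_ntrans C D t \<and> Src t = F \<and> Tgt t = G"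
  by (simp add: hom_def)

lemma hom_ftor_catD:
  assumes "t \<in> hom (ftor_cat C D) F G"
  shows "is_ftor C D F" "is_ftor C D G" "Src t = F" "Tgt t = G"
    and "x \<in> Obj C \<Longrightarrow> At t x \<in> hom D (FObj F x) (FObj G x)"
    and "f \<in> hom C x y \<Longrightarrow> Cmp D (At t y) (FArr F f) = Cmp D (FArr G f) (At t x)"
    and "At t \<in> extensional (Obj C)"
  using assms by (auto simp: hom_ftor_cat dest: is_ntransD)

lemma hom_ftor_catI:
  assumes "is_ftor C D F" "is_ftor C D G"
    and "\<And>x. x \<in> Obj C \<Longrightarrow> \<alpha> x \<in> hom D (FObj F x) (FObj G x)"
    and "\<And>f x y. f \<in> hom C x y \<Longrightarrow> Cmp D (\<alpha> y) (FArr F f) = Cmp D (FArr G f) (\<alpha> x)"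
  shows "\<lparr>Src = F, Tgt = G, At = (\<lambda>x\<in>Obj C. \<alpha> x)\<rparr> \<in> hom (ftor_cat C D) F G"
proof -
  interpret category C using assms(1) by (rule is_ftorD)
  show ?thesis
    unfolding hom_ftor_cat using assms hom_Obj by (auto intro!: is_ntransI)
qed

lemma ftor_cat_eqI:
  assumes "s \<in> hom (ftor_cat C D) F G" "t \<in> hom (ftor_cat C D) F G"
    and "\<And>x. x \<in> Obj C \<Longrightarrow> At s x = At t x"
  shows "s = t"
  using assms(3) hom_ftor_catD(3,4,7)[OF assms(1)] hom_ftor_catD(3,4,7)[OF assms(2)]
  by (intro ntrans_eqI[of s t "Obj C"]) auto

lemma ftor_cat_Ident_hom:
  assumes "is_ftor C D F"
  shows "Ident (ftor_cat C D) F \<in> hom (ftor_cat C D) F F"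
proof -
  interpret D: category D using assms by (rule is_ftorD)
  show ?thesis
    unfolding ftor_cat_simps
    using D.Cmp_Ident[OF is_ftorD(4)[OF assms]] D.Ident_Cmp[OF is_ftorD(4)[OF assms]]
    by (intro hom_ftor_catI assms) (auto simp: is_ftorD(3)[OF assms] D.Ident_hom)
qed

lemma ftor_cat_Cmp_hom:
  assumes s: "s \<in> hom (ftor_cat C D) F G" and t: "t \<in> hom (ftor_cat C D) G H"
  shows "Cmp (ftor_cat C D) t s \<in> hom (ftor_cat C D) F H"
proof -
  note F = hom_ftor_catD(1)[OF s] and G = hom_ftor_catD(1)[OF t] and H = hom_ftor_catD(2)[OF t]
  interpret C: category C using F by (rule is_ftorD)
  interpret D: category D using F by (rule is_ftorD)
  show ?thesis
    unfolding ftor_cat_simps hom_ftor_catD(3,4)[OF s] hom_ftor_catD(3,4)[OF t]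
  proof (intro hom_ftor_catI F H)
    fix x assume "x \<in> Obj C"
    then show "Cmp D (At t x) (At s x) \<in> hom D (FObj F x) (FObj H x)"
      using hom_ftor_catD(5)[OF s] hom_ftor_catD(5)[OF t] D.Cmp_hom by blast
  next
    fix f x y assume f: "f \<in> hom C x y"
    note x = C.hom_Obj(1)[OF f] and y = C.hom_Obj(2)[OF f]
    show "Cmp D (Cmp D (At t y) (At s y)) (FArr F f) = Cmp D (FArr H f) (Cmp D (At t x) (At s x))"
      by (rule D.paste_squares) (fact is_ftorD(4)[OF F f] is_ftorD(4)[OF G f] is_ftorD(4)[OF H f]
        hom_ftor_catD(5)[OF s x] hom_ftor_catD(5)[OF s y] hom_ftor_catD(5)[OF t x]
        hom_ftor_catD(5)[OF t y] hom_ftor_catD(6)[OF s f] hom_ftor_catD(6)[OF t f])+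
  qed
qed

lemma category_ftor_cat:
  assumes "category C" "category D"
  shows "category (ftor_cat C D)"
proof -
  interpret D: category D by fact
  show ?thesis
  proof
    fix F assume "F \<in> Obj (ftor_cat C D)"
    then show "Ident (ftor_cat C D) F \<in> hom (ftor_cat C D) F F"
      by (simp add: ftor_cat_Ident_hom del: ftor_cat_simps(5))
  next
    fix f F G assume f: "f \<in> hom (ftor_cat C D) F G"
    note F = ftor_cat_Ident_hom[OF hom_ftor_catD(1)[OF f]]
    note G = ftor_cat_Ident_hom[OF hom_ftor_catD(2)[OF f]]
    show "Cmp (ftor_cat C D) f (Ident (ftor_cat C D) F) = f"
      by (rule ftor_cat_eqI[OF ftor_cat_Cmp_hom[OF F f] f])
        (auto intro: D.Cmp_Ident hom_ftor_catD(5)[OF f])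
    show "Cmp (ftor_cat C D) (Ident (ftor_cat C D) G) f = f"
      by (rule ftor_cat_eqI[OF ftor_cat_Cmp_hom[OF f G] f])
        (auto intro: D.Ident_Cmp hom_ftor_catD(5)[OF f])
  next
    fix f g h E F G H
    assume f: "f \<in> hom (ftor_cat C D) E F" and g: "g \<in> hom (ftor_cat C D) F G"
      and h: "h \<in> hom (ftor_cat C D) G H"
    show "Cmp (ftor_cat C D) h (Cmp (ftor_cat C D) g f) =
        Cmp (ftor_cat C D) (Cmp (ftor_cat C D) h g) f"
      by (auto simp: fun_eq_iff restrict_def intro!: D.Cmp_assoc
          hom_ftor_catD(5)[OF f] hom_ftor_catD(5)[OF g] hom_ftor_catD(5)[OF h])
  qed (auto intro: ftor_cat_Cmp_hom simp: is_ntransD simp del: ftor_cat_simps(6))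
qed

text \<open>Inverses chosen object by object are natural by \<open>inverse_square\<close>. The lemma
  is applied twice to base change: once to reduce to its component at a functor, and once to reduce
  that component to a single object.\<close>

lemma is_iso_ftor_cat:
  assumes t: "t \<in> hom (ftor_cat C D) F G" and iso: "\<And>x. x \<in> Obj C \<Longrightarrow> is_iso D (At t x)"
  shows "is_iso (ftor_cat C D) t"
proof -
  note F = hom_ftor_catD(1)[OF t] and G = hom_ftor_catD(2)[OF t]
  interpret C: category C using F by (rule is_ftorD)
  interpret D: category D using F by (rule is_ftorD)
  have "\<exists>v. v \<in> hom D (FObj G x) (FObj F x) \<and> Cmp D v (At t x) = Ident D (FObj F x) \<and>
      Cmp D (At t x) v = Ident D (FObj G x)" if "x \<in> Obj C" for x
    using iso[OF that] homD[OF hom_ftor_catD(5)[OF t that]] unfolding is_iso_def by auto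
  then obtain v where v: "\<And>x. x \<in> Obj C \<Longrightarrow> v x \<in> hom D (FObj G x) (FObj F x)"
    and vl: "\<And>x. x \<in> Obj C \<Longrightarrow> Cmp D (v x) (At t x) = Ident D (FObj F x)"
    and vr: "\<And>x. x \<in> Obj C \<Longrightarrow> Cmp D (At t x) (v x) = Ident D (FObj G x)"
    by metis
  define s where "s = \<lparr>Src = G, Tgt = F, At = (\<lambda>x\<in>Obj C. v x)\<rparr>"
  have s: "s \<in> hom (ftor_cat C D) G F"
    unfolding s_def
  proof (intro hom_ftor_catI F G v)
    fix f x y assume f: "f \<in> hom C x y"
    note x = C.hom_Obj(1)[OF f] and y = C.hom_Obj(2)[OF f]
    show "Cmp D (v y) (FArr G f) = Cmp D (FArr F f) (v x)"
      by (rule D.inverse_square) (fact is_ftorD(4)[OF F f] is_ftorD(4)[OF G f]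
        hom_ftor_catD(5)[OF t x] hom_ftor_catD(5)[OF t y] v[OF x] v[OF y] vr[OF x] vl[OF y]
        hom_ftor_catD(6)[OF t f])+
  qed
  show ?thesis
    using t s
  proof (rule is_isoI)
    show "Cmp (ftor_cat C D) s t = Ident (ftor_cat C D) F"
      by (rule ftor_cat_eqI[OF ftor_cat_Cmp_hom[OF t s] ftor_cat_Ident_hom[OF F]])
        (simp add: s_def vl)
    show "Cmp (ftor_cat C D) t s = Ident (ftor_cat C D) G"
      by (rule ftor_cat_eqI[OF ftor_cat_Cmp_hom[OF s t] ftor_cat_Ident_hom[OF G]])
        (simp add: s_def vr)
  qed
qed

lemma is_ftor_comp:
  assumes F: "is_ftor C D F" and G: "is_ftor D E G"
  shows "is_ftor C E (ftor_comp C G F)"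
proof -
  interpret C: category C using F by (rule is_ftorD)
  have FObj: "FObj (ftor_comp C G F) x = FObj G (FObj F x)" if "x \<in> Obj C" for x
    using that by (simp add: ftor_comp_def)
  have FArr: "FArr (ftor_comp C G F) f = FArr G (FArr F f)" if "f \<in> hom C x y" for f x y
    using homD(1)[OF that] by (simp add: ftor_comp_def)
  show ?thesis
  proof (intro is_ftorI is_ftorD(1)[OF F] is_ftorD(2)[OF G])
    fix x assume x: "x \<in> Obj C"
    then show "FObj (ftor_comp C G F) x \<in> Obj E"
      by (simp add: FObj is_ftorD(3)[OF F] is_ftorD(3)[OF G])
    show "FArr (ftor_comp C G F) (Ident C x) = Ident E (FObj (ftor_comp C G F) x)"
      using x by (simp add: FObj FArr[OF C.Ident_hom] is_ftorD(3,5)[OF F] is_ftorD(5)[OF G])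
  next
    fix f x y assume f: "f \<in> hom C x y"
    then show "FArr (ftor_comp C G F) f \<in> hom E (FObj (ftor_comp C G F) x) (FObj (ftor_comp C G F) y)"
      by (simp add: FObj FArr[OF f] C.hom_Obj[OF f] is_ftorD(4)[OF F] is_ftorD(4)[OF G])
  next
    fix f g x y z assume f: "f \<in> hom C x y" and g: "g \<in> hom C y z"
    show "FArr (ftor_comp C G F) (Cmp C g f) =
        Cmp E (FArr (ftor_comp C G F) g) (FArr (ftor_comp C G F) f)"
      using is_ftorD(6)[OF F f g] is_ftorD(6)[OF G is_ftorD(4)[OF F f] is_ftorD(4)[OF F g]]
      by (simp add: FArr[OF f] FArr[OF g] FArr[OF C.Cmp_hom[OF f g]])
  qed (simp_all add: ftor_comp_def)
qed

lemma ftor_comp_simps: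
  "x \<in> Obj C \<Longrightarrow> FObj (ftor_comp C G F) x = FObj G (FObj F x)"
  "f \<in> Arr C \<Longrightarrow> FArr (ftor_comp C G F) f = FArr G (FArr F f)"
  by (simp_all add: ftor_comp_def)

lemma id_ftor_simps:
  "x \<in> Obj C \<Longrightarrow> FObj (id_ftor C) x = x"
  "f \<in> Arr C \<Longrightarrow> FArr (id_ftor C) f = f"
  by (simp_all add: id_ftor_def)

lemma whisker_right_hom:
  assumes t: "t \<in> hom (ftor_cat D E) F G" and H: "is_ftor C D H"
  shows "whisker_right C t H \<in> hom (ftor_cat C E) (ftor_comp C F H) (ftor_comp C G H)"
  unfolding whisker_right_def hom_ftor_catD(3,4)[OF t]
proof (intro hom_ftor_catI is_ftor_comp[OF H] hom_ftor_catD(1,2)[OF t])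
  fix x assume "x \<in> Obj C"
  then show "At t (FObj H x) \<in> hom E (FObj (ftor_comp C F H) x) (FObj (ftor_comp C G H) x)"
    by (simp add: ftor_comp_simps hom_ftor_catD(5)[OF t] is_ftorD(3)[OF H])
next
  fix f x y assume "f \<in> hom C x y"
  then show "Cmp E (At t (FObj H y)) (FArr (ftor_comp C F H) f) =
      Cmp E (FArr (ftor_comp C G H) f) (At t (FObj H x))"
    by (simp add: ftor_comp_simps hom_ftor_catD(6)[OF t] is_ftorD(4)[OF H] homD(1))
qed

lemma whisker_left_hom:
  assumes t: "t \<in> hom (ftor_cat C D) F G" and H: "is_ftor D E H"
  shows "whisker_left C H t \<in> hom (ftor_cat C E) (ftor_comp C H F) (ftor_comp C H G)"
proof -
  note F = hom_ftor_catD(1)[OF t] and G = hom_ftor_catD(2)[OF t]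
  interpret C: category C using F by (rule is_ftorD)
  show ?thesis
    unfolding whisker_left_def hom_ftor_catD(3,4)[OF t]
  proof (intro hom_ftor_catI is_ftor_comp[OF _ H] F G)
    fix x assume "x \<in> Obj C"
    then show "FArr H (At t x) \<in> hom E (FObj (ftor_comp C H F) x) (FObj (ftor_comp C H G) x)"
      by (simp add: ftor_comp_simps hom_ftor_catD(5)[OF t] is_ftorD(4)[OF H])
  next
    fix f x y assume f: "f \<in> hom C x y"
    note x = C.hom_Obj(1)[OF f] and y = C.hom_Obj(2)[OF f]
    have "Cmp E (FArr H (At t y)) (FArr H (FArr F f)) = Cmp E (FArr H (FArr G f)) (FArr H (At t x))"
      using is_ftorD(6)[OF H] hom_ftor_catD(5)[OF t x] hom_ftor_catD(5)[OF t y]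
        is_ftorD(4)[OF F f] is_ftorD(4)[OF G f] hom_ftor_catD(6)[OF t f] by metis
    then show "Cmp E (FArr H (At t y)) (FArr (ftor_comp C H F) f) =
      Cmp E (FArr (ftor_comp C H G) f) (FArr H (At t x))"
      by (simp add: ftor_comp_simps homD(1)[OF f])
  qed
qed

lemma precomp_ftor_simps:
  "is_ftor J C F \<Longrightarrow> FObj (precomp_ftor I J C K) F = ftor_comp I F K"
  "is_ntrans J C t \<Longrightarrow> FArr (precomp_ftor I J C K) t = whisker_right I t K"
  by (simp_all add: precomp_ftor_def)

lemma is_ftor_precomp:
  assumes K: "is_ftor I J K" and C: "category C"
  shows "is_ftor (ftor_cat J C) (ftor_cat I C) (precomp_ftor I J C K)"
proof -
  have FArr: "FArr (precomp_ftor I J C K) t = whisker_right I t K"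
    if "t \<in> hom (ftor_cat J C) F G" for t F G
    using homD(1)[OF that] by (simp add: precomp_ftor_simps)
  show ?thesis
  proof (intro is_ftorI category_ftor_cat is_ftorD(1,2)[OF K] C)
    fix F assume "F \<in> Obj (ftor_cat J C)"
    then show "FObj (precomp_ftor I J C K) F \<in> Obj (ftor_cat I C)"
      by (simp add: precomp_ftor_simps is_ftor_comp[OF K])
  next
    fix t F G assume t: "t \<in> hom (ftor_cat J C) F G"
    show "FArr (precomp_ftor I J C K) t \<in>
        hom (ftor_cat I C) (FObj (precomp_ftor I J C K) F) (FObj (precomp_ftor I J C K) G)"
      using whisker_right_hom[OF t K] hom_ftor_catD(1,2)[OF t]
      by (simp add: FArr[OF t] precomp_ftor_simps)
  next
    fix F assume "F \<in> Obj (ftor_cat J C)"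
    then have F: "is_ftor J C F" by simp
    show "FArr (precomp_ftor I J C K) (Ident (ftor_cat J C) F) =
        Ident (ftor_cat I C) (FObj (precomp_ftor I J C K) F)"
      using F is_ftorD(3)[OF K] unfolding FArr[OF ftor_cat_Ident_hom[OF F]]
      by (simp add: precomp_ftor_simps whisker_right_def ftor_comp_simps fun_eq_iff restrict_def)
  next
    fix s t F G H assume st: "s \<in> hom (ftor_cat J C) F G" "t \<in> hom (ftor_cat J C) G H"
    show "FArr (precomp_ftor I J C K) (Cmp (ftor_cat J C) t s) =
        Cmp (ftor_cat I C) (FArr (precomp_ftor I J C K) t) (FArr (precomp_ftor I J C K) s)"
      using is_ftorD(3)[OF K] unfolding FArr[OF ftor_cat_Cmp_hom[OF st]]
      by (simp add: FArr[OF st(1)] FArr[OF st(2)] whisker_right_def fun_eq_iff restrict_def)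
  qed (simp_all add: precomp_ftor_def)
qed


section \<open>Adjunctions\<close>

lemma adjunctionD:
  assumes "adjunction C D F G \<eta> \<epsilon>"
  shows "is_ftor C D F" "is_ftor D C G"
    and "x \<in> Obj C \<Longrightarrow> At \<eta> x \<in> hom C x (FObj G (FObj F x))"
    and "f \<in> hom C x x' \<Longrightarrow> Cmp C (At \<eta> x') f = Cmp C (FArr G (FArr F f)) (At \<eta> x)"
    and "y \<in> Obj D \<Longrightarrow> At \<epsilon> y \<in> hom D (FObj F (FObj G y)) y"
    and "g \<in> hom D y y' \<Longrightarrow> Cmp D (At \<epsilon> y') (FArr F (FArr G g)) = Cmp D g (At \<epsilon> y)"
    and "x \<in> Obj C \<Longrightarrow> Cmp D (At \<epsilon> (FObj F x)) (FArr F (At \<eta> x)) = Ident D (FObj F x)"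
    and "y \<in> Obj D \<Longrightarrow> Cmp C (FArr G (At \<epsilon> y)) (At \<eta> (FObj G y)) = Ident C (FObj G y)"
proof -
  have \<eta>: "\<eta> \<in> hom (ftor_cat C C) (id_ftor C) (ftor_comp C G F)"
    and \<epsilon>: "\<epsilon> \<in> hom (ftor_cat D D) (ftor_comp D F G) (id_ftor D)"
    using assms by (simp_all add: adjunction_def)
  show "x \<in> Obj C \<Longrightarrow> At \<eta> x \<in> hom C x (FObj G (FObj F x))"
    using hom_ftor_catD(5)[OF \<eta>] by (auto simp: ftor_comp_simps id_ftor_simps)
  show "y \<in> Obj D \<Longrightarrow> At \<epsilon> y \<in> hom D (FObj F (FObj G y)) y"
    using hom_ftor_catD(5)[OF \<epsilon>] by (auto simp: ftor_comp_simps id_ftor_simps)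
  show "f \<in> hom C x x' \<Longrightarrow> Cmp C (At \<eta> x') f = Cmp C (FArr G (FArr F f)) (At \<eta> x)"
    using hom_ftor_catD(6)[OF \<eta>] homD(1) by (fastforce simp: ftor_comp_simps id_ftor_simps)
  show "g \<in> hom D y y' \<Longrightarrow> Cmp D (At \<epsilon> y') (FArr F (FArr G g)) = Cmp D g (At \<epsilon> y)"
    using hom_ftor_catD(6)[OF \<epsilon>] homD(1) by (fastforce simp: ftor_comp_simps id_ftor_simps)
qed (use assms in \<open>simp_all add: adjunction_def\<close>)

text \<open>Naturality of \<eta> moves it past \<open>f\<close>; the triangle identity at
  \<open>y\<close> then cancels the counit.\<close>

lemma adjunction_transpose:
  assumes adj: "adjunction C D F G \<eta> \<epsilon>" and y: "y \<in> Obj D" and f: "f \<in> hom C x (FObj G y)"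
  shows "Cmp D (At \<epsilon> y) (FArr F f) \<in> hom D (FObj F x) y"
    and "Cmp C (FArr G (Cmp D (At \<epsilon> y) (FArr F f))) (At \<eta> x) = f"
proof -
  note A = adjunctionD[OF adj]
  interpret C: category C using A(1) by (rule is_ftorD)
  interpret D: category D using A(1) by (rule is_ftorD)
  have Ff: "FArr F f \<in> hom D (FObj F x) (FObj F (FObj G y))"
    using A(1) f by (rule is_ftorD)
  show "Cmp D (At \<epsilon> y) (FArr F f) \<in> hom D (FObj F x) y"
    using Ff A(5)[OF y] by (rule D.Cmp_hom)
  have x: "x \<in> Obj C" and Gy: "FObj G y \<in> Obj C" using C.hom_Obj[OF f] by auto
  have "Cmp C (FArr G (Cmp D (At \<epsilon> y) (FArr F f))) (At \<eta> x) =
      Cmp C (FArr G (At \<epsilon> y)) (Cmp C (FArr G (FArr F f)) (At \<eta> x))"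
    using is_ftorD(6)[OF A(2) Ff A(5)[OF y]]
      C.Cmp_assoc[OF A(3)[OF x] is_ftorD(4)[OF A(2) Ff] is_ftorD(4)[OF A(2) A(5)[OF y]]] by simp
  also have "\<dots> = Cmp C (Cmp C (FArr G (At \<epsilon> y)) (At \<eta> (FObj G y))) f"
    using C.Cmp_assoc[OF f A(3)[OF Gy] is_ftorD(4)[OF A(2) A(5)[OF y]]] A(4)[OF f] by simp
  also have "\<dots> = f"
    using A(8)[OF y] C.Ident_Cmp[OF f] by simp
  finally show "Cmp C (FArr G (Cmp D (At \<epsilon> y) (FArr F f))) (At \<eta> x) = f" .
qed

text \<open>An arrow out of \<open>FObj F x\<close> can be recovered from its transpose, by
  naturality of \<epsilon> and the triangle identity at \<open>x\<close>.\<close>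

lemma adjunction_transpose_unique:
  assumes adj: "adjunction C D F G \<eta> \<epsilon>" and x: "x \<in> Obj C"
    and g: "g \<in> hom D (FObj F x) y" "g' \<in> hom D (FObj F x) y"
    and eq: "Cmp C (FArr G g) (At \<eta> x) = Cmp C (FArr G g') (At \<eta> x)"
  shows "g = g'"
proof -
  note A = adjunctionD[OF adj]
  interpret C: category C using A(1) by (rule is_ftorD)
  interpret D: category D using A(1) by (rule is_ftorD)
  have "h = Cmp D (At \<epsilon> y) (FArr F (Cmp C (FArr G h) (At \<eta> x)))"
    if h: "h \<in> hom D (FObj F x) y" for h
  proof -
    note Fx = D.hom_Obj(1)[OF h] and y = D.hom_Obj(2)[OF h]
    note Gh = is_ftorD(4)[OF A(2) h]
    note F\<eta> = is_ftorD(4)[OF A(1) A(3)[OF x]]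
    have "h = Cmp D h (Cmp D (At \<epsilon> (FObj F x)) (FArr F (At \<eta> x)))"
      by (simp add: A(7)[OF x] D.Cmp_Ident[OF h])
    also have "\<dots> = Cmp D (Cmp D (At \<epsilon> y) (FArr F (FArr G h))) (FArr F (At \<eta> x))"
      using D.Cmp_assoc[OF F\<eta> A(5)[OF Fx] h] A(6)[OF h] by simp
    also have "\<dots> = Cmp D (At \<epsilon> y) (FArr F (Cmp C (FArr G h) (At \<eta> x)))"
      using D.Cmp_assoc[OF F\<eta> is_ftorD(4)[OF A(1) Gh] A(5)[OF y]]
        is_ftorD(6)[OF A(1) A(3)[OF x] Gh] by simp
    finally show ?thesis .
  qed
  then show ?thesis using g eq by metis
qed


section \<open>Colimits\<close>

lemma is_colimitD:
  assumes "is_colimit J C D c \<mu>"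
  shows "is_cocone J C D c \<mu>"
    and "is_cocone J C D c' \<nu> \<Longrightarrow> \<exists>h\<in>hom C c c'. \<forall>j\<in>Obj J. Cmp C h (\<mu> j) = \<nu> j"
  using assms unfolding is_colimit_def by blast+

lemma (in category) cocone_Cmp:
  assumes D: "is_ftor J C D" and \<mu>: "is_cocone J C D c \<mu>" and h: "h \<in> hom C c c'"
  shows "is_cocone J C D c' (\<lambda>j. Cmp C h (\<mu> j))"
proof -
  interpret J: category J using D by (rule is_ftorD)
  have "Cmp C (Cmp C h (\<mu> (Cod J f))) (FArr D f) = Cmp C h (\<mu> (Dom J f))" if f: "f \<in> Arr J" for f
  proof -
    have "Cmp C h (Cmp C (\<mu> (Cod J f)) (FArr D f)) = Cmp C (Cmp C h (\<mu> (Cod J f))) (FArr D f)"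
      using \<mu> h J.Cod_Obj[OF f] is_ftorD(4)[OF D Arr_hom[OF f]]
      unfolding is_cocone_def by (intro Cmp_assoc) auto
    then show ?thesis using \<mu> f unfolding is_cocone_def by simp
  qed
  then show ?thesis using \<mu> h Cmp_hom hom_Obj(2)[OF h] unfolding is_cocone_def by blast
qed

lemma (in category) colimit_unique:
  assumes D: "is_ftor J C D" and \<mu>: "is_colimit J C D c \<mu>"
    and h: "h \<in> hom C c c'" "h' \<in> hom C c c'"
    and eq: "\<And>j. j \<in> Obj J \<Longrightarrow> Cmp C h (\<mu> j) = Cmp C h' (\<mu> j)"
  shows "h = h'"
proof -
  have "is_cocone J C D c' (\<lambda>j. Cmp C h (\<mu> j))"
    using D is_colimitD(1)[OF \<mu>] h(1) by (rule cocone_Cmp)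
  then have "\<exists>!k. k \<in> hom C c c' \<and> (\<forall>j\<in>Obj J. Cmp C k (\<mu> j) = Cmp C h (\<mu> j))"
    using \<mu> unfolding is_colimit_def by blast
  then show ?thesis using h eq by (metis (no_types, lifting))
qed

text \<open>\<open>cocomplete\<close> quantifies over index categories on the type 'u only, whereas
  comma categories of categories of elements have pairs and triples as objects and arrows. A small
  index category of any type is replaced by an isomorphic copy inside 'u.\<close>

lemma colimit_exists:
  fixes \<kappa> :: "'u rel" and J :: "('i, 'j) cat" and C :: "('o, 'm) cat"
  assumes \<kappa>: "infinite_regular \<kappa>" and J: "small_category \<kappa> J" and C: "cocomplete \<kappa> C"
    and D: "is_ftor J C D"
  obtains c \<mu> where "is_colimit J C D c \<mu>"
proof -
  interpret J: category J using D by (rule is_ftorD)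
  interpret C: category C using D by (rule is_ftorD)
  obtain e :: "'i \<Rightarrow> 'u" where e: "inj_on e (Obj J)"
    using J small_embedding[OF \<kappa>] unfolding small_category_def by blast
  obtain d :: "'j \<Rightarrow> 'u" where d: "inj_on d (Arr J)"
    using J small_embedding[OF \<kappa>] unfolding small_category_def by blast
  define e' where "e' = inv_into (Obj J) e"
  define d' where "d' = inv_into (Arr J) d"
  have e' [simp]: "e' (e x) = x" if "x \<in> Obj J" for x
    using that e by (simp add: e'_def)
  have d' [simp]: "d' (d f) = f" if "f \<in> Arr J" for f
    using that d by (simp add: d'_def)
  \<comment> \<open>The structure of \<open>J\<close> is carried along the injections
    \<open>e\<close> on objects and \<open>d\<close> on arrows; \<open>e'\<close> and
    \<open>d'\<close> decode.\<close>
  define J' :: "('u, 'u) cat" where "J' = \<lparr>Obj = e ` Obj J, Arr = d ` Arr J,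
    Dom = (\<lambda>w. e (Dom J (d' w))), Cod = (\<lambda>w. e (Cod J (d' w))), Ident = (\<lambda>v. d (Ident J (e' v))),
    Cmp = (\<lambda>w v. d (Cmp J (d' w) (d' v)))\<rparr>"
  have J'_simps: "Obj J' = e ` Obj J" "Arr J' = d ` Arr J"
    "\<And>f. f \<in> Arr J \<Longrightarrow> Dom J' (d f) = e (Dom J f)" "\<And>f. f \<in> Arr J \<Longrightarrow> Cod J' (d f) = e (Cod J f)"
    "\<And>x. x \<in> Obj J \<Longrightarrow> Ident J' (e x) = d (Ident J x)"
    "\<And>f g. f \<in> Arr J \<Longrightarrow> g \<in> Arr J \<Longrightarrow> Cmp J' (d g) (d f) = d (Cmp J g f)"
    by (simp_all add: J'_def)
  have hom_E: "\<exists>f x y. w = d f \<and> v = e x \<and> v' = e y \<and> f \<in> hom J x y" if "w \<in> hom J' v v'" for w v v'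
    using that J.Dom_Obj J.Cod_Obj unfolding hom_def by (auto simp: J'_simps)
  have hom_I: "d f \<in> hom J' (e x) (e y)" if "f \<in> hom J x y" for f x y
    using that unfolding hom_def by (auto simp: J'_simps)
  have e_eq: "e x = e y \<longleftrightarrow> x = y" if "x \<in> Obj J" "y \<in> Obj J" for x y
    using that e by (auto dest: inj_onD)
  \<comment> \<open>Decoding two composable arrows separately gives two preimages of the middle
    object. Injectivity of \<open>e\<close> identifies them, so the decoded arrows are composable in
    \<open>J\<close>.\<close>
  have hom_E2: "\<exists>f x y g z. w = d f \<and> v = e x \<and> v' = e y \<and> f \<in> hom J x y \<and>
      w' = d g \<and> v'' = e z \<and> g \<in> hom J y z"
    if w: "w \<in> hom J' v v'" and w': "w' \<in> hom J' v' v''" for w w' v v' v''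
  proof -
    obtain f x y where f: "w = d f" "v = e x" "v' = e y" "f \<in> hom J x y"
      using hom_E[OF w] by blast
    obtain g y' z where g: "w' = d g" "v' = e y'" "v'' = e z" "g \<in> hom J y' z"
      using hom_E[OF w'] by blast
    have "y' = y" using e_eq f g J.hom_Obj by metis
    with f g show ?thesis by blast
  qed
  have J': "category J'"
  proof
    fix w assume "w \<in> Arr J'"
    then show "Dom J' w \<in> Obj J'" "Cod J' w \<in> Obj J'"
      using J.Dom_Obj J.Cod_Obj by (auto simp: J'_simps)
  next
    fix v assume "v \<in> Obj J'"
    then show "Ident J' v \<in> hom J' v v"
      using hom_I[OF J.Ident_hom] by (auto simp: J'_simps)
  next
    fix w v v' assume "w \<in> hom J' v v'"
    then obtain f x y where f: "w = d f" "v = e x" "v' = e y" "f \<in> hom J x y"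
      using hom_E by blast
    show "Cmp J' w (Ident J' v) = w" "Cmp J' (Ident J' v') w = w"
      using f J.Ident_hom[THEN homD(1)] homD(1)[OF f(4)] J.hom_Obj[OF f(4)]
        J.Cmp_Ident[OF f(4)] J.Ident_Cmp[OF f(4)]
      by (simp_all add: J'_simps)
  next
    fix w1 w2 v1 v2 v3 assume w: "w1 \<in> hom J' v1 v2" "w2 \<in> hom J' v2 v3"
    obtain f x y g z where f: "w1 = d f" "v1 = e x" "v2 = e y" "f \<in> hom J x y"
      and g: "w2 = d g" "v3 = e z" "g \<in> hom J y z"
      using hom_E2[OF w] by blast
    then show "Cmp J' w2 w1 \<in> hom J' v1 v3"
      using hom_I[OF J.Cmp_hom[OF f(4) g(3)]] by (simp add: J'_simps homD(1)[OF f(4)] homD(1)[OF g(3)])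
  next
    fix w1 w2 w3 v1 v2 v3 v4
    assume w: "w1 \<in> hom J' v1 v2" "w2 \<in> hom J' v2 v3" "w3 \<in> hom J' v3 v4"
    obtain f x y g z where f: "w1 = d f" "v1 = e x" "v2 = e y" "f \<in> hom J x y"
      and g: "w2 = d g" "v3 = e z" "g \<in> hom J y z"
      using hom_E2[OF w(1,2)] by blast
    obtain h z' t where h: "w3 = d h" "v3 = e z'" "v4 = e t" "h \<in> hom J z' t"
      using hom_E[OF w(3)] by blast
    have "z' = z" using e_eq J.hom_Obj g h by metis
    then have h': "h \<in> hom J z t" using h by simp
    show "Cmp J' w3 (Cmp J' w2 w1) = Cmp J' (Cmp J' w3 w2) w1"
      using J.Cmp_assoc[OF f(4) g(3) h'] homD(1)[OF J.Cmp_hom[OF f(4) g(3)]]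
        homD(1)[OF J.Cmp_hom[OF g(3) h']]
      by (simp add: f g h J'_simps homD(1)[OF f(4)] homD(1)[OF g(3)] homD(1)[OF h'])
  qed
  define D' where "D' = \<lparr>FObj = (\<lambda>v\<in>Obj J'. FObj D (e' v)), FArr = (\<lambda>w\<in>Arr J'. FArr D (d' w))\<rparr>"
  have D'_simps: "\<And>x. x \<in> Obj J \<Longrightarrow> FObj D' (e x) = FObj D x"
    "\<And>f. f \<in> Arr J \<Longrightarrow> FArr D' (d f) = FArr D f"
    by (auto simp: D'_def J'_simps)
  have D': "is_ftor J' C D'"
  proof (intro is_ftorI J' C.category_axioms)
    fix v assume "v \<in> Obj J'"
    then obtain x where x: "x \<in> Obj J" "v = e x" by (auto simp: J'_simps)
    then show "FObj D' v \<in> Obj C" by (simp add: D'_simps is_ftorD(3)[OF D])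
    show "FArr D' (Ident J' v) = Ident C (FObj D' v)"
      using x by (simp add: D'_simps J'_simps homD(1)[OF J.Ident_hom] is_ftorD(5)[OF D])
  next
    fix w v v' assume "w \<in> hom J' v v'"
    then obtain f x y where f: "w = d f" "v = e x" "v' = e y" "f \<in> hom J x y"
      using hom_E by blast
    then show "FArr D' w \<in> hom C (FObj D' v) (FObj D' v')"
      by (simp add: D'_simps homD(1)[OF f(4)] J.hom_Obj[OF f(4)] is_ftorD(4)[OF D])
  next
    fix w1 w2 v1 v2 v3 assume w: "w1 \<in> hom J' v1 v2" "w2 \<in> hom J' v2 v3"
    obtain f x y g z where f: "w1 = d f" "v1 = e x" "v2 = e y" "f \<in> hom J x y"
      and g: "w2 = d g" "v3 = e z" "g \<in> hom J y z"
      using hom_E2[OF w] by blast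
    show "FArr D' (Cmp J' w2 w1) = Cmp C (FArr D' w2) (FArr D' w1)"
      using homD(1)[OF J.Cmp_hom[OF f(4) g(3)]] is_ftorD(6)[OF D f(4) g(3)]
      by (simp add: f g D'_simps J'_simps homD(1)[OF f(4)] homD(1)[OF g(3)])
  qed (simp_all add: D'_def)
  have "small_category \<kappa> J'"
    using J J' unfolding small_category_def by (simp add: J'_simps small_image)
  then obtain c \<mu> where c: "is_colimit J' C D' c \<mu>"
    using C D' unfolding cocomplete_def by blast
  \<comment> \<open>Cocones over the two diagrams correspond by reindexing along \<open>e\<close>,
    with reindexing along \<open>e'\<close> as the way back. This transfers the whole universal
    property.\<close>
  have cocone_iff: "is_cocone J' C D' c' \<nu> \<longleftrightarrow> is_cocone J C D c' (\<nu> \<circ> e)" for c' \<nu>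
    unfolding is_cocone_def by (simp add: J'_simps D'_simps)
  have "is_colimit J C D c (\<mu> \<circ> e)"
    unfolding is_colimit_def
  proof (intro conjI allI impI)
    show "is_cocone J C D c (\<mu> \<circ> e)"
      using is_colimitD(1)[OF c] by (simp add: cocone_iff)
  next
    fix c' \<nu> assume "is_cocone J C D c' \<nu>"
    then have "is_cocone J' C D' c' (\<nu> \<circ> e')"
      unfolding cocone_iff by (simp add: is_cocone_def J.Dom_Obj J.Cod_Obj)
    then have "\<exists>!h. h \<in> hom C c c' \<and> (\<forall>j\<in>Obj J'. Cmp C h (\<mu> j) = (\<nu> \<circ> e') j)"
      using c unfolding is_colimit_def by blast
    then show "\<exists>!h. h \<in> hom C c c' \<and> (\<forall>j\<in>Obj J. Cmp C h ((\<mu> \<circ> e) j) = \<nu> j)"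
      by (simp add: J'_simps)
  qed
  then show ?thesis by (rule that)
qed


section \<open>Comma categories\<close>

text \<open>An arrow records both ends, as in \<open>elements\<close>, because the same
  \<open>g\<close> underlies several arrows. The label of its source is forced by \<open>g\<close>
  and the label of its target.\<close>

definition comma ::
  "('i, 'j) cat \<Rightarrow> ('k, 'l) cat \<Rightarrow> ('i, 'j, 'k, 'l) ftor \<Rightarrow> 'k \<Rightarrow>
   ('i \<times> 'l, ('i \<times> 'l) \<times> 'j \<times> ('i \<times> 'l)) cat" where
  "comma I J K r =
    \<lparr>Obj = {(p, u). p \<in> Obj I \<and> u \<in> hom J (FObj K p) r},
     Arr = {((p, u), g, (p', u')). g \<in> hom I p p' \<and> u' \<in> hom J (FObj K p') r \<and>
       u = Cmp J u' (FArr K g)},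
     Dom = fst,
     Cod = (\<lambda>w. snd (snd w)),
     Ident = (\<lambda>x. (x, Ident I (fst x), x)),
     Cmp = (\<lambda>w v. (fst v, Cmp I (fst (snd w)) (fst (snd v)), snd (snd w)))\<rparr>"

text \<open>The projection to \<open>I\<close> followed by \<open>F\<close>: the diagram whose
  colimit is the value at \<open>r\<close> of the pointwise left Kan extension of \<open>F\<close>
  along \<open>K\<close>.\<close>

definition comma_diagram where
  "comma_diagram I J K r F =
    \<lparr>FObj = (\<lambda>x\<in>Obj (comma I J K r). FObj F (fst x)),
     FArr = (\<lambda>w\<in>Arr (comma I J K r). FArr F (fst (snd w)))\<rparr>"

lemma comma_simps [simp]:
  "(p, u) \<in> Obj (comma I J K r) \<longleftrightarrow> p \<in> Obj I \<and> u \<in> hom J (FObj K p) r"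
  "((p, u), g, (p', u')) \<in> Arr (comma I J K r) \<longleftrightarrow>
    g \<in> hom I p p' \<and> u' \<in> hom J (FObj K p') r \<and> u = Cmp J u' (FArr K g)"
  "Dom (comma I J K r) w = fst w" "Cod (comma I J K r) w = snd (snd w)"
  "Ident (comma I J K r) x = (x, Ident I (fst x), x)"
  "Cmp (comma I J K r) w v = (fst v, Cmp I (fst (snd w)) (fst (snd v)), snd (snd w))"
  by (auto simp: comma_def)

lemma hom_comma:
  "((x, g, y) \<in> hom (comma I J K r) x' y') \<longleftrightarrow> x = x' \<and> y = y' \<and> g \<in> hom I (fst x) (fst y) \<and>
    snd y \<in> hom J (FObj K (fst y)) r \<and> snd x = Cmp J (snd y) (FArr K g)"
  unfolding hom_def[of "comma I J K r"] by (cases x; cases y) auto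

lemma category_comma:
  assumes K: "is_ftor I J K"
  shows "category (comma I J K r)"
proof -
  interpret I: category I using K by (rule is_ftorD)
  interpret J: category J using K by (rule is_ftorD)
  have *: "Cmp J u (FArr K (Cmp I h g)) = Cmp J (Cmp J u (FArr K h)) (FArr K g)"
    if "g \<in> hom I p p'" "h \<in> hom I p' p''" "u \<in> hom J (FObj K p'') r" for u g h p p' p''
    using that is_ftorD(6)[OF K that(1,2)] J.Cmp_assoc[OF is_ftorD(4)[OF K] is_ftorD(4)[OF K]]
    by simp
  show ?thesis
  proof
    fix w assume "w \<in> Arr (comma I J K r)"
    then show "Dom (comma I J K r) w \<in> Obj (comma I J K r)"
      "Cod (comma I J K r) w \<in> Obj (comma I J K r)"
      using I.hom_Obj J.Cmp_hom[OF is_ftorD(4)[OF K]] by (cases w; auto)+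
  next
    fix x assume "x \<in> Obj (comma I J K r)"
    then show "Ident (comma I J K r) x \<in> hom (comma I J K r) x x"
      by (cases x) (auto simp: hom_comma I.Ident_hom is_ftorD(5)[OF K] J.Cmp_Ident)
  next
    fix v w x y z assume "v \<in> hom (comma I J K r) x y" "w \<in> hom (comma I J K r) y z"
    then show "Cmp (comma I J K r) w v \<in> hom (comma I J K r) x z"
      by (cases v; cases w) (auto simp: hom_comma I.Cmp_hom *)
  next
    fix w x y assume "w \<in> hom (comma I J K r) x y"
    then show "Cmp (comma I J K r) w (Ident (comma I J K r) x) = w"
      "Cmp (comma I J K r) (Ident (comma I J K r) y) w = w"
      by (cases w; auto simp: hom_comma I.Cmp_Ident I.Ident_Cmp)+
  next
    fix u v w x y z t
    assume "u \<in> hom (comma I J K r) x y" "v \<in> hom (comma I J K r) y z"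
      "w \<in> hom (comma I J K r) z t"
    then show "Cmp (comma I J K r) w (Cmp (comma I J K r) v u) =
        Cmp (comma I J K r) (Cmp (comma I J K r) w v) u"
      by (cases u; cases v; cases w) (auto simp: hom_comma intro: I.Cmp_assoc)
  qed
qed

lemma small_comma:
  assumes \<kappa>: "infinite_regular \<kappa>" and I: "small_category \<kappa> I" and J: "small_category \<kappa> J"
    and K: "is_ftor I J K"
  shows "small_category \<kappa> (comma I J K r)"
proof -
  have Obj: "|Obj (comma I J K r)| <o \<kappa>"
  proof (rule small_subset)
    show "Obj (comma I J K r) \<subseteq> Obj I \<times> Arr J" by (auto simp: homD(1))
    show "|Obj I \<times> Arr J| <o \<kappa>"
      using small_Times[OF \<kappa>] I J unfolding small_category_def by blast
  qed
  interpret cm: category "comma I J K r" using K by (rule category_comma)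
  have "|Arr (comma I J K r)| <o \<kappa>"
  proof (rule small_subset)
    show "Arr (comma I J K r) \<subseteq> Obj (comma I J K r) \<times> Arr I \<times> Obj (comma I J K r)"
    proof
      fix w assume w: "w \<in> Arr (comma I J K r)"
      then show "w \<in> Obj (comma I J K r) \<times> Arr I \<times> Obj (comma I J K r)"
        using cm.Dom_Obj[OF w] cm.Cod_Obj[OF w] by (cases w) (auto simp: homD(1))
    qed
    show "|Obj (comma I J K r) \<times> Arr I \<times> Obj (comma I J K r)| <o \<kappa>"
      using I Obj unfolding small_category_def by (intro small_Times[OF \<kappa>]) auto
  qed
  then show ?thesis
    using Obj cm.category_axioms unfolding small_category_def by blast
qed

lemma comma_diagram_simps:
  "(p, u) \<in> Obj (comma I J K r) \<Longrightarrow> FObj (comma_diagram I J K r F) (p, u) = FObj F p"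
  "(x, g, y) \<in> Arr (comma I J K r) \<Longrightarrow> FArr (comma_diagram I J K r F) (x, g, y) = FArr F g"
  by (simp_all add: comma_diagram_def)

lemma is_ftor_comma_diagram:
  assumes K: "is_ftor I J K" and F: "is_ftor I C F"
  shows "is_ftor (comma I J K r) C (comma_diagram I J K r F)"
proof -
  interpret cm: category "comma I J K r" using K by (rule category_comma)
  have FObj: "FObj (comma_diagram I J K r F) x = FObj F (fst x)" if "x \<in> Obj (comma I J K r)" for x
    using that by (simp add: comma_diagram_def)
  have FArr: "FArr (comma_diagram I J K r F) w = FArr F (fst (snd w))"
    if "w \<in> hom (comma I J K r) x y" for w x y
    using homD(1)[OF that] by (simp add: comma_diagram_def)
  have hom: "fst (snd w) \<in> hom I (fst x) (fst y)" if "w \<in> hom (comma I J K r) x y" for w x y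
    using that by (cases w) (auto simp: hom_comma)
  show ?thesis
  proof (intro is_ftorI cm.category_axioms is_ftorD(2)[OF F])
    fix x assume x: "x \<in> Obj (comma I J K r)"
    then have "fst x \<in> Obj I" by (cases x) simp
    with x show "FObj (comma_diagram I J K r F) x \<in> Obj C"
      "FArr (comma_diagram I J K r F) (Ident (comma I J K r) x) =
        Ident C (FObj (comma_diagram I J K r F) x)"
      using FArr[OF cm.Ident_hom[OF x]] by (auto simp: FObj is_ftorD(3,5)[OF F])
  next
    fix w x y assume w: "w \<in> hom (comma I J K r) x y"
    show "FArr (comma_diagram I J K r F) w \<in>
        hom C (FObj (comma_diagram I J K r F) x) (FObj (comma_diagram I J K r F) y)"
      using is_ftorD(4)[OF F hom[OF w]] by (simp add: FArr[OF w] FObj cm.hom_Obj[OF w])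
  next
    fix v w x y z
    assume v: "v \<in> hom (comma I J K r) x y" and w: "w \<in> hom (comma I J K r) y z"
    show "FArr (comma_diagram I J K r F) (Cmp (comma I J K r) w v) =
        Cmp C (FArr (comma_diagram I J K r F) w) (FArr (comma_diagram I J K r F) v)"
      using FArr[OF cm.Cmp_hom[OF v w]] is_ftorD(6)[OF F hom[OF v] hom[OF w]]
      by (simp add: FArr[OF v] FArr[OF w])
  qed (simp_all add: comma_diagram_def)
qed

text \<open>An arrow of the comma category amounts to a free choice of \<open>g\<close> and of the
  label of its target, so the cocone condition can be stated without triples. All later cocones are
  built and used in this form.\<close>

lemma is_cocone_comma:
  assumes K: "is_ftor I J K"
  shows "is_cocone (comma I J K r) C (comma_diagram I J K r F) c \<mu> \<longleftrightarrow>
    c \<in> Obj C \<and> (\<forall>p u. p \<in> Obj I \<longrightarrow> u \<in> hom J (FObj K p) r \<longrightarrow> \<mu> (p, u) \<in> hom C (FObj F p) c) \<and>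
    (\<forall>p p' g u. g \<in> hom I p p' \<longrightarrow> u \<in> hom J (FObj K p') r \<longrightarrow>
      Cmp C (\<mu> (p', u)) (FArr F g) = \<mu> (p, Cmp J u (FArr K g)))"
proof -
  have "(\<forall>w\<in>Arr (comma I J K r). Cmp C (\<mu> (Cod (comma I J K r) w))
        (FArr (comma_diagram I J K r F) w) = \<mu> (Dom (comma I J K r) w)) \<longleftrightarrow>
      (\<forall>p p' g u. g \<in> hom I p p' \<longrightarrow> u \<in> hom J (FObj K p') r \<longrightarrow>
        Cmp C (\<mu> (p', u)) (FArr F g) = \<mu> (p, Cmp J u (FArr K g)))" (is "?L \<longleftrightarrow> ?R")
  proof
    assume L: ?L
    show ?R
    proof (intro allI impI)
      fix p p' g u assume "g \<in> hom I p p'" "u \<in> hom J (FObj K p') r"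
      then have "((p, Cmp J u (FArr K g)), g, (p', u)) \<in> Arr (comma I J K r)" by simp
      from bspec[OF L this] show "Cmp C (\<mu> (p', u)) (FArr F g) = \<mu> (p, Cmp J u (FArr K g))"
        by (simp add: comma_diagram_simps(2)[OF \<open>_ \<in> Arr (comma I J K r)\<close>])
    qed
  next
    assume ?R
    then show ?L by (auto simp: comma_diagram_simps)
  qed
  moreover have "(\<forall>x\<in>Obj (comma I J K r). \<mu> x \<in> hom C (FObj (comma_diagram I J K r F) x) c) \<longleftrightarrow>
      (\<forall>p u. p \<in> Obj I \<longrightarrow> u \<in> hom J (FObj K p) r \<longrightarrow> \<mu> (p, u) \<in> hom C (FObj F p) c)"
    by (auto simp add: Ball_def split_paired_All comma_diagram_simps)
  ultimately show ?thesis unfolding is_cocone_def by blast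
qed


section \<open>Left adjoints of precomposition are pointwise\<close>

text \<open>A pointwise left Kan extension \<open>E\<close> of \<open>F\<close> along \<open>K\<close> exists because \<open>C\<close> is cocomplete; its
  colimit property yields \<open>\<beta> : E \<rightarrow> l F\<close> and the adjunction yields \<open>\<gamma> : l F \<rightarrow> E\<close>, which are mutually
  inverse, so the colimit property is transferred from \<open>E\<close> to \<open>l F\<close>.\<close>

lemma left_adjoint_pointwise:
  fixes \<kappa> :: "'u rel" and I :: "('i, 'j) cat" and J :: "('k, 'l) cat" and C :: "('o, 'm) cat"
  assumes \<kappa>: "infinite_regular \<kappa>" and I: "small_category \<kappa> I" and J: "small_category \<kappa> J"
    and C: "cocomplete \<kappa> C" and K: "is_ftor I J K"
    and adj: "adjunction (ftor_cat I C) (ftor_cat J C) l (precomp_ftor I J C K) \<eta> \<epsilon>"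
    and F: "is_ftor I C F" and r: "r \<in> Obj J"
  shows "is_colimit (comma I J K r) C (comma_diagram I J K r F) (FObj (FObj l F) r)
    (\<lambda>(p, u). Cmp C (FArr (FObj l F) u) (At (At \<eta> F) p))"
proof -
  interpret I: category I using F by (rule is_ftorD)
  interpret J: category J using K by (rule is_ftorD)
  interpret C: category C using F by (rule is_ftorD)
  note diagram = is_ftor_comma_diagram[OF K F]
  \<comment> \<open>The unit at \<open>F\<close> is a transformation \<open>e\<close> from
    \<open>F\<close> to the restriction of \<open>Fl\<close> along \<open>K\<close>. Extending it
    along arrows \<open>u\<close> into an object gives the cocone that is to be shown
    universal.\<close>
  define Fl where "Fl = FObj l F"
  define e where "e = At (At \<eta> F)"
  have Fl: "is_ftor J C Fl"
    using adjunctionD(1)[OF adj] F unfolding Fl_def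
    by (auto dest: is_ftorD(3)[where x = F])
  have "At \<eta> F \<in> hom (ftor_cat I C) F (ftor_comp I Fl K)"
    using adjunctionD(3)[OF adj, of F] F Fl unfolding Fl_def[symmetric]
    by (simp add: precomp_ftor_simps)
  note e = hom_ftor_catD(5,6)[OF this, folded e_def]
  have e_hom: "e p \<in> hom C (FObj F p) (FObj Fl (FObj K p))" if "p \<in> Obj I" for p
    using e(1)[OF that] that by (simp add: ftor_comp_simps)
  have e_nat: "Cmp C (e p') (FArr F g) = Cmp C (FArr Fl (FArr K g)) (e p)"
    if "g \<in> hom I p p'" for g p p'
    using e(2)[OF that] homD(1)[OF that] by (simp add: ftor_comp_simps)
  \<comment> \<open>The comma category is small for every \<open>s\<close>, whether or not
    \<open>s\<close> is an object of \<open>J\<close>, so the choice of colimits carries no side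
    condition.\<close>
  have "\<exists>c \<mu>. is_colimit (comma I J K s) C (comma_diagram I J K s F) c \<mu>" for s
    using colimit_exists[OF \<kappa> small_comma[OF \<kappa> I J K] C diagram] by metis
  then obtain E0 \<mu> where
    colim: "\<And>s. is_colimit (comma I J K s) C (comma_diagram I J K s F) (E0 s) (\<mu> s)"
    by metis
  note cocone = is_colimitD(1)[OF colim, unfolded is_cocone_comma[OF K]]
  have E0: "E0 s \<in> Obj C" for s using cocone by blast
  have \<mu>_hom: "\<mu> s (p, u) \<in> hom C (FObj F p) (E0 s)"
    if "p \<in> Obj I" "u \<in> hom J (FObj K p) s" for s p u
    using cocone that by blast
  have \<mu>_nat: "Cmp C (\<mu> s (p', u)) (FArr F g) = \<mu> s (p, Cmp J u (FArr K g))"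
    if "g \<in> hom I p p'" "u \<in> hom J (FObj K p') s" for s p p' u g
    using cocone that by blast
  have unique: "h = h'" if "h \<in> hom C (E0 s) c" "h' \<in> hom C (E0 s) c"
    "\<And>p u. p \<in> Obj I \<Longrightarrow> u \<in> hom J (FObj K p) s \<Longrightarrow> Cmp C h (\<mu> s (p, u)) = Cmp C h' (\<mu> s (p, u))"
    for h h' s c
    using C.colimit_unique[OF diagram colim that(1,2)] that(3) by (auto simp: split_paired_all)
  have factor: "\<exists>h\<in>hom C (E0 s) c. \<forall>p u. p \<in> Obj I \<longrightarrow> u \<in> hom J (FObj K p) s \<longrightarrow>
      Cmp C h (\<mu> s (p, u)) = \<nu> (p, u)"
    if "is_cocone (comma I J K s) C (comma_diagram I J K s F) c \<nu>" for s c \<nu>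
    using is_colimitD(2)[OF colim that] comma_simps(1) by metis
  have "\<exists>h\<in>hom C (E0 s) (E0 s'). \<forall>p u. p \<in> Obj I \<longrightarrow> u \<in> hom J (FObj K p) s \<longrightarrow>
      Cmp C h (\<mu> s (p, u)) = \<mu> s' (p, Cmp J v u)" if v: "v \<in> hom J s s'" for s s' v
  proof -
    have "Cmp J (Cmp J v u) (FArr K g) = Cmp J v (Cmp J u (FArr K g))"
      if "g \<in> hom I p p'" "u \<in> hom J (FObj K p') s" for p p' g u
      using J.Cmp_assoc[OF is_ftorD(4)[OF K that(1)] that(2) v] by simp
    then have "is_cocone (comma I J K s) C (comma_diagram I J K s F) (E0 s')
        (\<lambda>(p, u). \<mu> s' (p, Cmp J v u))"
      using E0 \<mu>_hom J.Cmp_hom v \<mu>_nat unfolding is_cocone_comma[OF K] by simp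
    from factor[OF this] show ?thesis by simp
  qed
  note ex_E1 = this
  \<comment> \<open>This is the action of the Kan extension on \<open>v\<close>: composing labels
    with \<open>v\<close> turns the cocone at \<open>s'\<close> into a cocone over the diagram at
    \<open>s\<close>, and the colimit at \<open>s\<close> induces the arrow.\<close>
  define E1 where "E1 s s' v = (SOME h. h \<in> hom C (E0 s) (E0 s') \<and> (\<forall>p u. p \<in> Obj I \<longrightarrow>
      u \<in> hom J (FObj K p) s \<longrightarrow> Cmp C h (\<mu> s (p, u)) = \<mu> s' (p, Cmp J v u)))" for s s' v
  have E1_props: "E1 s s' v \<in> hom C (E0 s) (E0 s') \<and> (\<forall>p u. p \<in> Obj I \<longrightarrow>
      u \<in> hom J (FObj K p) s \<longrightarrow> Cmp C (E1 s s' v) (\<mu> s (p, u)) = \<mu> s' (p, Cmp J v u))"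
    if "v \<in> hom J s s'" for s s' v
    unfolding E1_def by (rule someI_ex) (use ex_E1[OF that] in blast)
  note E1_hom = conjunct1[OF E1_props] and E1 = conjunct2[OF E1_props, rule_format]
  define E where "E = \<lparr>FObj = (\<lambda>s\<in>Obj J. E0 s), FArr = (\<lambda>v\<in>Arr J. E1 (Dom J v) (Cod J v) v)\<rparr>"
  have FObj_E: "FObj E s = E0 s" if "s \<in> Obj J" for s
    using that by (simp add: E_def)
  have FArr_E: "FArr E v = E1 s s' v" if "v \<in> hom J s s'" for v s s'
    using homD[OF that] by (simp add: E_def)
  have E: "is_ftor J C E"
  proof (intro is_ftorI J.category_axioms C.category_axioms)
    fix s assume s: "s \<in> Obj J"
    show "FObj E s \<in> Obj C" using s by (simp add: FObj_E E0)
    have "E1 s s (Ident J s) = Ident C (E0 s)"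
      using J.Ident_hom[OF s] s
      by (intro unique[OF E1_hom C.Ident_hom[OF E0]])
        (auto simp: E1 J.Ident_Cmp C.Ident_Cmp[OF \<mu>_hom])
    then show "FArr E (Ident J s) = Ident C (FObj E s)"
      using s by (simp add: FArr_E[OF J.Ident_hom] FObj_E)
  next
    fix v s s' assume v: "v \<in> hom J s s'"
    show "FArr E v \<in> hom C (FObj E s) (FObj E s')"
      using E1_hom[OF v] J.hom_Obj[OF v] by (simp add: FArr_E[OF v] FObj_E)
  next
    fix v w s s' s'' assume v: "v \<in> hom J s s'" and w: "w \<in> hom J s' s''"
    have "E1 s s'' (Cmp J w v) = Cmp C (E1 s' s'' w) (E1 s s' v)"
    \<comment> \<open>Functoriality can be tested on coprojections, where both sides compose the
      label with \<open>v\<close> and then with \<open>w\<close>.\<close>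
    proof (rule unique)
      fix p u assume pu: "p \<in> Obj I" "u \<in> hom J (FObj K p) s"
      have "Cmp C (E1 s s'' (Cmp J w v)) (\<mu> s (p, u)) = \<mu> s'' (p, Cmp J w (Cmp J v u))"
        using E1[OF J.Cmp_hom[OF v w] pu] J.Cmp_assoc[OF pu(2) v w] by simp
      also have "\<dots> = Cmp C (E1 s' s'' w) (Cmp C (E1 s s' v) (\<mu> s (p, u)))"
        using E1[OF v pu] E1[OF w pu(1) J.Cmp_hom[OF pu(2) v]] by simp
      also have "\<dots> = Cmp C (Cmp C (E1 s' s'' w) (E1 s s' v)) (\<mu> s (p, u))"
        using C.Cmp_assoc[OF \<mu>_hom[OF pu] E1_hom[OF v] E1_hom[OF w]] .
      finally show "Cmp C (E1 s s'' (Cmp J w v)) (\<mu> s (p, u)) =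
        Cmp C (Cmp C (E1 s' s'' w) (E1 s s' v)) (\<mu> s (p, u))" .
    qed (use v w E1_hom J.Cmp_hom C.Cmp_hom in blast)+
    then show "FArr E (Cmp J w v) = Cmp C (FArr E w) (FArr E v)"
      by (simp add: FArr_E[OF v] FArr_E[OF w] FArr_E[OF J.Cmp_hom[OF v w]])
  qed (simp_all add: E_def)
  \<comment> \<open>The canonical transformation of a Kan extension: at \<open>p\<close> it is the
    coprojection labelled by the identity of \<open>FObj K p\<close>.\<close>
  define \<iota> where "\<iota> = \<lparr>Src = F, Tgt = ftor_comp I E K,
    At = (\<lambda>p\<in>Obj I. \<mu> (FObj K p) (p, Ident J (FObj K p)))\<rparr>"
  have \<iota>: "\<iota> \<in> hom (ftor_cat I C) F (ftor_comp I E K)"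
    unfolding \<iota>_def
  proof (intro hom_ftor_catI F is_ftor_comp[OF K E])
    fix p assume p: "p \<in> Obj I"
    then show "\<mu> (FObj K p) (p, Ident J (FObj K p)) \<in> hom C (FObj F p) (FObj (ftor_comp I E K) p)"
      using \<mu>_hom[OF p J.Ident_hom] by (simp add: ftor_comp_simps FObj_E is_ftorD(3)[OF K])
  next
    fix g p p' assume g: "g \<in> hom I p p'"
    note Kg = is_ftorD(4)[OF K g]
    note p = I.hom_Obj[OF g] and Kp = J.hom_Obj[OF Kg]
    have "Cmp C (\<mu> (FObj K p') (p', Ident J (FObj K p'))) (FArr F g) =
        \<mu> (FObj K p') (p, FArr K g)"
      using \<mu>_nat[OF g J.Ident_hom[OF Kp(2)]] J.Ident_Cmp[OF Kg] by simp
    also have "\<dots> = Cmp C (FArr E (FArr K g)) (\<mu> (FObj K p) (p, Ident J (FObj K p)))"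
      using E1[OF Kg p(1) J.Ident_hom[OF Kp(1)]] J.Cmp_Ident[OF Kg] by (simp add: FArr_E[OF Kg])
    finally show "Cmp C (\<mu> (FObj K p') (p', Ident J (FObj K p'))) (FArr F g) =
        Cmp C (FArr (ftor_comp I E K) g) (\<mu> (FObj K p) (p, Ident J (FObj K p)))"
      using homD(1)[OF g] by (simp add: ftor_comp_simps)
  qed
  \<comment> \<open>The adjunction is used for existence here: \<gamma> is the transpose of
    \<iota>.\<close>
  obtain \<gamma> where \<gamma>: "\<gamma> \<in> hom (ftor_cat J C) Fl E"
    and \<gamma>_e: "Cmp (ftor_cat I C) (FArr (precomp_ftor I J C K) \<gamma>) (At \<eta> F) = \<iota>"
    using adjunction_transpose[OF adj, of E \<iota> F] E \<iota> by (auto simp: precomp_ftor_simps Fl_def)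
  have \<gamma>e: "Cmp C (At \<gamma> (FObj K p)) (e p) = \<mu> (FObj K p) (p, Ident J (FObj K p))"
    if p: "p \<in> Obj I" for p
  proof -
    have "At (Cmp (ftor_cat I C) (FArr (precomp_ftor I J C K) \<gamma>) (At \<eta> F)) p = At \<iota> p"
      by (simp only: \<gamma>_e)
    then show ?thesis
      using p homD(1)[OF \<gamma>] by (simp add: precomp_ftor_simps whisker_right_def \<iota>_def e_def)
  qed
  have cocone_Fl: "is_cocone (comma I J K s) C (comma_diagram I J K s F) (FObj Fl s)
      (\<lambda>(p, u). Cmp C (FArr Fl u) (e p))" if s: "s \<in> Obj J" for s
    unfolding is_cocone_comma[OF K]
  proof (intro conjI allI impI)
    show "FObj Fl s \<in> Obj C" using Fl s by (rule is_ftorD)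
  next
    fix p u assume "p \<in> Obj I" "u \<in> hom J (FObj K p) s"
    then show "(case (p, u) of (p, u) \<Rightarrow> Cmp C (FArr Fl u) (e p)) \<in> hom C (FObj F p) (FObj Fl s)"
      using C.Cmp_hom[OF e_hom is_ftorD(4)[OF Fl]] by simp
  next
    fix p p' g u assume g: "g \<in> hom I p p'" and u: "u \<in> hom J (FObj K p') s"
    note p = I.hom_Obj[OF g] and Kg = is_ftorD(4)[OF K g]
    have "Cmp C (Cmp C (FArr Fl u) (e p')) (FArr F g) =
        Cmp C (FArr Fl u) (Cmp C (FArr Fl (FArr K g)) (e p))"
      using C.Cmp_assoc[OF is_ftorD(4)[OF F g] e_hom[OF p(2)] is_ftorD(4)[OF Fl u]]
        e_nat[OF g] by simp
    also have "\<dots> = Cmp C (FArr Fl (Cmp J u (FArr K g))) (e p)"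
      using C.Cmp_assoc[OF e_hom[OF p(1)] is_ftorD(4)[OF Fl Kg] is_ftorD(4)[OF Fl u]]
        is_ftorD(6)[OF Fl Kg u] by simp
    finally show "Cmp C (case (p', u) of (p, u) \<Rightarrow> Cmp C (FArr Fl u) (e p)) (FArr F g) =
      (case (p, Cmp J u (FArr K g)) of (p, u) \<Rightarrow> Cmp C (FArr Fl u) (e p))" by simp
  qed
  have "\<exists>h\<in>hom C (E0 s) (FObj Fl s). \<forall>p u. p \<in> Obj I \<longrightarrow> u \<in> hom J (FObj K p) s \<longrightarrow>
      Cmp C h (\<mu> s (p, u)) = Cmp C (FArr Fl u) (e p)" if "s \<in> Obj J" for s
    using factor[OF cocone_Fl[OF that]] by simp
  then obtain b where b_hom: "\<And>s. s \<in> Obj J \<Longrightarrow> b s \<in> hom C (E0 s) (FObj Fl s)"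
    and b: "\<And>s p u. s \<in> Obj J \<Longrightarrow> p \<in> Obj I \<Longrightarrow> u \<in> hom J (FObj K p) s \<Longrightarrow>
      Cmp C (b s) (\<mu> s (p, u)) = Cmp C (FArr Fl u) (e p)"
    by metis
  define \<beta> where "\<beta> = \<lparr>Src = E, Tgt = Fl, At = (\<lambda>s\<in>Obj J. b s)\<rparr>"
  have \<beta>: "\<beta> \<in> hom (ftor_cat J C) E Fl"
    unfolding \<beta>_def
  proof (intro hom_ftor_catI E Fl)
    fix s assume "s \<in> Obj J"
    then show "b s \<in> hom C (FObj E s) (FObj Fl s)" by (simp add: FObj_E b_hom)
  next
    fix v s s' assume v: "v \<in> hom J s s'"
    note s = J.hom_Obj[OF v]
    show "Cmp C (b s') (FArr E v) = Cmp C (FArr Fl v) (b s)"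
      unfolding FArr_E[OF v]
    proof (rule unique)
      show "Cmp C (b s') (E1 s s' v) \<in> hom C (E0 s) (FObj Fl s')"
        "Cmp C (FArr Fl v) (b s) \<in> hom C (E0 s) (FObj Fl s')"
        using C.Cmp_hom[OF E1_hom[OF v] b_hom[OF s(2)]]
          C.Cmp_hom[OF b_hom[OF s(1)] is_ftorD(4)[OF Fl v]] by auto
      fix p u assume pu: "p \<in> Obj I" "u \<in> hom J (FObj K p) s"
      have "Cmp C (Cmp C (b s') (E1 s s' v)) (\<mu> s (p, u)) = Cmp C (FArr Fl (Cmp J v u)) (e p)"
        using C.Cmp_assoc[OF \<mu>_hom[OF pu] E1_hom[OF v] b_hom[OF s(2)]] E1[OF v pu]
          b[OF s(2) pu(1) J.Cmp_hom[OF pu(2) v]] by simp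
      also have "\<dots> = Cmp C (FArr Fl v) (Cmp C (FArr Fl u) (e p))"
        using C.Cmp_assoc[OF e_hom[OF pu(1)] is_ftorD(4)[OF Fl pu(2)] is_ftorD(4)[OF Fl v]]
          is_ftorD(6)[OF Fl pu(2) v] by simp
      also have "\<dots> = Cmp C (Cmp C (FArr Fl v) (b s)) (\<mu> s (p, u))"
        using C.Cmp_assoc[OF \<mu>_hom[OF pu] b_hom[OF s(1)] is_ftorD(4)[OF Fl v]] b[OF s(1) pu] by simp
      finally show "Cmp C (Cmp C (b s') (E1 s s' v)) (\<mu> s (p, u)) =
        Cmp C (Cmp C (FArr Fl v) (b s)) (\<mu> s (p, u))" .
    qed
  qed
  have \<gamma>_hom: "At \<gamma> s \<in> hom C (FObj Fl s) (E0 s)" if "s \<in> Obj J" for s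
    using hom_ftor_catD(5)[OF \<gamma> that] that by (simp add: FObj_E)
  note \<beta>\<gamma> = ftor_cat_Cmp_hom[OF \<gamma> \<beta>]
  \<comment> \<open>Uniqueness of transposes reduces this to composites with the unit. There
    \<gamma> turns \<open>e p\<close> into the coprojection labelled by an identity, and
    \<open>b\<close> turns that coprojection back into \<open>e p\<close>.\<close>
  have "Cmp (ftor_cat J C) \<beta> \<gamma> = Ident (ftor_cat J C) Fl"
  proof (rule adjunction_transpose_unique[OF adj])
    show "F \<in> Obj (ftor_cat I C)" using F by simp
    show "Cmp (ftor_cat J C) \<beta> \<gamma> \<in> hom (ftor_cat J C) (FObj l F) Fl"
      "Ident (ftor_cat J C) Fl \<in> hom (ftor_cat J C) (FObj l F) Fl"
      using \<beta>\<gamma> ftor_cat_Ident_hom[OF Fl] unfolding Fl_def by auto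
    have "Cmp C (Cmp C (b (FObj K p)) (At \<gamma> (FObj K p))) (e p) =
        Cmp C (Ident C (FObj Fl (FObj K p))) (e p)" if p: "p \<in> Obj I" for p
    proof -
      have Kp: "FObj K p \<in> Obj J" using K p by (rule is_ftorD)
      show ?thesis
        using C.Cmp_assoc[OF e_hom[OF p] \<gamma>_hom[OF Kp] b_hom[OF Kp]] \<gamma>e[OF p]
          b[OF Kp p J.Ident_hom[OF Kp]] is_ftorD(5)[OF Fl Kp] by simp
    qed
    moreover have "is_ntrans J C (Cmp (ftor_cat J C) \<beta> \<gamma>)"
      "is_ntrans J C (Ident (ftor_cat J C) Fl)"
      using homD(1)[OF \<beta>\<gamma>] homD(1)[OF ftor_cat_Ident_hom[OF Fl]] by simp_all
    ultimately show "Cmp (ftor_cat I C)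
        (FArr (precomp_ftor I J C K) (Cmp (ftor_cat J C) \<beta> \<gamma>)) (At \<eta> F) =
      Cmp (ftor_cat I C) (FArr (precomp_ftor I J C K) (Ident (ftor_cat J C) Fl)) (At \<eta> F)"
      using is_ftorD(3)[OF K] hom_ftor_catD(3,4)[OF \<gamma>] hom_ftor_catD(3,4)[OF \<beta>]
      by (simp add: precomp_ftor_simps whisker_right_def e_def[symmetric] \<beta>_def fun_eq_iff
          restrict_def)
  qed
  then have "At (Cmp (ftor_cat J C) \<beta> \<gamma>) r = At (Ident (ftor_cat J C) Fl) r"
    by simp
  then have b\<gamma>: "Cmp C (b r) (At \<gamma> r) = Ident C (FObj Fl r)"
    using r by (simp add: \<beta>_def)
  \<comment> \<open>So \<gamma> carries the cocone on \<open>Fl\<close> to the colimit cocone on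
    \<open>E\<close>. Naturality of \<gamma> at \<open>u\<close> reduces the general label to an
    identity label.\<close>
  have \<gamma>_factor: "Cmp C (At \<gamma> r) (Cmp C (FArr Fl u) (e p)) = \<mu> r (p, u)"
    if p: "p \<in> Obj I" and u: "u \<in> hom J (FObj K p) r" for p u
  proof -
    have Kp: "FObj K p \<in> Obj J" using K p by (rule is_ftorD)
    have "Cmp C (At \<gamma> r) (Cmp C (FArr Fl u) (e p)) =
        Cmp C (Cmp C (FArr E u) (At \<gamma> (FObj K p))) (e p)"
      using C.Cmp_assoc[OF e_hom[OF p] is_ftorD(4)[OF Fl u] \<gamma>_hom[OF r]]
        hom_ftor_catD(6)[OF \<gamma> u] by simp
    also have "\<dots> = Cmp C (E1 (FObj K p) r u) (\<mu> (FObj K p) (p, Ident J (FObj K p)))"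
      using C.Cmp_assoc[OF e_hom[OF p] \<gamma>_hom[OF Kp] E1_hom[OF u]] \<gamma>e[OF p]
      by (simp add: FArr_E[OF u])
    also have "\<dots> = \<mu> r (p, u)"
      using E1[OF u p J.Ident_hom[OF Kp]] J.Cmp_Ident[OF u] by simp
    finally show ?thesis .
  qed
  show ?thesis
    unfolding Fl_def[symmetric] e_def[symmetric] is_colimit_def
  proof (intro conjI allI impI cocone_Fl r)
    fix c \<nu> assume "is_cocone (comma I J K r) C (comma_diagram I J K r F) c \<nu>"
    from factor[OF this] obtain h where h: "h \<in> hom C (E0 r) c"
      and h_\<nu>: "\<And>p u. p \<in> Obj I \<Longrightarrow> u \<in> hom J (FObj K p) r \<Longrightarrow> Cmp C h (\<mu> r (p, u)) = \<nu> (p, u)"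
      by blast
    show "\<exists>!h. h \<in> hom C (FObj Fl r) c \<and> (\<forall>x\<in>Obj (comma I J K r).
        Cmp C h (case x of (p, u) \<Rightarrow> Cmp C (FArr Fl u) (e p)) = \<nu> x)"
    proof (rule ex1I[of _ "Cmp C h (At \<gamma> r)"], intro conjI ballI)
      show "Cmp C h (At \<gamma> r) \<in> hom C (FObj Fl r) c"
        using \<gamma>_hom[OF r] h by (rule C.Cmp_hom)
      fix x assume "x \<in> Obj (comma I J K r)"
      then obtain p u where x: "x = (p, u)" "p \<in> Obj I" "u \<in> hom J (FObj K p) r"
        by (cases x) auto
      show "Cmp C (Cmp C h (At \<gamma> r)) (case x of (p, u) \<Rightarrow> Cmp C (FArr Fl u) (e p)) = \<nu> x"
        using C.Cmp_assoc[OF C.Cmp_hom[OF e_hom[OF x(2)] is_ftorD(4)[OF Fl x(3)]] \<gamma>_hom[OF r] h]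
          \<gamma>_factor[OF x(2,3)] h_\<nu>[OF x(2,3)] x(1) by simp
    next
      fix k assume k: "k \<in> hom C (FObj Fl r) c \<and> (\<forall>x\<in>Obj (comma I J K r).
        Cmp C k (case x of (p, u) \<Rightarrow> Cmp C (FArr Fl u) (e p)) = \<nu> x)"
      then have k_hom: "k \<in> hom C (FObj Fl r) c" by blast
      \<comment> \<open>Composing with \<open>b r\<close> turns \<open>k\<close> into a
        factorization through the colimit \<open>E0 r\<close>, which is unique. Since
        \<open>b r\<close> after \<gamma> at \<open>r\<close> is the identity, \<open>k\<close> is
        recovered from \<open>h\<close>.\<close>
      have "Cmp C k (b r) = h"
      proof (rule unique[OF C.Cmp_hom[OF b_hom[OF r] k_hom] h])
        fix p u assume pu: "p \<in> Obj I" "u \<in> hom J (FObj K p) r"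
        then have "Cmp C k (Cmp C (FArr Fl u) (e p)) = \<nu> (p, u)"
          using conjunct2[OF k, rule_format, of "(p, u)"] by simp
        then show "Cmp C (Cmp C k (b r)) (\<mu> r (p, u)) = Cmp C h (\<mu> r (p, u))"
          using C.Cmp_assoc[OF \<mu>_hom[OF pu] b_hom[OF r] k_hom] b[OF r pu] h_\<nu>[OF pu] by simp
      qed
      then show "k = Cmp C h (At \<gamma> r)"
        using C.Cmp_assoc[OF \<gamma>_hom[OF r] b_hom[OF r] k_hom] b\<gamma> C.Cmp_Ident[OF k_hom] by simp
    qed
  qed
qed


section \<open>The category of sets\<close>

lemma Set_cat_simps [simp]:
  "Obj (Set_cat \<kappa>) = {X. |X| <o \<kappa>}"
  "(X, \<phi>, Y) \<in> Arr (Set_cat \<kappa>) \<longleftrightarrow> |X| <o \<kappa> \<and> |Y| <o \<kappa> \<and> \<phi> \<in> X \<rightarrow>\<^sub>E Y"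
  "Dom (Set_cat \<kappa>) u = fst u" "Cod (Set_cat \<kappa>) u = snd (snd u)"
  "Ident (Set_cat \<kappa>) X = (X, \<lambda>x\<in>X. x, X)"
  "Cmp (Set_cat \<kappa>) v u = (fst u, compose (fst u) (set_map v) (set_map u), snd (snd v))"
  by (simp_all add: Set_cat_def)

lemma hom_Set_cat:
  "(X, \<phi>, Y) \<in> hom (Set_cat \<kappa>) X' Y' \<longleftrightarrow>
    X = X' \<and> Y = Y' \<and> |X| <o \<kappa> \<and> |Y| <o \<kappa> \<and> \<phi> \<in> X \<rightarrow>\<^sub>E Y"
  by (auto simp: hom_def)

lemma Set_hom_map: "u \<in> hom (Set_cat \<kappa>) X Y \<Longrightarrow> x \<in> X \<Longrightarrow> set_map u x \<in> Y"
  by (cases u) (auto simp: hom_Set_cat)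

lemma Set_hom_eqI:
  assumes "u \<in> hom (Set_cat \<kappa>) X Y" "v \<in> hom (Set_cat \<kappa>) X Y"
    and "\<And>x. x \<in> X \<Longrightarrow> set_map u x = set_map v x"
  shows "u = v"
  using assms by (cases u; cases v) (auto simp: hom_Set_cat intro: PiE_ext)

lemma Set_Cmp_map:
  "u \<in> hom (Set_cat \<kappa>) X Y \<Longrightarrow> x \<in> X \<Longrightarrow> set_map (Cmp (Set_cat \<kappa>) v u) x = set_map v (set_map u x)"
  by (cases u) (auto simp: hom_Set_cat compose_def)

lemma category_Set_cat: "category (Set_cat \<kappa>)"
proof
  fix u assume "u \<in> Arr (Set_cat \<kappa>)"
  then show "Dom (Set_cat \<kappa>) u \<in> Obj (Set_cat \<kappa>)" "Cod (Set_cat \<kappa>) u \<in> Obj (Set_cat \<kappa>)"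
    by (cases u; simp)+
next
  fix u v X Y Z assume "u \<in> hom (Set_cat \<kappa>) X Y" "v \<in> hom (Set_cat \<kappa>) Y Z"
  then show "Cmp (Set_cat \<kappa>) v u \<in> hom (Set_cat \<kappa>) X Z"
    by (cases u; cases v) (auto simp: hom_Set_cat compose_def)
next
  fix u X Y assume "u \<in> hom (Set_cat \<kappa>) X Y"
  then show "Cmp (Set_cat \<kappa>) u (Ident (Set_cat \<kappa>) X) = u"
    "Cmp (Set_cat \<kappa>) (Ident (Set_cat \<kappa>) Y) u = u"
    by (cases u; auto simp: hom_Set_cat compose_def fun_eq_iff restrict_def PiE_def extensional_def)+
next
  fix u v w X Y Z T
  assume "u \<in> hom (Set_cat \<kappa>) X Y" "v \<in> hom (Set_cat \<kappa>) Y Z" "w \<in> hom (Set_cat \<kappa>) Z T"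
  then show "Cmp (Set_cat \<kappa>) w (Cmp (Set_cat \<kappa>) v u) = Cmp (Set_cat \<kappa>) (Cmp (Set_cat \<kappa>) w v) u"
    by (cases u; cases v; cases w) (auto simp: hom_Set_cat compose_def fun_eq_iff restrict_def)
qed (auto simp: hom_Set_cat)

text \<open>Two elements of the disjoint union of the diagram are identified when every cocone
  identifies them.\<close>

lemma cocomplete_Set_cat:
  fixes \<kappa> :: "'u rel"
  assumes \<kappa>: "infinite_regular \<kappa>"
  shows "cocomplete \<kappa> (Set_cat \<kappa>)"
  unfolding cocomplete_def
proof (intro conjI allI impI category_Set_cat)
  fix J :: "('u, 'u) cat" and D assume JD: "small_category \<kappa> J \<and> is_ftor J (Set_cat \<kappa>) D"
  then have D: "is_ftor J (Set_cat \<kappa>) D" ..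
  interpret J: category J using D by (rule is_ftorD)
  have D_small: "|FObj D j| <o \<kappa>" if "j \<in> Obj J" for j
    using is_ftorD(3)[OF D that] by simp
  define S where "S = Sigma (Obj J) (FObj D)"
  have "|S| <o \<kappa>"
    unfolding S_def using JD D_small by (intro small_Sigma[OF \<kappa>]) (auto simp: small_category_def)
  \<comment> \<open>The colimit object must be a set of elements of 'u, so classes of pairs are
    represented by codes of chosen members.\<close>
  then obtain e :: "'u \<times> 'u \<Rightarrow> 'u" where e: "inj_on e S"
    using small_embedding[OF \<kappa>] by blast
  define rel where "rel s t \<longleftrightarrow> (\<forall>c \<nu>. is_cocone J (Set_cat \<kappa>) D c \<nu> \<longrightarrow>
    set_map (\<nu> (fst s)) (snd s) = set_map (\<nu> (fst t)) (snd t))" for s t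
  define rep where "rep s = (SOME t. t \<in> S \<and> rel t s)" for s
  define q where "q s = e (rep s)" for s
  have rep: "rep s \<in> S \<and> rel (rep s) s" if "s \<in> S" for s
    unfolding rep_def by (rule someI[of _ s]) (simp add: rel_def that)
  \<comment> \<open>Related pairs satisfy the same predicate under \<open>SOME\<close>, so they get
    the same representative and hence the same code.\<close>
  have q_eq: "q s = q t" if "rel s t" for s t
  proof -
    have "rel u s \<longleftrightarrow> rel u t" for u using that by (auto simp: rel_def)
    then show ?thesis by (simp add: q_def rep_def)
  qed
  have q_rel: "rel s t" if "q s = q t" "s \<in> S" "t \<in> S" for s t
  proof -
    have "rep s = rep t" using that(1) rep[OF that(2)] rep[OF that(3)] inj_onD[OF e] by (simp add: q_def)
    then show ?thesis using rep[OF that(2)] rep[OF that(3)] by (simp add: rel_def)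
  qed
  define Q where "Q = q ` S"
  have Q: "|Q| <o \<kappa>" using \<open>|S| <o \<kappa>\<close> by (simp add: Q_def small_image)
  define \<mu> where "\<mu> j = (FObj D j, \<lambda>x\<in>FObj D j. q (j, x), Q)" for j
  have \<mu>_hom: "\<mu> j \<in> hom (Set_cat \<kappa>) (FObj D j) Q" if "j \<in> Obj J" for j
    using that Q D_small[OF that] by (auto simp: \<mu>_def hom_Set_cat Q_def S_def)
  have "is_colimit J (Set_cat \<kappa>) D Q \<mu>"
    unfolding is_colimit_def
  proof (intro conjI allI impI)
    show "is_cocone J (Set_cat \<kappa>) D Q \<mu>"
      unfolding is_cocone_def
    proof (intro conjI ballI \<mu>_hom)
      show "Q \<in> Obj (Set_cat \<kappa>)" using Q by simp
    next
      fix f assume f: "f \<in> Arr J"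
      note Df = is_ftorD(4)[OF D Arr_hom[OF f]]
      note ends = J.Dom_Obj[OF f] J.Cod_Obj[OF f]
      show "Cmp (Set_cat \<kappa>) (\<mu> (Cod J f)) (FArr D f) = \<mu> (Dom J f)"
      proof (rule Set_hom_eqI)
        show "Cmp (Set_cat \<kappa>) (\<mu> (Cod J f)) (FArr D f) \<in> hom (Set_cat \<kappa>) (FObj D (Dom J f)) Q"
          using category.Cmp_hom[OF category_Set_cat Df \<mu>_hom[OF ends(2)]] .
        show "\<mu> (Dom J f) \<in> hom (Set_cat \<kappa>) (FObj D (Dom J f)) Q" using ends(1) by (rule \<mu>_hom)
        fix x assume x: "x \<in> FObj D (Dom J f)"
        have "rel (Cod J f, set_map (FArr D f) x) (Dom J f, x)"
          unfolding rel_def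
        proof (intro allI impI)
          fix c \<nu> assume "is_cocone J (Set_cat \<kappa>) D c \<nu>"
          then have "Cmp (Set_cat \<kappa>) (\<nu> (Cod J f)) (FArr D f) = \<nu> (Dom J f)"
            using f by (simp add: is_cocone_def del: Set_cat_simps)
          then show "set_map (\<nu> (fst (Cod J f, set_map (FArr D f) x)))
              (snd (Cod J f, set_map (FArr D f) x)) = set_map (\<nu> (fst (Dom J f, x))) (snd (Dom J f, x))"
            using Set_Cmp_map[OF Df x] by (simp del: Set_cat_simps) metis
        qed
        then show "set_map (Cmp (Set_cat \<kappa>) (\<mu> (Cod J f)) (FArr D f)) x = set_map (\<mu> (Dom J f)) x"
          unfolding Set_Cmp_map[OF Df x]
          using x Set_hom_map[OF Df x] q_eq by (simp add: \<mu>_def)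
      qed
    qed
  next
    fix c \<nu> assume \<nu>: "is_cocone J (Set_cat \<kappa>) D c \<nu>"
    then have c: "|c| <o \<kappa>"
      and \<nu>_hom: "\<And>j. j \<in> Obj J \<Longrightarrow> \<nu> j \<in> hom (Set_cat \<kappa>) (FObj D j) c"
      by (simp_all add: is_cocone_def)
    define \<phi> where "\<phi> s = set_map (\<nu> (fst s)) (snd s)" for s
    \<comment> \<open>\<open>inv_into\<close> may return a different member of the class, but
      related pairs have equal images under every cocone, in particular under \<nu>.\<close>
    have \<phi>: "\<phi> (inv_into S q (q s)) = \<phi> s" if "s \<in> S" for s
    proof -
      have "inv_into S q (q s) \<in> S" "q (inv_into S q (q s)) = q s"
        using that by (auto intro: inv_into_into f_inv_into_f)
      then show ?thesis using q_rel that \<nu> unfolding rel_def \<phi>_def by blast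
    qed
    define h where "h = (Q, \<lambda>z\<in>Q. \<phi> (inv_into S q z), c)"
    have h: "h \<in> hom (Set_cat \<kappa>) Q c"
      using Q c \<phi> Set_hom_map[OF \<nu>_hom] by (auto simp: h_def hom_Set_cat Q_def S_def \<phi>_def)
    show "\<exists>!h. h \<in> hom (Set_cat \<kappa>) Q c \<and> (\<forall>j\<in>Obj J. Cmp (Set_cat \<kappa>) h (\<mu> j) = \<nu> j)"
    proof (rule ex1I[of _ h], intro conjI ballI h)
      fix j assume j: "j \<in> Obj J"
      show "Cmp (Set_cat \<kappa>) h (\<mu> j) = \<nu> j"
      proof (rule Set_hom_eqI[OF _ \<nu>_hom[OF j]])
        show "Cmp (Set_cat \<kappa>) h (\<mu> j) \<in> hom (Set_cat \<kappa>) (FObj D j) c"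
          using category.Cmp_hom[OF category_Set_cat \<mu>_hom[OF j] h] .
        fix x assume x: "x \<in> FObj D j"
        then have "(j, x) \<in> S" using j by (simp add: S_def)
        then show "set_map (Cmp (Set_cat \<kappa>) h (\<mu> j)) x = set_map (\<nu> j) x"
          unfolding Set_Cmp_map[OF \<mu>_hom[OF j] x]
          using x \<phi>[of "(j, x)"] by (simp add: h_def \<mu>_def Q_def \<phi>_def)
      qed
    next
      fix k assume k: "k \<in> hom (Set_cat \<kappa>) Q c \<and> (\<forall>j\<in>Obj J. Cmp (Set_cat \<kappa>) k (\<mu> j) = \<nu> j)"
      show "k = h"
      proof (rule Set_hom_eqI[OF conjunct1[OF k] h])
        fix z assume "z \<in> Q"
        then obtain j x where jx: "j \<in> Obj J" "x \<in> FObj D j" "z = q (j, x)" "(j, x) \<in> S"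
          by (auto simp: Q_def S_def)
        then have "set_map k z = set_map (Cmp (Set_cat \<kappa>) k (\<mu> j)) x"
          unfolding Set_Cmp_map[OF \<mu>_hom[OF jx(1)] jx(2)] by (simp add: \<mu>_def)
        also have "\<dots> = set_map (\<nu> j) x"
          using k jx(1) by (simp del: Set_cat_simps)
        also have "\<dots> = set_map h z"
          using jx \<phi>[of "(j, x)"] by (simp add: h_def Q_def \<phi>_def)
        finally show "set_map k z = set_map h z" .
      qed
    qed
  qed
  then show "\<exists>c \<mu>. is_colimit J (Set_cat \<kappa>) D c \<mu>" by blast
qed


section \<open>Presheaves and their categories of elements\<close>

lemma op_cat_simps [simp]:
  "Obj (op_cat C) = Obj C" "Arr (op_cat C) = Arr C" "Dom (op_cat C) = Cod C"
  "Cod (op_cat C) = Dom C" "Ident (op_cat C) = Ident C" "Cmp (op_cat C) g f = Cmp C f g"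
  by (simp_all add: op_cat_def)

lemma hom_op_cat [simp]: "hom (op_cat C) x y = hom C y x"
  by (auto simp: hom_def)

lemma category_op_cat:
  assumes "category C"
  shows "category (op_cat C)"
proof -
  interpret category C by fact
  show ?thesis
    by unfold_locales
      (auto simp: Dom_Obj Cod_Obj Ident_hom Cmp_Ident Ident_Cmp intro: Cmp_hom Cmp_assoc[symmetric])
qed

lemma presheafD:
  assumes A: "is_ftor (op_cat \<A>) (Set_cat \<kappa>) A" and \<A>: "category \<A>"
  shows "X \<in> Obj \<A> \<Longrightarrow> |FObj A X| <o \<kappa>"
    and "f \<in> hom \<A> X Y \<Longrightarrow> FArr A f \<in> hom (Set_cat \<kappa>) (FObj A Y) (FObj A X)"
    and "f \<in> hom \<A> X Y \<Longrightarrow> y \<in> FObj A Y \<Longrightarrow> set_map (FArr A f) y \<in> FObj A X"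
    and "X \<in> Obj \<A> \<Longrightarrow> x \<in> FObj A X \<Longrightarrow> set_map (FArr A (Ident \<A> X)) x = x"
    and "f \<in> hom \<A> X Y \<Longrightarrow> g \<in> hom \<A> Y Z \<Longrightarrow> z \<in> FObj A Z \<Longrightarrow>
      set_map (FArr A (Cmp \<A> g f)) z = set_map (FArr A f) (set_map (FArr A g) z)"
proof -
  have FArr: "FArr A f \<in> hom (Set_cat \<kappa>) (FObj A Y) (FObj A X)" if "f \<in> hom \<A> X Y" for f X Y
    using is_ftorD(4)[OF A, of f Y X] that by simp
  then show "f \<in> hom \<A> X Y \<Longrightarrow> FArr A f \<in> hom (Set_cat \<kappa>) (FObj A Y) (FObj A X)" .
  from Set_hom_map[OF this]
  show "f \<in> hom \<A> X Y \<Longrightarrow> y \<in> FObj A Y \<Longrightarrow> set_map (FArr A f) y \<in> FObj A X" .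
  show "X \<in> Obj \<A> \<Longrightarrow> |FObj A X| <o \<kappa>"
    using is_ftorD(3)[OF A, of X] by simp
  show "X \<in> Obj \<A> \<Longrightarrow> x \<in> FObj A X \<Longrightarrow> set_map (FArr A (Ident \<A> X)) x = x"
    using is_ftorD(5)[OF A, of X] by simp
  show "set_map (FArr A (Cmp \<A> g f)) z = set_map (FArr A f) (set_map (FArr A g) z)"
    if "f \<in> hom \<A> X Y" "g \<in> hom \<A> Y Z" "z \<in> FObj A Z"
    using is_ftorD(6)[OF A, of g Z Y f X] that Set_Cmp_map[OF FArr[OF that(2)] that(3)]
    by (simp del: Set_cat_simps)
qed

lemma presheaf_homD:
  assumes a: "a \<in> hom (presheaf_cat \<kappa> \<A>) A B"
  shows "is_ftor (op_cat \<A>) (Set_cat \<kappa>) A" "is_ftor (op_cat \<A>) (Set_cat \<kappa>) B"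
    and "Src a = A" "Tgt a = B"
    and "X \<in> Obj \<A> \<Longrightarrow> At a X \<in> hom (Set_cat \<kappa>) (FObj A X) (FObj B X)"
    and "X \<in> Obj \<A> \<Longrightarrow> x \<in> FObj A X \<Longrightarrow> set_map (At a X) x \<in> FObj B X"
    and "category \<A> \<Longrightarrow> f \<in> hom \<A> X Y \<Longrightarrow> y \<in> FObj A Y \<Longrightarrow>
      set_map (At a X) (set_map (FArr A f) y) = set_map (FArr B f) (set_map (At a Y) y)"
proof -
  note a' = hom_ftor_catD[OF a[unfolded presheaf_cat_def]]
  show AB: "is_ftor (op_cat \<A>) (Set_cat \<kappa>) A" "is_ftor (op_cat \<A>) (Set_cat \<kappa>) B"
    and "Src a = A" "Tgt a = B" by (fact a')+
  show at: "At a X \<in> hom (Set_cat \<kappa>) (FObj A X) (FObj B X)" if "X \<in> Obj \<A>" for X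
    using a'(5)[of X] that by simp
  from Set_hom_map[OF this]
  show "X \<in> Obj \<A> \<Longrightarrow> x \<in> FObj A X \<Longrightarrow> set_map (At a X) x \<in> FObj B X" .
  show "set_map (At a X) (set_map (FArr A f) y) = set_map (FArr B f) (set_map (At a Y) y)"
    if \<A>: "category \<A>" and f: "f \<in> hom \<A> X Y" and y: "y \<in> FObj A Y"
  proof -
    have "Cmp (Set_cat \<kappa>) (At a X) (FArr A f) = Cmp (Set_cat \<kappa>) (FArr B f) (At a Y)"
      using a'(6)[of f Y X] f by (simp del: Set_cat_simps)
    from arg_cong[OF this, of "\<lambda>u. set_map u y"] show ?thesis
      unfolding Set_Cmp_map[OF presheafD(2)[OF AB(1) \<A> f] y]
        Set_Cmp_map[OF at[OF category.hom_Obj(2)[OF \<A> f]] y] .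
  qed
qed

lemma elements_simps [simp]:
  "(X, x) \<in> Obj (elements \<A> A) \<longleftrightarrow> X \<in> Obj \<A> \<and> x \<in> FObj A X"
  "Dom (elements \<A> A) = fst" "Cod (elements \<A> A) u = snd (snd u)"
  "Ident (elements \<A> A) p = (p, Ident \<A> (fst p), p)"
  "Cmp (elements \<A> A) v u = (fst u, Cmp \<A> (fst (snd v)) (fst (snd u)), snd (snd v))"
  by (simp_all add: elements_def)

lemma hom_elements:
  "(p, f, q) \<in> hom (elements \<A> A) (X, x) (Y, y) \<longleftrightarrow> p = (X, x) \<and> q = (Y, y) \<and> f \<in> hom \<A> X Y \<and>
    x \<in> FObj A X \<and> y \<in> FObj A Y \<and> set_map (FArr A f) y = x"
  unfolding hom_def[of "elements \<A> A"] by (auto simp: elements_def)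

lemma hom_elementsE:
  assumes "u \<in> hom (elements \<A> A) (X, x) (Y, y)"
  obtains f where "u = ((X, x), f, (Y, y))" "f \<in> hom \<A> X Y" "x \<in> FObj A X" "y \<in> FObj A Y"
    "set_map (FArr A f) y = x"
  using assms by (cases u) (auto simp: hom_elements)

lemma category_elements:
  assumes A: "is_ftor (op_cat \<A>) (Set_cat \<kappa>) A" and \<A>: "category \<A>"
  shows "category (elements \<A> A)"
proof -
  interpret category \<A> by (rule \<A>)
  note P = presheafD[OF A \<A>]
  show ?thesis
  proof
    fix u assume "u \<in> Arr (elements \<A> A)"
    then show "Dom (elements \<A> A) u \<in> Obj (elements \<A> A)" "Cod (elements \<A> A) u \<in> Obj (elements \<A> A)"
      using hom_Obj by (auto simp: elements_def)
  next
    fix p assume "p \<in> Obj (elements \<A> A)"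
    then show "Ident (elements \<A> A) p \<in> hom (elements \<A> A) p p"
      by (cases p) (auto simp: hom_elements Ident_hom P(4))
  next
    fix u v p q r assume "u \<in> hom (elements \<A> A) p q" "v \<in> hom (elements \<A> A) q r"
    then show "Cmp (elements \<A> A) v u \<in> hom (elements \<A> A) p r"
      by (cases p; cases q; cases r; cases u; cases v) (auto simp: hom_elements P(5) intro: Cmp_hom)
  next
    fix u p q assume "u \<in> hom (elements \<A> A) p q"
    then show "Cmp (elements \<A> A) u (Ident (elements \<A> A) p) = u"
      "Cmp (elements \<A> A) (Ident (elements \<A> A) q) u = u"
      by (cases p; cases q; cases u; auto simp: hom_elements Cmp_Ident Ident_Cmp)+
  next
    fix u v w p q r s
    assume "u \<in> hom (elements \<A> A) p q" "v \<in> hom (elements \<A> A) q r"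
      "w \<in> hom (elements \<A> A) r s"
    then show "Cmp (elements \<A> A) w (Cmp (elements \<A> A) v u) =
        Cmp (elements \<A> A) (Cmp (elements \<A> A) w v) u"
      by (cases p; cases q; cases r; cases s; cases u; cases v; cases w)
        (auto simp: hom_elements intro: Cmp_assoc)
  qed
qed

lemma small_elements:
  assumes \<kappa>: "infinite_regular \<kappa>" and \<A>: "small_category \<kappa> \<A>"
    and A: "is_ftor (op_cat \<A>) (Set_cat \<kappa>) A"
  shows "small_category \<kappa> (elements \<A> A)"
proof -
  have "category \<A>" using \<A> by (simp add: small_category_def)
  note P = presheafD[OF A this]
  interpret E: category "elements \<A> A" using A \<open>category \<A>\<close> by (rule category_elements)
  have "Obj (elements \<A> A) = Sigma (Obj \<A>) (FObj A)" by (auto simp: elements_def)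
  then have Obj: "|Obj (elements \<A> A)| <o \<kappa>"
    using \<A> P(1) by (simp add: small_category_def small_Sigma[OF \<kappa>])
  have "|Arr (elements \<A> A)| <o \<kappa>"
  proof (rule small_subset)
    show "Arr (elements \<A> A) \<subseteq> Obj (elements \<A> A) \<times> Arr \<A> \<times> Obj (elements \<A> A)"
    proof
      fix u assume u: "u \<in> Arr (elements \<A> A)"
      then have "fst (snd u) \<in> Arr \<A>" by (auto simp: elements_def homD(1))
      then show "u \<in> Obj (elements \<A> A) \<times> Arr \<A> \<times> Obj (elements \<A> A)"
        using E.Dom_Obj[OF u] E.Cod_Obj[OF u] by (cases u) auto
    qed
    show "|Obj (elements \<A> A) \<times> Arr \<A> \<times> Obj (elements \<A> A)| <o \<kappa>"
      using \<A> Obj unfolding small_category_def by (intro small_Times[OF \<kappa>]) auto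
  qed
  then show ?thesis
    using Obj E.category_axioms by (simp add: small_category_def)
qed

lemma elements_map_simps:
  assumes "Src a = A"
  shows "(X, x) \<in> Obj (elements \<A> A) \<Longrightarrow> FObj (elements_map \<A> a) (X, x) = (X, set_map (At a X) x)"
    and "((X, x), f, (Y, y)) \<in> Arr (elements \<A> A) \<Longrightarrow> FArr (elements_map \<A> a) ((X, x), f, (Y, y)) =
      ((X, set_map (At a X) x), f, (Y, set_map (At a Y) y))"
  using assms by (simp_all add: elements_map_def Let_def)

lemma is_ftor_elements_map:
  assumes a: "a \<in> hom (presheaf_cat \<kappa> \<A>) A B" and \<A>: "category \<A>"
  shows "is_ftor (elements \<A> A) (elements \<A> B) (elements_map \<A> a)"
proof -
  note a' = presheaf_homD[OF a]
  interpret \<A>: category \<A> by (rule \<A>)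
  interpret A: category "elements \<A> A" using a'(1) \<A> by (rule category_elements)
  interpret B: category "elements \<A> B" using a'(2) \<A> by (rule category_elements)
  note simps = elements_map_simps[OF a'(3)]
  show ?thesis
  proof (intro is_ftorI A.category_axioms B.category_axioms)
    fix p assume p: "p \<in> Obj (elements \<A> A)"
    show "FObj (elements_map \<A> a) p \<in> Obj (elements \<A> B)"
      using p by (cases p) (simp add: simps a'(6))
    have "Ident (elements \<A> A) p \<in> Arr (elements \<A> A)"
      using homD(1)[OF A.Ident_hom[OF p]] .
    then show "FArr (elements_map \<A> a) (Ident (elements \<A> A) p) =
        Ident (elements \<A> B) (FObj (elements_map \<A> a) p)"
      using p by (cases p) (simp add: simps)
  next
    fix u p q assume u: "u \<in> hom (elements \<A> A) p q"
    obtain X x Y y where pq: "p = (X, x)" "q = (Y, y)" by (cases p; cases q)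
    obtain f where f: "u = ((X, x), f, (Y, y))" "f \<in> hom \<A> X Y" "x \<in> FObj A X" "y \<in> FObj A Y"
      "set_map (FArr A f) y = x"
      using u unfolding pq by (rule hom_elementsE)
    show "FArr (elements_map \<A> a) u \<in>
        hom (elements \<A> B) (FObj (elements_map \<A> a) p) (FObj (elements_map \<A> a) q)"
      using homD(1)[OF u] f \<A>.hom_Obj[OF f(2)] a'(7)[OF \<A> f(2,4)]
        a'(6)[OF \<A>.hom_Obj(1)[OF f(2)] f(3)]
      by (simp add: pq simps hom_elements a'(6))
  next
    fix u v p q r assume u: "u \<in> hom (elements \<A> A) p q" and v: "v \<in> hom (elements \<A> A) q r"
    obtain X x Y y Z z where pqr: "p = (X, x)" "q = (Y, y)" "r = (Z, z)"
      by (cases p; cases q; cases r)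
    obtain f where f: "u = ((X, x), f, (Y, y))" using u unfolding pqr by (rule hom_elementsE)
    obtain g where g: "v = ((Y, y), g, (Z, z))" using v unfolding pqr by (rule hom_elementsE)
    show "FArr (elements_map \<A> a) (Cmp (elements \<A> A) v u) =
        Cmp (elements \<A> B) (FArr (elements_map \<A> a) v) (FArr (elements_map \<A> a) u)"
      using homD(1)[OF u] homD(1)[OF v] homD(1)[OF A.Cmp_hom[OF u v]] by (simp add: f g simps)
  qed (auto simp: elements_map_def Let_def a'(3) extensional_def)
qed


section \<open>Pullbacks of presheaves are computed pointwise\<close>

text \<open>The Yoneda lemma, stated through a universal element. The encoding of arrows in 'u stays
  hidden from the users of the lemma.\<close>

lemma representable_presheaf:
  fixes \<kappa> :: "'u rel" and \<A> :: "('o, 'm) cat"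
  assumes \<kappa>: "infinite_regular \<kappa>" and small: "small_category \<kappa> \<A>" and X: "X \<in> Obj \<A>"
  obtains R x where "is_ftor (op_cat \<A>) (Set_cat \<kappa>) R" "x \<in> FObj R X"
    "\<And>B b. is_ftor (op_cat \<A>) (Set_cat \<kappa>) B \<Longrightarrow> b \<in> FObj B X \<Longrightarrow>
      \<exists>!t. t \<in> hom (presheaf_cat \<kappa> \<A>) R B \<and> set_map (At t X) x = b"
proof -
  interpret category \<A> using small by (simp add: small_category_def)
  note \<A> = category_axioms
  have Arr: "|Arr \<A>| <o \<kappa>" using small by (simp add: small_category_def)
  obtain e :: "'m \<Rightarrow> 'u" where e: "inj_on e (Arr \<A>)"
    using small_embedding[OF \<kappa> Arr] by blast
  define d where "d = inv_into (Arr \<A>) e"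
  have d [simp]: "d (e f) = f" if "f \<in> hom \<A> Y Z" for f Y Z
    using homD(1)[OF that] e by (simp add: d_def)
  have H: "|e ` hom \<A> Z X| <o \<kappa>" for Z
    by (rule small_image, rule small_subset[OF _ Arr]) (auto simp: homD(1))
  \<comment> \<open>The representable presheaf hom(-, X), with arrows replaced by their codes under
    \<open>e\<close>; restriction along \<open>g\<close> is composition with
    \<open>g\<close>.\<close>
  define R where "R = \<lparr>FObj = (\<lambda>Z\<in>Obj \<A>. e ` hom \<A> Z X),
    FArr = (\<lambda>g\<in>Arr \<A>. (e ` hom \<A> (Cod \<A> g) X, \<lambda>w\<in>e ` hom \<A> (Cod \<A> g) X. e (Cmp \<A> (d w) g),
      e ` hom \<A> (Dom \<A> g) X))\<rparr>"
  have FObj_R: "FObj R Z = e ` hom \<A> Z X" if "Z \<in> Obj \<A>" for Z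
    using that by (simp add: R_def)
  have FArr_R: "FArr R g = (e ` hom \<A> Z X, \<lambda>w\<in>e ` hom \<A> Z X. e (Cmp \<A> (d w) g), e ` hom \<A> Y X)"
    if "g \<in> hom \<A> Y Z" for g Y Z
    using homD[OF that] by (simp add: R_def)
  have R_hom: "FArr R g \<in> hom (Set_cat \<kappa>) (e ` hom \<A> Z X) (e ` hom \<A> Y X)"
    if g: "g \<in> hom \<A> Y Z" for g Y Z
    using Cmp_hom[OF g] H by (auto simp: FArr_R[OF g] hom_Set_cat)
  have R_map: "set_map (FArr R g) (e f) = e (Cmp \<A> f g)"
    if "g \<in> hom \<A> Y Z" "f \<in> hom \<A> Z X" for f g Y Z
    using that by (simp add: FArr_R[OF that(1)])
  have R: "is_ftor (op_cat \<A>) (Set_cat \<kappa>) R"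
  proof (intro is_ftorI category_op_cat \<A> category_Set_cat)
    fix Z assume "Z \<in> Obj (op_cat \<A>)"
    then have Z: "Z \<in> Obj \<A>" by simp
    show "FObj R Z \<in> Obj (Set_cat \<kappa>)" using H by (simp add: FObj_R[OF Z])
    have "FArr R (Ident \<A> Z) = Ident (Set_cat \<kappa>) (e ` hom \<A> Z X)"
      by (rule Set_hom_eqI[OF R_hom[OF Ident_hom[OF Z]]
            category.Ident_hom[OF category_Set_cat]])
        (auto simp: H R_map[OF Ident_hom[OF Z]] Cmp_Ident)
    then show "FArr R (Ident (op_cat \<A>) Z) = Ident (Set_cat \<kappa>) (FObj R Z)"
      by (simp add: FObj_R[OF Z] del: Set_cat_simps)
  next
    fix g Z Y assume "g \<in> hom (op_cat \<A>) Z Y"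
    then have g: "g \<in> hom \<A> Y Z" by simp
    show "FArr R g \<in> hom (Set_cat \<kappa>) (FObj R Z) (FObj R Y)"
      using R_hom[OF g] by (simp add: FObj_R hom_Obj[OF g])
  next
    fix g h Z Y W assume "g \<in> hom (op_cat \<A>) Z Y" "h \<in> hom (op_cat \<A>) Y W"
    then have g: "g \<in> hom \<A> Y Z" and h: "h \<in> hom \<A> W Y" by simp_all
    have "FArr R (Cmp \<A> g h) = Cmp (Set_cat \<kappa>) (FArr R h) (FArr R g)"
    proof (rule Set_hom_eqI[OF R_hom[OF Cmp_hom[OF h g]]
          category.Cmp_hom[OF category_Set_cat R_hom[OF g] R_hom[OF h]]])
      fix w assume w: "w \<in> e ` hom \<A> Z X"
      then obtain f where f: "w = e f" "f \<in> hom \<A> Z X" by blast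
      show "set_map (FArr R (Cmp \<A> g h)) w = set_map (Cmp (Set_cat \<kappa>) (FArr R h) (FArr R g)) w"
        unfolding Set_Cmp_map[OF R_hom[OF g] w]
        using Cmp_assoc[OF h g f(2)]
        by (simp add: f R_map[OF g] R_map[OF h] R_map[OF Cmp_hom[OF h g]] Cmp_hom[OF g])
    qed
    then show "FArr R (Cmp (op_cat \<A>) h g) = Cmp (Set_cat \<kappa>) (FArr R h) (FArr R g)" by simp
  qed (simp_all add: R_def)
  \<comment> \<open>The universal element is the code of the identity.\<close>
  define x where "x = e (Ident \<A> X)"
  have x: "x \<in> FObj R X" using Ident_hom[OF X] by (simp add: FObj_R[OF X] x_def)
  have "\<exists>!t. t \<in> hom (presheaf_cat \<kappa> \<A>) R B \<and> set_map (At t X) x = b"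
    if B: "is_ftor (op_cat \<A>) (Set_cat \<kappa>) B" and b: "b \<in> FObj B X" for B b
  proof -
    note PB = presheafD[OF B \<A>]
    \<comment> \<open>The transformation belonging to \<open>b\<close> sends the code of
      \<open>f\<close> to the restriction of \<open>b\<close> along \<open>f\<close>.\<close>
    define t where "t = \<lparr>Src = R, Tgt = B, At = (\<lambda>Z\<in>Obj (op_cat \<A>).
      (e ` hom \<A> Z X, \<lambda>w\<in>e ` hom \<A> Z X. set_map (FArr B (d w)) b, FObj B Z))\<rparr>"
    have t_map: "set_map (At t Z) (e f) = set_map (FArr B f) b" if "f \<in> hom \<A> Z X" for f Z
      using that hom_Obj[OF that] by (simp add: t_def)
    have t_hom: "(e ` hom \<A> Z X, \<lambda>w\<in>e ` hom \<A> Z X. set_map (FArr B (d w)) b, FObj B Z) \<in>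
        hom (Set_cat \<kappa>) (e ` hom \<A> Z X) (FObj B Z)" if "Z \<in> Obj \<A>" for Z
      using PB(3)[OF _ b] PB(1)[OF that] H by (auto simp: hom_Set_cat)
    have t: "t \<in> hom (presheaf_cat \<kappa> \<A>) R B"
      unfolding t_def presheaf_cat_def
    proof (intro hom_ftor_catI R B)
      fix Z assume "Z \<in> Obj (op_cat \<A>)"
      then show "(e ` hom \<A> Z X, \<lambda>w\<in>e ` hom \<A> Z X. set_map (FArr B (d w)) b, FObj B Z) \<in>
          hom (Set_cat \<kappa>) (FObj R Z) (FObj B Z)"
        using t_hom by (simp add: FObj_R)
    next
      fix g Z Y assume "g \<in> hom (op_cat \<A>) Z Y"
      then have g: "g \<in> hom \<A> Y Z" by simp
      note Y = hom_Obj(1)[OF g] and Z = hom_Obj(2)[OF g]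
      show "Cmp (Set_cat \<kappa>) (e ` hom \<A> Y X, \<lambda>w\<in>e ` hom \<A> Y X. set_map (FArr B (d w)) b, FObj B Y)
          (FArr R g) =
        Cmp (Set_cat \<kappa>) (FArr B g)
          (e ` hom \<A> Z X, \<lambda>w\<in>e ` hom \<A> Z X. set_map (FArr B (d w)) b, FObj B Z)"
      proof (rule Set_hom_eqI[OF category.Cmp_hom[OF category_Set_cat R_hom[OF g] t_hom[OF Y]]
            category.Cmp_hom[OF category_Set_cat t_hom[OF Z] PB(2)[OF g]]])
        fix w assume w: "w \<in> e ` hom \<A> Z X"
        then obtain f where f: "w = e f" "f \<in> hom \<A> Z X" by blast
        show "set_map (Cmp (Set_cat \<kappa>) (e ` hom \<A> Y X, \<lambda>w\<in>e ` hom \<A> Y X. set_map (FArr B (d w)) b,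
              FObj B Y) (FArr R g)) w =
            set_map (Cmp (Set_cat \<kappa>) (FArr B g)
              (e ` hom \<A> Z X, \<lambda>w\<in>e ` hom \<A> Z X. set_map (FArr B (d w)) b, FObj B Z)) w"
          unfolding Set_Cmp_map[OF R_hom[OF g] w] Set_Cmp_map[OF t_hom[OF Z] w]
          using f g PB(5)[OF g f(2) b] Cmp_hom[OF g f(2)] by (simp add: R_map)
      qed
    qed
    show ?thesis
    proof (rule ex1I[of _ t], intro conjI t)
      show "set_map (At t X) x = b"
        using t_map[OF Ident_hom[OF X]] PB(4)[OF X b] by (simp add: x_def)
    next
      fix s assume s: "s \<in> hom (presheaf_cat \<kappa> \<A>) R B \<and> set_map (At s X) x = b"
      note s' = presheaf_homD[OF conjunct1[OF s]]
      show "s = t"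
      proof (rule ftor_cat_eqI[OF conjunct1[OF s, unfolded presheaf_cat_def]
            t[unfolded presheaf_cat_def]])
        fix Z assume "Z \<in> Obj (op_cat \<A>)"
        then have Z: "Z \<in> Obj \<A>" by simp
        show "At s Z = At t Z"
        proof (rule Set_hom_eqI[OF s'(5)[OF Z] presheaf_homD(5)[OF t Z]])
          fix w assume "w \<in> FObj R Z"
          then obtain f where f: "w = e f" "f \<in> hom \<A> Z X" using FObj_R[OF Z] by auto
          \<comment> \<open>Every element of \<open>R\<close> is a restriction of the universal
            element, so naturality leaves no choice for \<open>s\<close>.\<close>
          have "w = set_map (FArr R f) x"
            using R_map[OF f(2) Ident_hom[OF X]] Ident_Cmp[OF f(2)] by (simp add: f x_def)
          then show "set_map (At s Z) w = set_map (At t Z) w"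
            using s'(7)[OF \<A> f(2) x] s t_map[OF f(2)] by (simp add: f(1))
        qed
      qed
    qed
  qed
  with R x show ?thesis by (rule that)
qed

lemma presheaf_Cmp_map:
  assumes "s \<in> hom (presheaf_cat \<kappa> \<A>) A B" "X \<in> Obj \<A>" "x \<in> FObj A X"
  shows "set_map (At (Cmp (presheaf_cat \<kappa> \<A>) t s) X) x = set_map (At t X) (set_map (At s X) x)"
  using Set_Cmp_map[OF presheaf_homD(5)[OF assms(1,2)] assms(3)] assms(2)
  by (simp add: presheaf_cat_def del: Set_cat_simps)

text \<open>By the Yoneda lemma, elements at \<open>X\<close> are transformations out of the
  representable presheaf \<open>R\<close>. Applying the universal property of the square to cones
  with vertex \<open>R\<close> turns it into a statement about elements.\<close>

lemma cartesian_square_pointwise: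
  fixes \<kappa> :: "'u rel" and \<A> :: "('o, 'm) cat"
  assumes \<kappa>: "infinite_regular \<kappa>" and small: "small_category \<kappa> \<A>"
    and square: "cartesian_square (presheaf_cat \<kappa> \<A>) p q f g"
    and p: "p \<in> hom (presheaf_cat \<kappa> \<A>) P A" and q: "q \<in> hom (presheaf_cat \<kappa> \<A>) P B"
    and f: "f \<in> hom (presheaf_cat \<kappa> \<A>) A D" and g: "g \<in> hom (presheaf_cat \<kappa> \<A>) B D"
    and X: "X \<in> Obj \<A>" and x: "x \<in> FObj A X" and y: "y \<in> FObj B X"
    and eq: "set_map (At f X) x = set_map (At g X) y"
  shows "\<exists>!z. z \<in> FObj P X \<and> set_map (At p X) z = x \<and> set_map (At q X) z = y"
proof -
  have P: "is_ftor (op_cat \<A>) (Set_cat \<kappa>) P" and A: "is_ftor (op_cat \<A>) (Set_cat \<kappa>) A"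
    and B: "is_ftor (op_cat \<A>) (Set_cat \<kappa>) B" and D: "is_ftor (op_cat \<A>) (Set_cat \<kappa>) D"
    using presheaf_homD(1,2)[OF p] presheaf_homD(1,2)[OF g] by simp_all
  interpret Psh: category "presheaf_cat \<kappa> \<A>"
    unfolding presheaf_cat_def using is_ftorD(1,2)[OF P] by (rule category_ftor_cat)
  let ?comp = "Cmp (presheaf_cat \<kappa> \<A>)"
  obtain R r where R: "is_ftor (op_cat \<A>) (Set_cat \<kappa>) R" and r: "r \<in> FObj R X"
    and yoneda: "\<And>B b. is_ftor (op_cat \<A>) (Set_cat \<kappa>) B \<Longrightarrow> b \<in> FObj B X \<Longrightarrow>
      \<exists>!t. t \<in> hom (presheaf_cat \<kappa> \<A>) R B \<and> set_map (At t X) r = b"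
    using representable_presheaf[OF \<kappa> small X] by metis
  have unique: "s = t" if "s \<in> hom (presheaf_cat \<kappa> \<A>) R B" "t \<in> hom (presheaf_cat \<kappa> \<A>) R B"
    "set_map (At s X) r = set_map (At t X) r" for s t B
    using yoneda[OF presheaf_homD(2)[OF that(1)] presheaf_homD(6)[OF that(1) X r]] that by metis
  obtain u where u: "u \<in> hom (presheaf_cat \<kappa> \<A>) R A" "set_map (At u X) r = x"
    using yoneda[OF A x] by blast
  obtain v where v: "v \<in> hom (presheaf_cat \<kappa> \<A>) R B" "set_map (At v X) r = y"
    using yoneda[OF B y] by blast
  \<comment> \<open>Two transformations out of \<open>R\<close> agree as soon as they agree on the
    universal element \<open>r\<close>, and there this is the hypothesis \<open>eq\<close>.\<close>
  have "?comp f u = ?comp g v"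
    using unique[OF Psh.Cmp_hom[OF u(1) f] Psh.Cmp_hom[OF v(1) g]] eq
    by (simp add: presheaf_Cmp_map[OF u(1) X r] presheaf_Cmp_map[OF v(1) X r] u v)
  then have ex1: "\<exists>!h. h \<in> hom (presheaf_cat \<kappa> \<A>) R P \<and> ?comp p h = u \<and> ?comp q h = v"
    using square u(1) v(1) unfolding cartesian_square_def homD(2,3)[OF p] homD(2,3)[OF q] by blast
  then obtain h where h: "h \<in> hom (presheaf_cat \<kappa> \<A>) R P" "?comp p h = u" "?comp q h = v"
    by blast
  show ?thesis
  proof (rule ex1I[of _ "set_map (At h X) r"], intro conjI)
    show "set_map (At h X) r \<in> FObj P X" using h(1) X r by (rule presheaf_homD)
    show "set_map (At p X) (set_map (At h X) r) = x" "set_map (At q X) (set_map (At h X) r) = y"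
      using h(2,3) u(2) v(2) presheaf_Cmp_map[OF h(1) X r] by metis+
  next
    fix z assume z: "z \<in> FObj P X \<and> set_map (At p X) z = x \<and> set_map (At q X) z = y"
    then obtain t where t: "t \<in> hom (presheaf_cat \<kappa> \<A>) R P" "set_map (At t X) r = z"
      using yoneda[OF P] by blast
    have "?comp p t = u"
      using unique[OF Psh.Cmp_hom[OF t(1) p] u(1)] z u(2)
      by (simp add: presheaf_Cmp_map[OF t(1) X r] t(2))
    moreover have "?comp q t = v"
      using unique[OF Psh.Cmp_hom[OF t(1) q] v(1)] z v(2)
      by (simp add: presheaf_Cmp_map[OF t(1) X r] t(2))
    ultimately have "t = h" using ex1 t(1) h by blast
    then show "z = set_map (At h X) r" using t(2) by simp
  qed
qed


section \<open>Base change\<close>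

text \<open>Associativity is an equality, since both sides are restricted to the same domain.
  Together with its analogue for whiskering, it makes the two pull-backs along the diagonal of the
  square equal rather than merely isomorphic.\<close>

lemma ftor_comp_assoc:
  assumes "is_ftor I J H"
  shows "ftor_comp I (ftor_comp J F K) H = ftor_comp I F (ftor_comp I K H)"
  using is_ftorD(3)[OF assms] is_ftorD(4)[OF assms Arr_hom, THEN homD(1)]
  by (simp add: ftor_comp_def fun_eq_iff restrict_def)

lemma whisker_right_assoc:
  assumes "is_ftor I J H"
  shows "whisker_right I (whisker_right J t K) H = whisker_right I t (ftor_comp I K H)"
  using is_ftorD(3)[OF assms]
  by (simp add: ftor_comp_assoc[OF assms] whisker_right_def fun_eq_iff restrict_def ftor_comp_simps)

text \<open>The functor sending (s, v) to (\<open>FObj K\<^sub>1 s\<close>, \<open>FArr K v\<close>)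
  is well typed by \<open>KK\<close> and matches the two diagrams. By \<open>lift\<close> it is
  bijective on objects and by \<open>lift_arr\<close> it is full. Bijectivity permits moving the
  cocone \<mu> to the other index category, and fullness keeps it a cocone there; the arrow induced
  by it is inverse to \<open>t\<close>.\<close>

lemma comma_colimits_is_iso:
  assumes K: "is_ftor I\<^sub>1 I\<^sub>0 K" and K1: "is_ftor I\<^sub>2 I\<^sub>1 K\<^sub>1" and K2: "is_ftor I\<^sub>2 I\<^sub>1 K\<^sub>2"
    and F: "is_ftor I\<^sub>1 C F"
    and lift: "\<And>p u. p \<in> Obj I\<^sub>1 \<Longrightarrow> u \<in> hom I\<^sub>0 (FObj K p) (FObj K q) \<Longrightarrow>
      \<exists>!x. x \<in> Obj (comma I\<^sub>2 I\<^sub>1 K\<^sub>2 q) \<and> FObj K\<^sub>1 (fst x) = p \<and> FArr K (snd x) = u"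
    and lift_arr: "\<And>s v s' v' g. (s, v) \<in> Obj (comma I\<^sub>2 I\<^sub>1 K\<^sub>2 q) \<Longrightarrow>
      (s', v') \<in> Obj (comma I\<^sub>2 I\<^sub>1 K\<^sub>2 q) \<Longrightarrow> g \<in> hom I\<^sub>1 (FObj K\<^sub>1 s') (FObj K\<^sub>1 s) \<Longrightarrow>
      FArr K v' = Cmp I\<^sub>0 (FArr K v) (FArr K g) \<Longrightarrow>
      \<exists>w\<in>hom I\<^sub>2 s' s. FArr K\<^sub>1 w = g \<and> v' = Cmp I\<^sub>1 v (FArr K\<^sub>2 w)"
    and KK: "\<And>s. s \<in> Obj I\<^sub>2 \<Longrightarrow> FObj K (FObj K\<^sub>1 s) = FObj K (FObj K\<^sub>2 s)"
    and c: "is_colimit (comma I\<^sub>2 I\<^sub>1 K\<^sub>2 q) C (comma_diagram I\<^sub>2 I\<^sub>1 K\<^sub>2 q (ftor_comp I\<^sub>2 F K\<^sub>1)) c \<mu>"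
    and d: "is_colimit (comma I\<^sub>1 I\<^sub>0 K (FObj K q)) C (comma_diagram I\<^sub>1 I\<^sub>0 K (FObj K q) F) d \<nu>"
    and t: "t \<in> hom C c d"
    and t_eq: "\<And>s v. (s, v) \<in> Obj (comma I\<^sub>2 I\<^sub>1 K\<^sub>2 q) \<Longrightarrow>
      Cmp C t (\<mu> (s, v)) = \<nu> (FObj K\<^sub>1 s, FArr K v)"
  shows "is_iso C t"
proof -
  interpret C: category C using F by (rule is_ftorD)
  interpret I0: category I\<^sub>0 using K by (rule is_ftorD)
  interpret I1: category I\<^sub>1 using K by (rule is_ftorD)
  define X where "X = Obj (comma I\<^sub>2 I\<^sub>1 K\<^sub>2 q)"
  note \<mu> = is_colimitD(1)[OF c, unfolded is_cocone_comma[OF K2]]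
  have \<mu>_hom: "\<mu> (s, v) \<in> hom C (FObj F (FObj K\<^sub>1 s)) c" if "(s, v) \<in> X" for s v
    using \<mu> that by (simp add: X_def ftor_comp_simps)
  have \<mu>_nat: "Cmp C (\<mu> (s, v)) (FArr F (FArr K\<^sub>1 w)) = \<mu> (s', Cmp I\<^sub>1 v (FArr K\<^sub>2 w))"
    if "w \<in> hom I\<^sub>2 s' s" "(s, v) \<in> X" for s s' v w
  proof -
    have "Cmp C (\<mu> (s, v)) (FArr (ftor_comp I\<^sub>2 F K\<^sub>1) w) = \<mu> (s', Cmp I\<^sub>1 v (FArr K\<^sub>2 w))"
      using \<mu> that by (simp add: X_def)
    then show ?thesis using homD(1)[OF that(1)] by (simp add: ftor_comp_simps)
  qed
  have KX: "FObj K\<^sub>1 s \<in> Obj I\<^sub>1" "FArr K v \<in> hom I\<^sub>0 (FObj K (FObj K\<^sub>1 s)) (FObj K q)"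
    if "(s, v) \<in> X" for s v
    using that KK is_ftorD(3)[OF K1] is_ftorD(4)[OF K] by (auto simp: X_def)
  \<comment> \<open>The inverse of the functor on objects.\<close>
  define L where "L p u = (THE x. x \<in> X \<and> FObj K\<^sub>1 (fst x) = p \<and> FArr K (snd x) = u)" for p u
  have L: "L p u \<in> X" "FObj K\<^sub>1 (fst (L p u)) = p" "FArr K (snd (L p u)) = u"
    if "p \<in> Obj I\<^sub>1" "u \<in> hom I\<^sub>0 (FObj K p) (FObj K q)" for p u
    using theI'[OF lift[OF that]] unfolding L_def X_def by blast+
  have L_eq: "L (FObj K\<^sub>1 s) (FArr K v) = (s, v)" if "(s, v) \<in> X" for s v
    using lift[OF KX[OF that]] L[OF KX[OF that]] that unfolding X_def[symmetric]
    by (metis fst_conv snd_conv)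
  \<comment> \<open>Compatibility at \<open>g\<close> is compatibility of \<mu> at an arrow
    \<open>w\<close> above \<open>g\<close>, supplied by \<open>lift_arr\<close> between the lifts
    of the two ends.\<close>
  have "is_cocone (comma I\<^sub>1 I\<^sub>0 K (FObj K q)) C (comma_diagram I\<^sub>1 I\<^sub>0 K (FObj K q) F) c
      (\<lambda>(p, u). \<mu> (L p u))"
    unfolding is_cocone_comma[OF K]
  proof (intro conjI allI impI)
    show "c \<in> Obj C" using \<mu> by blast
  next
    fix p u assume pu: "p \<in> Obj I\<^sub>1" "u \<in> hom I\<^sub>0 (FObj K p) (FObj K q)"
    show "(case (p, u) of (p, u) \<Rightarrow> \<mu> (L p u)) \<in> hom C (FObj F p) c"
      using \<mu>_hom[of "fst (L p u)" "snd (L p u)"] L[OF pu] by simp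
  next
    fix p p' g u assume g: "g \<in> hom I\<^sub>1 p p'" and u: "u \<in> hom I\<^sub>0 (FObj K p') (FObj K q)"
    note p = I1.hom_Obj[OF g]
    note ug = I0.Cmp_hom[OF is_ftorD(4)[OF K g] u]
    obtain s v where sv: "L p' u = (s, v)" by fastforce
    obtain s' v' where sv': "L p (Cmp I\<^sub>0 u (FArr K g)) = (s', v')" by fastforce
    note L1 = L[OF p(2) u, unfolded sv fst_conv snd_conv]
    note L2 = L[OF p(1) ug, unfolded sv' fst_conv snd_conv]
    obtain w where w: "w \<in> hom I\<^sub>2 s' s" "FArr K\<^sub>1 w = g" "v' = Cmp I\<^sub>1 v (FArr K\<^sub>2 w)"
      using lift_arr[of s v s' v' g] L1 L2 g unfolding X_def by blast
    show "Cmp C (case (p', u) of (p, u) \<Rightarrow> \<mu> (L p u)) (FArr F g) =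
        (case (p, Cmp I\<^sub>0 u (FArr K g)) of (p, u) \<Rightarrow> \<mu> (L p u))"
      using \<mu>_nat[OF w(1) L1(1)] w(2,3) by (simp add: sv sv')
  qed
  from is_colimitD(2)[OF d this] obtain h where h: "h \<in> hom C d c"
    and "\<forall>x\<in>Obj (comma I\<^sub>1 I\<^sub>0 K (FObj K q)). Cmp C h (\<nu> x) = (\<lambda>(p, u). \<mu> (L p u)) x"
    by blast
  then have h_eq: "Cmp C h (\<nu> (p, u)) = \<mu> (L p u)"
    if "p \<in> Obj I\<^sub>1" "u \<in> hom I\<^sub>0 (FObj K p) (FObj K q)" for p u
    using that by simp
  note \<nu> = is_colimitD(1)[OF d, unfolded is_cocone_comma[OF K]]
  note cObj = C.hom_Obj(1)[OF t] and dObj = C.hom_Obj(2)[OF t]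
  show ?thesis
    using t h
  proof (rule is_isoI)
    show "Cmp C h t = Ident C c"
    proof (rule C.colimit_unique[OF is_ftor_comma_diagram[OF K2 is_ftor_comp[OF K1 F]] c
          C.Cmp_hom[OF t h] C.Ident_hom[OF cObj]])
      fix x assume x: "x \<in> Obj (comma I\<^sub>2 I\<^sub>1 K\<^sub>2 q)"
      obtain s v where sv: "x = (s, v)" by (cases x)
      then have X: "(s, v) \<in> X" using x by (simp add: X_def)
      show "Cmp C (Cmp C h t) (\<mu> x) = Cmp C (Ident C c) (\<mu> x)"
        unfolding sv
        using C.Cmp_assoc[OF \<mu>_hom[OF X] t h] t_eq[OF X[unfolded X_def]] h_eq[OF KX[OF X]]
          L_eq[OF X] C.Ident_Cmp[OF \<mu>_hom[OF X]] by simp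
    qed
    show "Cmp C t h = Ident C d"
    proof (rule C.colimit_unique[OF is_ftor_comma_diagram[OF K F] d
          C.Cmp_hom[OF h t] C.Ident_hom[OF dObj]])
      fix x assume "x \<in> Obj (comma I\<^sub>1 I\<^sub>0 K (FObj K q))"
      then obtain p u where x: "x = (p, u)" "p \<in> Obj I\<^sub>1" "u \<in> hom I\<^sub>0 (FObj K p) (FObj K q)"
        by (cases x) auto
      have \<nu>_hom: "\<nu> (p, u) \<in> hom C (FObj F p) d" using \<nu> x by blast
      have "Cmp C t (\<mu> (L p u)) = \<nu> (p, u)"
        using t_eq[of "fst (L p u)" "snd (L p u)"] L[OF x(2,3)] by (simp add: X_def)
      then show "Cmp C (Cmp C t h) (\<nu> x) = Cmp C (Ident C d) (\<nu> x)"
        using C.Cmp_assoc[OF \<nu>_hom h t] h_eq[OF x(2,3)] C.Ident_Cmp[OF \<nu>_hom] x(1) by simp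
    qed
  qed
qed

text \<open>Fullness and bijectivity on objects of the functor from the comma category over \<open>q\<close> to the one
  over the image of \<open>q\<close> that is induced by \<open>K\<^sub>1\<close> and \<open>K\<close>.\<close>

lemma elements_comma_lift:
  fixes \<kappa> :: "'u rel" and \<A> :: "('o, 'm) cat"
  assumes \<kappa>: "infinite_regular \<kappa>" and small: "small_category \<kappa> \<A>"
    and a: "a \<in> hom (presheaf_cat \<kappa> \<A>) A\<^sub>1 A\<^sub>0"
    and a1: "a\<^sub>1 \<in> hom (presheaf_cat \<kappa> \<A>) A\<^sub>2 A\<^sub>1" and a2: "a\<^sub>2 \<in> hom (presheaf_cat \<kappa> \<A>) A\<^sub>2 A\<^sub>1"
    and square: "cartesian_square (presheaf_cat \<kappa> \<A>) a\<^sub>1 a\<^sub>2 a a"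
    and q: "q \<in> Obj (elements \<A> A\<^sub>1)"
  defines "I\<^sub>2 \<equiv> elements \<A> A\<^sub>2" and "I\<^sub>1 \<equiv> elements \<A> A\<^sub>1" and "I\<^sub>0 \<equiv> elements \<A> A\<^sub>0"
    and "K \<equiv> elements_map \<A> a" and "K\<^sub>1 \<equiv> elements_map \<A> a\<^sub>1" and "K\<^sub>2 \<equiv> elements_map \<A> a\<^sub>2"
  shows "p \<in> Obj I\<^sub>1 \<Longrightarrow> u \<in> hom I\<^sub>0 (FObj K p) (FObj K q) \<Longrightarrow>
      \<exists>!x. x \<in> Obj (comma I\<^sub>2 I\<^sub>1 K\<^sub>2 q) \<and> FObj K\<^sub>1 (fst x) = p \<and> FArr K (snd x) = u"
    and "(s, v) \<in> Obj (comma I\<^sub>2 I\<^sub>1 K\<^sub>2 q) \<Longrightarrow> (s', v') \<in> Obj (comma I\<^sub>2 I\<^sub>1 K\<^sub>2 q) \<Longrightarrow>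
      g \<in> hom I\<^sub>1 (FObj K\<^sub>1 s') (FObj K\<^sub>1 s) \<Longrightarrow> FArr K v' = Cmp I\<^sub>0 (FArr K v) (FArr K g) \<Longrightarrow>
      \<exists>w\<in>hom I\<^sub>2 s' s. FArr K\<^sub>1 w = g \<and> v' = Cmp I\<^sub>1 v (FArr K\<^sub>2 w)"
proof -
  interpret category \<A> using small by (simp add: small_category_def)
  note \<A> = category_axioms
  note pb = cartesian_square_pointwise[OF \<kappa> small square a1 a2 a a]
  note A2 = presheafD[OF presheaf_homD(1)[OF a1] \<A>]
  note A1 = presheafD[OF presheaf_homD(1)[OF a] \<A>]
  note a_simps = elements_map_simps[where \<A> = \<A>, OF presheaf_homD(3)[OF a]]
  note a1_simps = elements_map_simps[where \<A> = \<A>, OF presheaf_homD(3)[OF a1]]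
  note a2_simps = elements_map_simps[where \<A> = \<A>, OF presheaf_homD(3)[OF a2]]
  obtain Y y where q_eq: "q = (Y, y)" and Y: "Y \<in> Obj \<A>" and y: "y \<in> FObj A\<^sub>1 Y"
    using q by (cases q) auto
  \<comment> \<open>\<open>K\<close> leaves the underlying arrow of the base category unchanged.
    Comparing images under \<open>K\<close> therefore compares underlying arrows.\<close>
  have K_arr: "FArr K ((X, x), f, (Z, z)) = ((X, set_map (At a X) x), f, (Z, set_map (At a Z) z))"
    if "((X, x), f, (Z, z)) \<in> hom I\<^sub>1 (X, x) (Z, z)" for X x f Z z
    using homD(1)[OF that] unfolding K_def I\<^sub>1_def by (rule a_simps)
  have comma_objE: "\<exists>X z f. s = (X, z) \<and> v = ((X, set_map (At a\<^sub>2 X) z), f, (Y, y)) \<and> X \<in> Obj \<A> \<and>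
      z \<in> FObj A\<^sub>2 X \<and> f \<in> hom \<A> X Y \<and> set_map (FArr A\<^sub>1 f) y = set_map (At a\<^sub>2 X) z"
    if "(s, v) \<in> Obj (comma I\<^sub>2 I\<^sub>1 K\<^sub>2 q)" for s v
    using that unfolding comma_simps I\<^sub>2_def I\<^sub>1_def K\<^sub>2_def q_eq
    by (cases s) (auto simp: a2_simps elim!: hom_elementsE)
  {
    assume p: "p \<in> Obj I\<^sub>1" and u: "u \<in> hom I\<^sub>0 (FObj K p) (FObj K q)"
    obtain X x where p_eq: "p = (X, x)" and X: "X \<in> Obj \<A>" and x: "x \<in> FObj A\<^sub>1 X"
      using p unfolding I\<^sub>1_def by (cases p) auto
    obtain f where u_eq: "u = ((X, set_map (At a X) x), f, (Y, set_map (At a Y) y))"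
      and f: "f \<in> hom \<A> X Y"
      and f_eq: "set_map (FArr A\<^sub>0 f) (set_map (At a Y) y) = set_map (At a X) x"
      using u X x Y y unfolding I\<^sub>0_def K_def p_eq q_eq by (auto simp: a_simps elim!: hom_elementsE)
    \<comment> \<open>The arrow of \<open>I\<^sub>1\<close> from (X, x') to \<open>q\<close> with
      underlying arrow \<open>f\<close> is the lift of \<open>u\<close>. By naturality of
      \<open>a\<close>, the elements x and x' have the same image in \<open>A\<^sub>0\<close>, so
      the pair is an element z of the pullback.\<close>
    define x' where "x' = set_map (FArr A\<^sub>1 f) y"
    have x': "x' \<in> FObj A\<^sub>1 X" using A1(3)[OF f y] by (simp add: x'_def)
    have "set_map (At a X) x = set_map (At a X) x'"
      using presheaf_homD(7)[OF a \<A> f y] f_eq by (simp add: x'_def)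
    from pb[OF X x x' this]
    obtain z where z: "z \<in> FObj A\<^sub>2 X" "set_map (At a\<^sub>1 X) z = x" "set_map (At a\<^sub>2 X) z = x'"
      and z_unique: "\<And>z'. z' \<in> FObj A\<^sub>2 X \<Longrightarrow> set_map (At a\<^sub>1 X) z' = x \<Longrightarrow>
        set_map (At a\<^sub>2 X) z' = x' \<Longrightarrow> z' = z"
      by blast
    have v: "((X, x'), f, (Y, y)) \<in> hom I\<^sub>1 (X, x') (Y, y)"
      using f x' y by (simp add: I\<^sub>1_def hom_elements x'_def)
    show "\<exists>!x. x \<in> Obj (comma I\<^sub>2 I\<^sub>1 K\<^sub>2 q) \<and> FObj K\<^sub>1 (fst x) = p \<and> FArr K (snd x) = u"
    proof (rule ex1I[of _ "((X, z), ((X, x'), f, (Y, y)))"], intro conjI)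
      show "((X, z), ((X, x'), f, (Y, y))) \<in> Obj (comma I\<^sub>2 I\<^sub>1 K\<^sub>2 q)"
        using v X z by (simp add: q_eq I\<^sub>2_def K\<^sub>2_def a2_simps)
      show "FObj K\<^sub>1 (fst ((X, z), ((X, x'), f, (Y, y)))) = p"
        using X z by (simp add: K\<^sub>1_def a1_simps p_eq)
      show "FArr K (snd ((X, z), ((X, x'), f, (Y, y)))) = u"
        using \<open>set_map (At a X) x = set_map (At a X) x'\<close> by (simp add: K_arr[OF v] u_eq)
    next
      fix t assume t: "t \<in> Obj (comma I\<^sub>2 I\<^sub>1 K\<^sub>2 q) \<and> FObj K\<^sub>1 (fst t) = p \<and> FArr K (snd t) = u"
      obtain s v where t_eq: "t = (s, v)" by (cases t)
      obtain X' z' f' where s: "s = (X', z')" "v = ((X', set_map (At a\<^sub>2 X') z'), f', (Y, y))"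
        "X' \<in> Obj \<A>" "z' \<in> FObj A\<^sub>2 X'" "f' \<in> hom \<A> X' Y"
        "set_map (FArr A\<^sub>1 f') y = set_map (At a\<^sub>2 X') z'"
        using comma_objE t unfolding t_eq by blast
      have "X' = X" "set_map (At a\<^sub>1 X') z' = x"
        using t s(1,3,4) by (auto simp: t_eq K\<^sub>1_def a1_simps p_eq)
      moreover have "v \<in> hom I\<^sub>1 (X', set_map (At a\<^sub>2 X') z') (Y, y)"
        using s(3-6) y presheaf_homD(6)[OF a2 s(3,4)] by (simp add: s(2) I\<^sub>1_def hom_elements)
      \<comment> \<open>With the underlying arrow known, the second projection of z' must be the
        restriction of y along \<open>f\<close>, which is x'. Both projections of z' are then
        prescribed, and z' is z.\<close>
      then have "f' = f"
        using K_arr[of X' "set_map (At a\<^sub>2 X') z'" f' Y y] t by (simp add: s(2) t_eq u_eq)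
      ultimately show "t = ((X, z), ((X, x'), f, (Y, y)))"
        using s(4,6) z_unique[of z'] z(3) by (simp add: t_eq s(1,2) x'_def)
    qed
  }
  {
    assume sv: "(s, v) \<in> Obj (comma I\<^sub>2 I\<^sub>1 K\<^sub>2 q)" and sv': "(s', v') \<in> Obj (comma I\<^sub>2 I\<^sub>1 K\<^sub>2 q)"
      and g: "g \<in> hom I\<^sub>1 (FObj K\<^sub>1 s') (FObj K\<^sub>1 s)" and eq: "FArr K v' = Cmp I\<^sub>0 (FArr K v) (FArr K g)"
    obtain X z f where s: "s = (X, z)" "v = ((X, set_map (At a\<^sub>2 X) z), f, (Y, y))"
      "X \<in> Obj \<A>" "z \<in> FObj A\<^sub>2 X" "f \<in> hom \<A> X Y" "set_map (FArr A\<^sub>1 f) y = set_map (At a\<^sub>2 X) z"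
      using comma_objE[OF sv] by blast
    obtain X' z' f' where s': "s' = (X', z')" "v' = ((X', set_map (At a\<^sub>2 X') z'), f', (Y, y))"
      "X' \<in> Obj \<A>" "z' \<in> FObj A\<^sub>2 X'" "f' \<in> hom \<A> X' Y"
      "set_map (FArr A\<^sub>1 f') y = set_map (At a\<^sub>2 X') z'"
      using comma_objE[OF sv'] by blast
    obtain g0 where g0: "g = ((X', set_map (At a\<^sub>1 X') z'), g0, (X, set_map (At a\<^sub>1 X) z))"
      "g0 \<in> hom \<A> X' X" "set_map (FArr A\<^sub>1 g0) (set_map (At a\<^sub>1 X) z) = set_map (At a\<^sub>1 X') z'"
      using g s(3,4) s'(3,4) unfolding I\<^sub>1_def K\<^sub>1_def s(1) s'(1)
      by (auto simp: a1_simps elim!: hom_elementsE)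
    have homs: "v \<in> hom I\<^sub>1 (X, set_map (At a\<^sub>2 X) z) (Y, y)"
      "v' \<in> hom I\<^sub>1 (X', set_map (At a\<^sub>2 X') z') (Y, y)"
      "g \<in> hom I\<^sub>1 (X', set_map (At a\<^sub>1 X') z') (X, set_map (At a\<^sub>1 X) z)"
      using s(5,6) s'(5,6) g0 y presheaf_homD(6)[OF a2 s(3,4)] presheaf_homD(6)[OF a2 s'(3,4)]
        presheaf_homD(6)[OF a1 s(3,4)] presheaf_homD(6)[OF a1 s'(3,4)]
      by (simp_all add: s(2) s'(2) I\<^sub>1_def hom_elements)
    \<comment> \<open>The hypothesis \<open>eq\<close> is an equality in \<open>I\<^sub>0\<close>;
      its component in the base category is what is needed.\<close>
    have f': "f' = Cmp \<A> f g0"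
      using eq K_arr[OF homs(1)[unfolded s(2)]] K_arr[OF homs(2)[unfolded s'(2)]]
        K_arr[OF homs(3)[unfolded g0(1)]]
      by (simp add: s(2) s'(2) g0(1) I\<^sub>0_def)
    define w where "w = ((X', z'), g0, (X, z))"
    \<comment> \<open>The arrow \<open>g0\<close> lifts to \<open>I\<^sub>2\<close> only if it
      restricts z to z'. Elements of the pullback are equal when both projections agree: for
      \<open>a\<^sub>1\<close> this is the condition that \<open>g\<close> is an arrow, for
      \<open>a\<^sub>2\<close> both sides are the restriction of y along
      \<open>Cmp \<A> f g0\<close>.\<close>
    have "set_map (FArr A\<^sub>2 g0) z = z'"
    proof -
      let ?z = "set_map (FArr A\<^sub>2 g0) z"
      have "set_map (At a\<^sub>1 X') ?z = set_map (At a\<^sub>1 X') z'"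
        using presheaf_homD(7)[OF a1 \<A> g0(2) s(4)] g0(3) by simp
      moreover have "set_map (At a\<^sub>2 X') ?z = set_map (At a\<^sub>2 X') z'"
        using presheaf_homD(7)[OF a2 \<A> g0(2) s(4)] s(6) s'(6) A1(5)[OF g0(2) s(5) y] f' by simp
      moreover have "set_map (At a X') (set_map (At a\<^sub>1 X') z') =
          set_map (At a X') (set_map (At a\<^sub>2 X') z')"
        using square presheaf_Cmp_map[OF a1 s'(3,4)] presheaf_Cmp_map[OF a2 s'(3,4)]
        unfolding cartesian_square_def by metis
      ultimately show ?thesis
        using pb[OF s'(3) presheaf_homD(6)[OF a1 s'(3,4)] presheaf_homD(6)[OF a2 s'(3,4)]]
          A2(3)[OF g0(2) s(4)] s'(4) by blast
    qed
    then have w: "w \<in> hom I\<^sub>2 s' s"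
      using g0(2) s(4) s'(4) by (simp add: w_def s(1) s'(1) I\<^sub>2_def hom_elements)
    then have "w \<in> Arr (elements \<A> A\<^sub>2)" unfolding I\<^sub>2_def by (rule homD)
    then show "\<exists>w\<in>hom I\<^sub>2 s' s. FArr K\<^sub>1 w = g \<and> v' = Cmp I\<^sub>1 v (FArr K\<^sub>2 w)"
      using w by (intro bexI[of _ w])
        (simp_all add: w_def K\<^sub>1_def K\<^sub>2_def a1_simps a2_simps g0(1) s(2) s'(2) I\<^sub>1_def f')
  }
qed

text \<open>Three facts meet here: the two pointwise colimit formulas for the given left adjoints,
  the matching of their index categories, and the description of base change as a transpose, which
  identifies it with the comparison of these colimits.\<close>

lemma exchange_condition_cocomplete:
  fixes \<kappa> :: "'u rel" and \<A> :: "('o, 'm) cat" and C :: "('p, 'q) cat"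
  assumes \<kappa>: "infinite_regular \<kappa>" and small: "small_category \<kappa> \<A>"
    and a: "a \<in> hom (presheaf_cat \<kappa> \<A>) A\<^sub>1 A\<^sub>0"
    and a1: "a\<^sub>1 \<in> hom (presheaf_cat \<kappa> \<A>) A\<^sub>2 A\<^sub>1" and a2: "a\<^sub>2 \<in> hom (presheaf_cat \<kappa> \<A>) A\<^sub>2 A\<^sub>1"
    and square: "cartesian_square (presheaf_cat \<kappa> \<A>) a\<^sub>1 a\<^sub>2 a a"
    and C: "cocomplete \<kappa> C"
  shows "exchange_condition \<A> C a a\<^sub>1 a\<^sub>2"
proof -
  have \<A>: "category \<A>" using small by (simp add: small_category_def)
  have category_C: "category C" using C by (simp add: cocomplete_def)
  note src = presheaf_homD(3)[OF a] presheaf_homD(3)[OF a1] presheaf_homD(3)[OF a2]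
  note tgt = presheaf_homD(4)[OF a] presheaf_homD(4)[OF a1] presheaf_homD(4)[OF a2]
  define I\<^sub>0 where "I\<^sub>0 = elements \<A> A\<^sub>0"
  define I\<^sub>1 where "I\<^sub>1 = elements \<A> A\<^sub>1"
  define I\<^sub>2 where "I\<^sub>2 = elements \<A> A\<^sub>2"
  define K where "K = elements_map \<A> a"
  define K\<^sub>1 where "K\<^sub>1 = elements_map \<A> a\<^sub>1"
  define K\<^sub>2 where "K\<^sub>2 = elements_map \<A> a\<^sub>2"
  define M\<^sub>1 where "M\<^sub>1 = ftor_cat I\<^sub>1 C"
  define P where "P = precomp_ftor I\<^sub>1 I\<^sub>0 C K"
  define P\<^sub>1 where "P\<^sub>1 = precomp_ftor I\<^sub>2 I\<^sub>1 C K\<^sub>1"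
  define P\<^sub>2 where "P\<^sub>2 = precomp_ftor I\<^sub>2 I\<^sub>1 C K\<^sub>2"
  have small_I: "small_category \<kappa> I\<^sub>0" "small_category \<kappa> I\<^sub>1" "small_category \<kappa> I\<^sub>2"
    using small_elements[OF \<kappa> small] presheaf_homD(1,2)[OF a] presheaf_homD(1)[OF a1]
    by (simp_all add: I\<^sub>0_def I\<^sub>1_def I\<^sub>2_def)
  have K: "is_ftor I\<^sub>1 I\<^sub>0 K" and K1: "is_ftor I\<^sub>2 I\<^sub>1 K\<^sub>1" and K2: "is_ftor I\<^sub>2 I\<^sub>1 K\<^sub>2"
    using is_ftor_elements_map[OF _ \<A>] a a1 a2
    by (simp_all add: I\<^sub>0_def I\<^sub>1_def I\<^sub>2_def K_def K\<^sub>1_def K\<^sub>2_def)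
  interpret I2: category I\<^sub>2 using K1 by (rule is_ftorD)
  interpret C: category C by (rule category_C)
  have aa: "set_map (At a X) (set_map (At a\<^sub>1 X) z) = set_map (At a X) (set_map (At a\<^sub>2 X) z)"
    if "X \<in> Obj \<A>" "z \<in> FObj A\<^sub>2 X" for X z
    using square presheaf_Cmp_map[OF a1 that] presheaf_Cmp_map[OF a2 that]
    unfolding cartesian_square_def by metis
  \<comment> \<open>This is the equality of \<open>a a\<^sub>1\<close> and
    \<open>a a\<^sub>2\<close> on the level of categories of elements. An equality of functors is
    required, since the target of one whiskered transformation must be the source of the
    other.\<close>
  have KK: "ftor_comp I\<^sub>2 K K\<^sub>1 = ftor_comp I\<^sub>2 K K\<^sub>2"
  proof (rule ftor_eqI[OF is_ftor_comp[OF K1 K] is_ftor_comp[OF K2 K]])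
    fix s assume "s \<in> Obj I\<^sub>2"
    then show "FObj (ftor_comp I\<^sub>2 K K\<^sub>1) s = FObj (ftor_comp I\<^sub>2 K K\<^sub>2) s"
      using presheaf_homD(6)[OF a1] presheaf_homD(6)[OF a2] aa
      by (cases s) (simp add: ftor_comp_simps K_def K\<^sub>1_def K\<^sub>2_def I\<^sub>2_def elements_map_simps[OF src(1)]
          elements_map_simps[OF src(2)] elements_map_simps[OF src(3)])
  next
    fix w assume w: "w \<in> Arr I\<^sub>2"
    obtain X' z' g X z where w_eq: "w = ((X', z'), g, (X, z))" by (metis prod.collapse)
    have obj: "(X', z') \<in> Obj I\<^sub>2" "(X, z) \<in> Obj I\<^sub>2"
      using I2.Dom_Obj[OF w] I2.Cod_Obj[OF w] by (simp_all add: w_eq I\<^sub>2_def)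
    have "FArr K\<^sub>1 w \<in> Arr I\<^sub>1" "FArr K\<^sub>2 w \<in> Arr I\<^sub>1"
      using homD(1)[OF is_ftorD(4)[OF K1 Arr_hom[OF w]]]
        homD(1)[OF is_ftorD(4)[OF K2 Arr_hom[OF w]]] .
    then show "FArr (ftor_comp I\<^sub>2 K K\<^sub>1) w = FArr (ftor_comp I\<^sub>2 K K\<^sub>2) w"
      using w obj aa unfolding w_eq
      by (simp add: ftor_comp_simps K_def K\<^sub>1_def K\<^sub>2_def I\<^sub>2_def I\<^sub>1_def elements_map_simps[OF src(1)]
          elements_map_simps[OF src(2)] elements_map_simps[OF src(3)])
  qed
  have P: "is_ftor (ftor_cat I\<^sub>0 C) M\<^sub>1 P" and P1: "is_ftor M\<^sub>1 (ftor_cat I\<^sub>2 C) P\<^sub>1"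
    and P2: "is_ftor M\<^sub>1 (ftor_cat I\<^sub>2 C) P\<^sub>2"
    unfolding M\<^sub>1_def P_def P\<^sub>1_def P\<^sub>2_def
    using is_ftor_precomp[OF K category_C] is_ftor_precomp[OF K1 category_C]
      is_ftor_precomp[OF K2 category_C] by blast+
  have pullbacks: "pullback \<A> C a = P" "pullback \<A> C a\<^sub>1 = P\<^sub>1" "pullback \<A> C a\<^sub>2 = P\<^sub>2"
    by (simp_all add: pullback_def src tgt P_def P\<^sub>1_def P\<^sub>2_def I\<^sub>0_def I\<^sub>1_def I\<^sub>2_def K_def K\<^sub>1_def K\<^sub>2_def)
  have "is_iso (ftor_cat M\<^sub>1 M\<^sub>1) (base_change \<A> C a a\<^sub>1 a\<^sub>2 l \<eta> l\<^sub>2 \<epsilon>\<^sub>2)"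
    if adj: "adjunction M\<^sub>1 (ftor_cat I\<^sub>0 C) l P \<eta> \<epsilon>"
      and adj2: "adjunction (ftor_cat I\<^sub>2 C) M\<^sub>1 l\<^sub>2 P\<^sub>2 \<eta>\<^sub>2 \<epsilon>\<^sub>2" for l \<eta> \<epsilon> l\<^sub>2 \<eta>\<^sub>2 \<epsilon>\<^sub>2
  proof -
    note l = adjunctionD(1)[OF adj] and l2 = adjunctionD(1)[OF adj2]
    interpret M1: category M\<^sub>1 using l by (rule is_ftorD)
    have \<eta>: "\<eta> \<in> hom (ftor_cat M\<^sub>1 M\<^sub>1) (id_ftor M\<^sub>1) (ftor_comp M\<^sub>1 P l)"
      and \<epsilon>2: "\<epsilon>\<^sub>2 \<in> hom (ftor_cat M\<^sub>1 M\<^sub>1) (ftor_comp M\<^sub>1 l\<^sub>2 P\<^sub>2) (id_ftor M\<^sub>1)"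
      using adj adj2 by (simp_all add: adjunction_def)
    note Pl = is_ftor_comp[OF l P]
    define \<sigma> where "\<sigma> = whisker_left M\<^sub>1 (ftor_comp M\<^sub>1 l\<^sub>2 P\<^sub>1) \<eta>"
    define \<rho> where "\<rho> = whisker_right M\<^sub>1 \<epsilon>\<^sub>2 (ftor_comp M\<^sub>1 P l)"
    define \<tau> where "\<tau> = Cmp (ftor_cat M\<^sub>1 M\<^sub>1) \<rho> \<sigma>"
    \<comment> \<open>The target of \<sigma> passes through \<open>P\<^sub>1\<close> and the source
      of \<rho> through \<open>P\<^sub>2\<close>. After \<open>P\<close> both restrict along the
      same composite by \<open>KK\<close>.\<close>
    have "ftor_comp M\<^sub>1 (ftor_comp M\<^sub>1 l\<^sub>2 P\<^sub>1) (ftor_comp M\<^sub>1 P l) =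
        ftor_comp M\<^sub>1 (ftor_comp M\<^sub>1 l\<^sub>2 P\<^sub>2) (ftor_comp M\<^sub>1 P l)"
    proof (rule ftor_eqI[OF is_ftor_comp[OF Pl is_ftor_comp[OF P1 l2]]
          is_ftor_comp[OF Pl is_ftor_comp[OF P2 l2]]])
      fix F assume F: "F \<in> Obj M\<^sub>1"
      then have "is_ftor I\<^sub>0 C (FObj l F)" using is_ftorD(3)[OF l] by simp
      then show "FObj (ftor_comp M\<^sub>1 (ftor_comp M\<^sub>1 l\<^sub>2 P\<^sub>1) (ftor_comp M\<^sub>1 P l)) F =
          FObj (ftor_comp M\<^sub>1 (ftor_comp M\<^sub>1 l\<^sub>2 P\<^sub>2) (ftor_comp M\<^sub>1 P l)) F"
        using F is_ftorD(3)[OF Pl F]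
        by (simp add: ftor_comp_simps P_def P\<^sub>1_def P\<^sub>2_def M\<^sub>1_def precomp_ftor_simps
            ftor_comp_assoc[OF K1] ftor_comp_assoc[OF K2] KK)
    next
      fix t assume t: "t \<in> Arr M\<^sub>1"
      then have "is_ntrans I\<^sub>0 C (FArr l t)"
        using homD(1)[OF is_ftorD(4)[OF l Arr_hom[OF t]]] by simp
      then show "FArr (ftor_comp M\<^sub>1 (ftor_comp M\<^sub>1 l\<^sub>2 P\<^sub>1) (ftor_comp M\<^sub>1 P l)) t =
          FArr (ftor_comp M\<^sub>1 (ftor_comp M\<^sub>1 l\<^sub>2 P\<^sub>2) (ftor_comp M\<^sub>1 P l)) t"
        using t homD(1)[OF is_ftorD(4)[OF Pl Arr_hom[OF t]]]
        by (simp add: ftor_comp_simps P_def P\<^sub>1_def P\<^sub>2_def M\<^sub>1_def precomp_ftor_simps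
            whisker_right_assoc[OF K1] whisker_right_assoc[OF K2] KK)
    qed
    then have \<sigma>: "\<sigma> \<in> hom (ftor_cat M\<^sub>1 M\<^sub>1) (ftor_comp M\<^sub>1 (ftor_comp M\<^sub>1 l\<^sub>2 P\<^sub>1) (id_ftor M\<^sub>1))
        (ftor_comp M\<^sub>1 (ftor_comp M\<^sub>1 l\<^sub>2 P\<^sub>2) (ftor_comp M\<^sub>1 P l))"
      using whisker_left_hom[OF \<eta> is_ftor_comp[OF P1 l2]] by (simp only: \<sigma>_def)
    have \<tau>: "\<tau> \<in> hom (ftor_cat M\<^sub>1 M\<^sub>1) (ftor_comp M\<^sub>1 (ftor_comp M\<^sub>1 l\<^sub>2 P\<^sub>1) (id_ftor M\<^sub>1))
        (ftor_comp M\<^sub>1 (id_ftor M\<^sub>1) (ftor_comp M\<^sub>1 P l))"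
      using \<sigma> whisker_right_hom[OF \<epsilon>2 Pl] unfolding \<tau>_def \<rho>_def by (rule ftor_cat_Cmp_hom)
    have "is_iso M\<^sub>1 (At \<tau> F)" if "F \<in> Obj M\<^sub>1" for F
    proof -
      have F: "is_ftor I\<^sub>1 C F" using that by (simp add: M\<^sub>1_def)
      define G where "G = ftor_comp I\<^sub>2 F K\<^sub>1"
      define H where "H = FObj l F"
      have G: "is_ftor I\<^sub>2 C G" unfolding G_def using K1 F by (rule is_ftor_comp)
      have H: "is_ftor I\<^sub>0 C H" using is_ftorD(3)[OF l that] by (simp add: H_def)
      have HK: "is_ftor I\<^sub>1 C (ftor_comp I\<^sub>1 H K)" using K H by (rule is_ftor_comp)
      have e: "At \<eta> F \<in> hom (ftor_cat I\<^sub>1 C) F (ftor_comp I\<^sub>1 H K)"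
        using adjunctionD(3)[OF adj that] H by (simp add: P_def precomp_ftor_simps H_def M\<^sub>1_def)
      define f where "f = whisker_right I\<^sub>2 (At \<eta> F) K\<^sub>1"
      \<comment> \<open>Whiskering gives a target restricted along \<open>K\<^sub>1\<close>;
        rewriting with \<open>KK\<close> presents it as a pull-back along \<open>K\<^sub>2\<close>,
        so that the adjunction of \<open>l\<^sub>2\<close> applies.\<close>
      have f: "f \<in> hom (ftor_cat I\<^sub>2 C) G (FObj P\<^sub>2 (ftor_comp I\<^sub>1 H K))"
        using whisker_right_hom[OF e K1] HK unfolding f_def G_def
        by (simp add: P\<^sub>2_def precomp_ftor_simps ftor_comp_assoc[OF K1] ftor_comp_assoc[OF K2] KK)
      have HK_Obj: "ftor_comp I\<^sub>1 H K \<in> Obj M\<^sub>1" using HK by (simp add: M\<^sub>1_def)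
      \<comment> \<open>The transpose of \<open>f\<close> under \<open>adj2\<close>. Evaluating
        \<sigma> and \<rho> at \<open>F\<close> gives exactly its two factors.\<close>
      define t where "t = Cmp M\<^sub>1 (At \<epsilon>\<^sub>2 (ftor_comp I\<^sub>1 H K)) (FArr l\<^sub>2 f)"
      have "At \<eta> F \<in> Arr M\<^sub>1" using homD(1)[OF e] by (simp add: M\<^sub>1_def)
      moreover have "FArr P\<^sub>1 (At \<eta> F) = f"
        using homD(1)[OF e] by (simp add: P\<^sub>1_def precomp_ftor_simps f_def)
      ultimately have "At \<sigma> F = FArr l\<^sub>2 f"
        using that by (simp add: \<sigma>_def whisker_left_def ftor_comp_simps)
      moreover have "FObj P H = ftor_comp I\<^sub>1 H K"
        using H by (simp add: P_def precomp_ftor_simps)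
      then have "At \<rho> F = At \<epsilon>\<^sub>2 (ftor_comp I\<^sub>1 H K)"
        using that by (simp add: \<rho>_def whisker_right_def ftor_comp_simps H_def[symmetric])
      ultimately have "At \<tau> F = t"
        using that by (simp add: \<tau>_def t_def)
      moreover have "is_iso M\<^sub>1 t"
      proof -
        note transpose = adjunction_transpose[OF adj2 HK_Obj f, folded t_def]
        have t: "t \<in> hom (ftor_cat I\<^sub>1 C) (FObj l\<^sub>2 G) (ftor_comp I\<^sub>1 H K)"
          using transpose(1) by (simp add: M\<^sub>1_def)
        have l2G: "is_ftor I\<^sub>1 C (FObj l\<^sub>2 G)" using t by (rule hom_ftor_catD)
        \<comment> \<open>The defining property of the transpose, read at the object
          \<open>s\<close>: the unit of \<open>l\<^sub>2\<close> followed by \<open>t\<close> is the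
          unit of \<open>l\<close> at \<open>FObj K\<^sub>1 s\<close>.\<close>
        have t_unit: "Cmp C (At t (FObj K\<^sub>2 s)) (At (At \<eta>\<^sub>2 G) s) = At (At \<eta> F) (FObj K\<^sub>1 s)"
          if "s \<in> Obj I\<^sub>2" for s
          using arg_cong[OF transpose(2), of "\<lambda>t. At t s"] that homD(1)[OF t]
          by (simp add: P\<^sub>2_def precomp_ftor_simps whisker_right_def f_def)
        have e2: "At \<eta>\<^sub>2 G \<in> hom (ftor_cat I\<^sub>2 C) G (ftor_comp I\<^sub>2 (FObj l\<^sub>2 G) K\<^sub>2)"
          using adjunctionD(3)[OF adj2, of G] G l2G by (simp add: P\<^sub>2_def precomp_ftor_simps)
        show ?thesis
          unfolding M\<^sub>1_def
        proof (rule is_iso_ftor_cat[OF t])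
          fix q assume q: "q \<in> Obj I\<^sub>1"
          note lifts = elements_comma_lift[OF \<kappa> small a a1 a2 square q[unfolded I\<^sub>1_def],
              folded I\<^sub>0_def I\<^sub>1_def I\<^sub>2_def K_def K\<^sub>1_def K\<^sub>2_def]
          show "is_iso C (At t q)"
          proof (rule comma_colimits_is_iso[OF K K1 K2 F lifts, folded G_def])
            show "is_colimit (comma I\<^sub>2 I\<^sub>1 K\<^sub>2 q) C (comma_diagram I\<^sub>2 I\<^sub>1 K\<^sub>2 q G) (FObj (FObj l\<^sub>2 G) q)
                (\<lambda>(p, u). Cmp C (FArr (FObj l\<^sub>2 G) u) (At (At \<eta>\<^sub>2 G) p))"
              using left_adjoint_pointwise[OF \<kappa> small_I(3,2) C K2 adj2[unfolded P\<^sub>2_def M\<^sub>1_def] G q] .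
            show "is_colimit (comma I\<^sub>1 I\<^sub>0 K (FObj K q)) C (comma_diagram I\<^sub>1 I\<^sub>0 K (FObj K q) F)
                (FObj H (FObj K q)) (\<lambda>(p, u). Cmp C (FArr H u) (At (At \<eta> F) p))"
              using left_adjoint_pointwise[OF \<kappa> small_I(2,1) C K adj[unfolded P_def M\<^sub>1_def] F
                  is_ftorD(3)[OF K q]] unfolding H_def .
            show "At t q \<in> hom C (FObj (FObj l\<^sub>2 G) q) (FObj H (FObj K q))"
              using hom_ftor_catD(5)[OF t q] q by (simp add: ftor_comp_simps)
            show "FObj K (FObj K\<^sub>1 s) = FObj K (FObj K\<^sub>2 s)" if "s \<in> Obj I\<^sub>2" for s
              using arg_cong[OF KK, of "\<lambda>F. FObj F s"] that by (simp add: ftor_comp_simps)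
            fix s v assume "(s, v) \<in> Obj (comma I\<^sub>2 I\<^sub>1 K\<^sub>2 q)"
            then have s: "s \<in> Obj I\<^sub>2" and v: "v \<in> hom I\<^sub>1 (FObj K\<^sub>2 s) q" by simp_all
            have K2s: "FObj K\<^sub>2 s \<in> Obj I\<^sub>1" using K2 s by (rule is_ftorD)
            have e2s: "At (At \<eta>\<^sub>2 G) s \<in> hom C (FObj G s) (FObj (FObj l\<^sub>2 G) (FObj K\<^sub>2 s))"
              using hom_ftor_catD(5)[OF e2 s] s by (simp add: ftor_comp_simps)
            \<comment> \<open>The value of \<open>t\<close> on the coprojection labelled by
              \<open>v\<close>: naturality of \<open>t\<close> moves it past \<open>v\<close>, and
              then \<open>t_unit\<close> applies. The result is the coprojection of the other
              colimit labelled by \<open>FArr K v\<close>.\<close>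
            have "Cmp C (At t q) (Cmp C (FArr (FObj l\<^sub>2 G) v) (At (At \<eta>\<^sub>2 G) s)) =
                Cmp C (Cmp C (FArr (ftor_comp I\<^sub>1 H K) v) (At t (FObj K\<^sub>2 s))) (At (At \<eta>\<^sub>2 G) s)"
              using C.Cmp_assoc[OF e2s is_ftorD(4)[OF l2G v] hom_ftor_catD(5)[OF t q]]
                hom_ftor_catD(6)[OF t v] by simp
            also have "\<dots> = Cmp C (FArr (ftor_comp I\<^sub>1 H K) v) (At (At \<eta> F) (FObj K\<^sub>1 s))"
              using C.Cmp_assoc[OF e2s hom_ftor_catD(5)[OF t K2s] is_ftorD(4)[OF HK v]]
                t_unit[OF s] by simp
            finally show "Cmp C (At t q) (case (s, v) of (p, u) \<Rightarrow>
                  Cmp C (FArr (FObj l\<^sub>2 G) u) (At (At \<eta>\<^sub>2 G) p)) =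
                (case (FObj K\<^sub>1 s, FArr K v) of (p, u) \<Rightarrow> Cmp C (FArr H u) (At (At \<eta> F) p))"
              using homD(1)[OF v] by (simp add: ftor_comp_simps)
          qed
        qed
      qed
      ultimately show ?thesis by simp
    qed
    with \<tau> have "is_iso (ftor_cat M\<^sub>1 M\<^sub>1) \<tau>" by (rule is_iso_ftor_cat)
    then show ?thesis
      by (simp add: base_change_def fibre_def src pullbacks I\<^sub>1_def[symmetric] M\<^sub>1_def[symmetric]
          \<tau>_def \<rho>_def \<sigma>_def Let_def del: ftor_cat_simps)
  qed
  then show ?thesis
    unfolding exchange_condition_def Let_def fibre_def src tgt pullbacks
      I\<^sub>0_def[symmetric] I\<^sub>1_def[symmetric] I\<^sub>2_def[symmetric] M\<^sub>1_def[symmetric] by blast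
qed

theorem proposition0p6p1:
  fixes \<kappa> :: "'u rel"
    and \<A> :: "('o, 'm) cat"
    and A\<^sub>0 A\<^sub>1 A\<^sub>2 :: "('o, 'm, 'u) presheaf"
    and a a\<^sub>1 a\<^sub>2 :: "('o, 'm, 'u) presheaf_arr"
  assumes "infinite_regular \<kappa>"
    and "small_category \<kappa> \<A>"
    and "a \<in> hom (presheaf_cat \<kappa> \<A>) A\<^sub>1 A\<^sub>0"
    and "a\<^sub>1 \<in> hom (presheaf_cat \<kappa> \<A>) A\<^sub>2 A\<^sub>1"
    and "a\<^sub>2 \<in> hom (presheaf_cat \<kappa> \<A>) A\<^sub>2 A\<^sub>1"
    and "cartesian_square (presheaf_cat \<kappa> \<A>) a\<^sub>1 a\<^sub>2 a a"
  shows "exchange_condition \<A> (Set_cat \<kappa>) a a\<^sub>1 a\<^sub>2 \<and>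
    (\<forall>(C :: ('p, 'q) cat) L \<Omega> \<eta> \<epsilon>.
      cocomplete \<kappa> C \<and> beck_monadic (Set_cat \<kappa>) C L \<Omega> \<eta> \<epsilon> \<longrightarrow>
      exchange_condition \<A> C a a\<^sub>1 a\<^sub>2)"
proof (intro conjI allI impI)
  show "exchange_condition \<A> (Set_cat \<kappa>) a a\<^sub>1 a\<^sub>2"
    using assms cocomplete_Set_cat[OF assms(1)] by (rule exchange_condition_cocomplete)
next
  fix C :: "('p, 'q) cat" and L \<Omega> \<eta> \<epsilon>
  assume "cocomplete \<kappa> C \<and> beck_monadic (Set_cat \<kappa>) C L \<Omega> \<eta> \<epsilon>"
  then have "cocomplete \<kappa> C" ..
  with assms show "exchange_condition \<A> C a a\<^sub>1 a\<^sub>2"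
    by (rule exchange_condition_cocomplete)
qed

end
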